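(* Let $0<\sigma<1$. Let $v$ be a function on the torus $\mathbb{T}^n$ such that $$\sum_{k\in\mathbb{Z}^n\setminus\{0\}}|c_k(v)|\frac{e^{-|k|^2}}{|k|}<\infty.$$ Then its repetition $Rv$ is a function in $L_\sigma$ which defines a distribution in $\mathcal{S}_\sigma'$ and such that $$\int_{\mathbb{R}^n}(Rv)\,(-\Delta_{\mathbb{R}^n})^\sigma\varphi\,dx=\int_{\mathbb{T}^n}v\,(-\Delta_{\mathbb{T}^n})^\sigma(p_\Sigma\varphi)\,dz,\qquad \varphi\in\mathcal{S}.$$ In other words, when evaluated in periodizations of Schwartz functions, the periodic distribution $(-\Delta_{\mathbb{T}^n})^\sigma v$ coincides with the distributional fractional Laplacian on $\mathbb{R}^n$ of the repetition $Rv$.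
   Context: $\mathbb{T}^n=\mathbb{R}^n/(2\pi\mathbb{Z}^n)$ is identified with $Q_n=(-\pi,\pi]^n$; integration $dz$ on $\mathbb{T}^n$ is Lebesgue integration over $Q_n$. $\mathcal{S}$ is the Schwartz class on $\mathbb{R}^n$, and $c_k(v)$ is the $k$-th Fourier coefficient of $v:\mathbb{T}^n\to\mathbb{R}$, $k\in\mathbb{Z}^n$, normalized so that the Fourier series of $v$ is $\sum_k c_k(v)e^{ik\cdot z}$. The Fourier transform $\widehat{\varphi}$ is normalized so that $\varphi(x)=\int_{\mathbb{R}^n}\widehat\varphi(\xi)e^{ix\cdot\xi}\,d\xi$. Fractional Laplacians: for $\varphi\in\mathcal{S}$, $(-\Delta_{\mathbb{R}^n})^\sigma\varphi(x)=\int_{\mathbb{R}^n}|\xi|^{2\sigma}\widehat\varphi(\xi)e^{ix\cdot\xi}\,d\xi$; for $\phi\in C^\infty(\mathbb{T}^n)$, $(-\Delta_{\mathbb{T}^n})^\sigma\phi(z)=\sum_{k\in\mathbb{Z}^n}|k|^{2\sigma}c_k(\phi)e^{ik\cdot z}$, which is again in $C^\infty(\mathbb{T}^n)$. For a function $v$ that is a periodic distribution on $\mathbb{T}^n$, $(-\Delta_{\mathbb{T}^n})^\sigma v$ is the periodic distribution $\phi\mapsto\int_{\mathbb{T}^n}v\,(-\Delta_{\mathbb{T}^n})^\sigma\phi\,dz$, $\phi\in C^\infty(\mathbb{T}^n)$. For a locally integrable function $u$ in $\mathcal{S}_\sigma'$, $(-\Delta_{\mathbb{R}^n})^\sigma u$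 is defined by $\varphi\mapsto\int_{\mathbb{R}^n}u\,(-\Delta_{\mathbb{R}^n})^\sigma\varphi\,dx$, $\varphi\in\mathcal{S}$. Spaces: $\mathcal{S}_\sigma=\{\varphi\in C^\infty(\mathbb{R}^n):(1+|x|^2)^{\frac{n+2\sigma}{2}}D^\gamma\varphi(x)\in L^\infty(\mathbb{R}^n)\text{ for all derivatives }D^\gamma\}$, and $\mathcal{S}_\sigma'$ is its dual. $(-\Delta_{\mathbb{R}^n})^\sigma$ maps $\mathcal{S}$ into $\mathcal{S}_\sigma$. $L_\sigma=L^1(\mathbb{R}^n,(1+|x|^2)^{-\frac{n+2\sigma}{2}}dx)$. Repetition: $(Rv)(x)=\sum_{k\in\mathbb{Z}^n}v(x-2\pi k)\chi_{Q_n}(x-2\pi k)$, $x\in\mathbb{R}^n$, i.e. the $Q_n$-periodic function on $\mathbb{R}^n$ that coincides with $v$ on $Q_n$. Periodization: for $u:\mathbb{R}^n\to\mathbb{R}$, $(p_\Sigma u)(z)=\sum_{k\in\mathbb{Z}^n}u(z+2\pi k)$, $z\in\mathbb{T}^n$. *)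

theory Defs
  imports "HOL-Analysis.Analysis"
begin

definition partial_deriv :: "'n::finite \<Rightarrow> (real^'n \<Rightarrow> complex) \<Rightarrow> real^'n \<Rightarrow> complex" where
  "partial_deriv i f x = vector_derivative (\<lambda>t. f (x + t *\<^sub>R axis i 1)) (at 0)"

text \<open>Derivatives $D^\gamma$ are indexed by the list of directions in which one differentiates
  successively, instead of by a multi-index. On smooth functions the order is
  irrelevant, so both index sets give the same family of derivatives.\<close>

primrec iter_deriv :: "'n::finite list \<Rightarrow> (real^'n \<Rightarrow> complex) \<Rightarrow> real^'n \<Rightarrow> complex" where
  "iter_deriv [] f = f"
| "iter_deriv (i # \<gamma>) f = partial_deriv i (iter_deriv \<gamma> f)"

definition smooth :: "(real^'n::finite \<Rightarrow> complex) \<Rightarrow> bool" where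
  "smooth f \<longleftrightarrow> (\<forall>\<gamma> x. iter_deriv \<gamma> f differentiable (at x))"

definition schwartz :: "(real^'n::finite \<Rightarrow> complex) set" where
  "schwartz = {\<phi>. smooth \<phi> \<and>
     (\<forall>\<gamma> (N::nat). bounded (range (\<lambda>x. (1 + (norm x)\<^sup>2) ^ N *\<^sub>R iter_deriv \<gamma> \<phi> x)))}"

definition weight :: "real \<Rightarrow> real^'n::finite \<Rightarrow> real" where
  "weight \<sigma> x = (1 + (norm x)\<^sup>2) powr ((real CARD('n) + 2 * \<sigma>) / 2)"

definition S_space :: "real \<Rightarrow> (real^'n::finite \<Rightarrow> complex) set" where
  "S_space \<sigma> = {\<phi>. smooth \<phi> \<and> (\<forall>\<gamma>. bounded (range (\<lambda>x. weight \<sigma> x *\<^sub>R iter_deriv \<gamma> \<phi> x)))}"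

definition S_seminorm :: "real \<Rightarrow> 'n::finite list \<Rightarrow> (real^'n \<Rightarrow> complex) \<Rightarrow> real" where
  "S_seminorm \<sigma> \<gamma> \<phi> = (SUP x. norm (weight \<sigma> x *\<^sub>R iter_deriv \<gamma> \<phi> x))"

definition S_topology :: "real \<Rightarrow> (real^'n::finite \<Rightarrow> complex) topology" where
  "S_topology \<sigma> = topology_generated_by
     {{\<psi> \<in> S_space \<sigma>. S_seminorm \<sigma> \<gamma> (\<lambda>x. \<psi> x - \<phi> x) < \<epsilon>} | \<gamma> \<phi> \<epsilon>. \<phi> \<in> S_space \<sigma> \<and> 0 < \<epsilon>}"

definition S_dual :: "real \<Rightarrow> ((real^'n::finite \<Rightarrow> complex) \<Rightarrow> complex) set" where
  "S_dual \<sigma> = {T.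
     (\<forall>\<phi>\<in>S_space \<sigma>. \<forall>\<psi>\<in>S_space \<sigma>. T (\<lambda>x. \<phi> x + \<psi> x) = T \<phi> + T \<psi>) \<and>
     (\<forall>c. \<forall>\<phi>\<in>S_space \<sigma>. T (\<lambda>x. c * \<phi> x) = c * T \<phi>) \<and>
     continuous_map (S_topology \<sigma>) euclidean T}"

definition defines_S_distribution :: "real \<Rightarrow> (real^'n::finite \<Rightarrow> real) \<Rightarrow> bool" where
  "defines_S_distribution \<sigma> u \<longleftrightarrow>
     (\<forall>\<phi>\<in>S_space \<sigma>. integrable lebesgue (\<lambda>x. u x *\<^sub>R \<phi> x)) \<and>
     (\<lambda>\<phi>. LINT x|lebesgue. u x *\<^sub>R \<phi> x) \<in> S_dual \<sigma>"

definition L_space :: "real \<Rightarrow> (real^'n::finite \<Rightarrow> real) set" where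
  "L_space \<sigma> = {u. integrable (density lebesgue (\<lambda>x. ennreal (1 / weight \<sigma> x))) u}"

text \<open>A function on the torus is represented by a function on $\mathbb{R}^n$ of which only the
  values on the fundamental cell matter; smooth functions on the torus are
  represented by their smooth periodic extensions.\<close>

definition cell :: "(real^'n::finite) set" where
  "cell = {x. \<forall>i. - pi < x $ i \<and> x $ i \<le> pi}"

definition lattice_vec :: "int^'n::finite \<Rightarrow> real^'n" where
  "lattice_vec k = (\<chi> i. of_int (k $ i))"

definition torus_smooth :: "(real^'n::finite \<Rightarrow> complex) set" where
  "torus_smooth = {f. smooth f \<and> (\<forall>k x. f (x + (2 * pi) *\<^sub>R lattice_vec k) = f x)}"

definition fourier_coeff :: "(real^'n::finite \<Rightarrow> complex) \<Rightarrow> int^'n \<Rightarrow> complex" where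
  "fourier_coeff f k =
     (1 / (2 * pi) ^ CARD('n)) *\<^sub>R (LINT z:cell|lebesgue. f z * cis (- (lattice_vec k \<bullet> z)))"

definition repetition :: "(real^'n::finite \<Rightarrow> real) \<Rightarrow> real^'n \<Rightarrow> real" where
  "repetition v x = (\<Sum>\<^sub>\<infinity>k. v (x - (2 * pi) *\<^sub>R lattice_vec k) *
                          indicator cell (x - (2 * pi) *\<^sub>R lattice_vec k))"

definition periodization :: "(real^'n::finite \<Rightarrow> complex) \<Rightarrow> real^'n \<Rightarrow> complex" where
  "periodization u z = (\<Sum>\<^sub>\<infinity>k. u (z + (2 * pi) *\<^sub>R lattice_vec k))"

text \<open>The factor $(2\pi)^{-n}$ sits in the forward transform, so that the inversion formula
  reads $\varphi(x) = \int \widehat\varphi(\xi) e^{i x\cdot\xi}\,d\xi$.\<close>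

definition fourier :: "(real^'n::finite \<Rightarrow> complex) \<Rightarrow> real^'n \<Rightarrow> complex" where
  "fourier \<phi> \<xi> = (1 / (2 * pi) ^ CARD('n)) *\<^sub>R (LINT x|lebesgue. \<phi> x * cis (- (x \<bullet> \<xi>)))"

definition frac_laplacian :: "real \<Rightarrow> (real^'n::finite \<Rightarrow> complex) \<Rightarrow> real^'n \<Rightarrow> complex" where
  "frac_laplacian \<sigma> \<phi> x =
     (LINT \<xi>|lebesgue. norm \<xi> powr (2 * \<sigma>) *\<^sub>R (fourier \<phi> \<xi> * cis (x \<bullet> \<xi>)))"

definition torus_frac_laplacian :: "real \<Rightarrow> (real^'n::finite \<Rightarrow> complex) \<Rightarrow> real^'n \<Rightarrow> complex" where
  "torus_frac_laplacian \<sigma> \<phi> z =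
     (\<Sum>\<^sub>\<infinity>k. norm (lattice_vec k) powr (2 * \<sigma>) *\<^sub>R (fourier_coeff \<phi> k * cis (lattice_vec k \<bullet> z)))"

text \<open>Both functionals are meant on test functions only: \<^term>\<open>schwartz\<close> for the first,
  \<^term>\<open>torus_smooth\<close> for the second.\<close>

definition frac_laplacian_dist ::
    "real \<Rightarrow> (real^'n::finite \<Rightarrow> real) \<Rightarrow> (real^'n \<Rightarrow> complex) \<Rightarrow> complex" where
  "frac_laplacian_dist \<sigma> u \<phi> = (LINT x|lebesgue. u x *\<^sub>R frac_laplacian \<sigma> \<phi> x)"

definition torus_frac_laplacian_dist ::
    "real \<Rightarrow> (real^'n::finite \<Rightarrow> real) \<Rightarrow> (real^'n \<Rightarrow> complex) \<Rightarrow> complex" where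
  "torus_frac_laplacian_dist \<sigma> v \<phi> = (LINT z:cell|lebesgue. v z *\<^sub>R torus_frac_laplacian \<sigma> \<phi> z)"

end

theory Submission
  imports Defs
begin

text \<open>Let $g = (-\Delta)^\sigma \varphi$ and $W(\xi) = |\xi|^{2\sigma} \widehat\varphi(\xi)$.
  Cutting the integral over $\mathbb{R}^n$ into translates of the cell reduces the identity to
  $\sum_k g(z + 2\pi k) = \sum_k |k|^{2\sigma} \widehat\varphi(k) e^{i k \cdot z}$ and
  $c_k(p_\Sigma \varphi) = \widehat\varphi(k)$. The former is Poisson summation on the frequency
  side: the Fourier transform of $y \mapsto W(y/2\pi) e^{i y \cdot z/2\pi}$ at $k$ is
  $g(z - 2\pi k)$, so that all one needs about $g$ is the decay
  $|g(x)| \le C (1 + |x|^2)^{-(n+2\sigma)/2}$, which also gives integrability against $Rv$.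
  Since $c |\xi|^{2\sigma} = \int (1 - \cos (y \cdot \xi)) |y|^{-n-2\sigma} dy$, Fourier inversion
  for $\varphi$ yields
  $c\, g(x) = \int (\varphi(x) - \frac12 (\varphi(x+y) + \varphi(x-y))) |y|^{-n-2\sigma} dy$,
  and the decay follows by shifting weights with
  $1 + |x+y|^2 \le 2 (1 + |x|^2) (1 + |y|^2)$.\<close>

text \<open>The symbol |\<xi>|^(2s) is in general not smooth at the origin after multiplication by
  the transform of \<phi>, so g does not inherit rapid decay, and plain integration by parts in
  \<xi> stops short of the exponent n + 2s. That exponent is the decay rate of the kernel
  |y|^(-n-2s), which is why g is rewritten as an integral over y before it is estimated. The second
  difference is symmetric because 1 - cos is quadratic at 0; the integral then converges absolutely
  for every s < 1 and Fubini applies.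

  Since W need not be a Schwartz function, Poisson summation is proved for continuous functions with
  decay whose transform is absolutely summable over the lattice. It rests on the uniqueness of
  Fourier coefficients of continuous functions, and in turn it yields the Fourier inversion used for
  \<phi>. The constant c is not computed: rotation invariance and homogeneity produce it, and only c
  > 0 is used.

  Integrability of v over the cell enters through one majorant, a summable lattice sequence times
  |v|.\<close>

abbreviation per :: "int^'n::finite \<Rightarrow> real^'n" where
  "per k \<equiv> (2 * pi) *\<^sub>R lattice_vec k"

section \<open>Polynomial weights and how they change under translation\<close>

lemma one_plus_norm_add_le:
  fixes x y :: "'a::real_normed_vector"
  shows "1 + (norm (x + y))\<^sup>2 \<le> 2 * (1 + (norm x)\<^sup>2) * (1 + (norm y)\<^sup>2)"
proof -
  have "(norm (x + y))\<^sup>2 \<le> (norm x + norm y)\<^sup>2"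
    by (intro power_mono norm_triangle_ineq) auto
  also have "\<dots> \<le> 2 * (norm x)\<^sup>2 + 2 * (norm y)\<^sup>2"
    using zero_le_power2[of "norm x - norm y"] by (simp add: power2_eq_square algebra_simps)
  finally have "(norm (x + y))\<^sup>2 \<le> 2 * (norm x)\<^sup>2 + 2 * (norm y)\<^sup>2" .
  moreover have "0 \<le> (norm x)\<^sup>2 * (norm y)\<^sup>2" by simp
  moreover have "0 \<le> (norm x)\<^sup>2" "0 \<le> (norm y)\<^sup>2" by simp_all
  ultimately have "1 + (norm (x + y))\<^sup>2
      \<le> 2 + 2 * (norm x)\<^sup>2 + 2 * (norm y)\<^sup>2 + 2 * ((norm x)\<^sup>2 * (norm y)\<^sup>2)"
    by linarith
  then show ?thesis by (simp add: algebra_simps)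
qed

lemma weight_pos [simp]: "0 < weight s x"
  proof -
  have "1 + (norm x)\<^sup>2 \<noteq> 0" by (metis add_pos_nonneg less_irrefl zero_le_power2 zero_less_one)
  then show ?thesis by (simp add: weight_def)
qed

lemma weight_nonneg [simp]: "0 \<le> weight s x"
  by (simp add: less_imp_le)

lemma weight_nonzero [simp]: "weight s x \<noteq> 0"
  using weight_pos[of s x] by linarith

lemma weight_minus [simp]: "weight s (- x) = weight s x"
  by (simp add: weight_def)

lemma weight_add_le:
  fixes x y :: "real^'n::finite"
  assumes "0 < s"
  shows "weight s (x + y) \<le> 2 powr ((real CARD('n) + 2 * s) / 2) * weight s x * weight s y"
proof -
  have "weight s (x + y) \<le> (2 * (1 + (norm x)\<^sup>2) * (1 + (norm y)\<^sup>2)) powr ((real CARD('n) + 2 * s) / 2)"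
    unfolding weight_def using assms one_plus_norm_add_le[of x y]
    by (intro powr_mono2) auto
  also have "\<dots> = 2 powr ((real CARD('n) + 2 * s) / 2) * weight s x * weight s y"
    unfolding weight_def by (simp only: powr_mult)
  finally show ?thesis .
qed

text \<open>Peetre's inequality, from x = (x + y) + (- y) and the evenness of the weight. Decay is
  transferred from a point to a translate of it through this bound.\<close>

lemma inverse_weight_le:
  fixes x y :: "real^'n::finite"
  assumes "0 < s"
  shows "1 / weight s (x + y) \<le> 2 powr ((real CARD('n) + 2 * s) / 2) * weight s y / weight s x"
  using weight_add_le[OF assms, of "x + y" "- y"]
  by (simp add: field_simps)

lemma continuous_on_weight [continuous_intros]: "continuous_on A (weight s)"
  unfolding weight_def by (intro continuous_intros) (auto simp: add_nonneg_eq_0_iff)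

lemma weight_measurable [measurable]: "weight s \<in> borel_measurable borel"
  by (intro borel_measurable_continuous_onI continuous_on_weight)

text \<open>The Schwartz bounds carry natural exponents, the weight a real one. For s <= 1 the
  exponent n/2 + s is at most n + 1.\<close>

lemma weight_le_power:
  fixes x :: "real^'n::finite"
  assumes "s \<le> 1"
  shows "weight s x \<le> (1 + (norm x)\<^sup>2) ^ (CARD('n) + 1)"
proof -
  have "weight s x \<le> (1 + (norm x)\<^sup>2) powr real (CARD('n) + 1)"
    unfolding weight_def using assms by (intro powr_mono) auto
  also have "\<dots> = (1 + (norm x)\<^sup>2) ^ (CARD('n) + 1)"
    by (rule powr_realpow) (simp add: add_pos_nonneg)
  finally show ?thesis .
qed

lemma weight_unit_ball_le:
  fixes u :: "real^'n::finite"
  assumes "0 < s" "norm u \<le> 1"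
  shows "weight s u \<le> 2 powr ((real CARD('n) + 2 * s) / 2)"
proof -
  have "(norm u)\<^sup>2 \<le> 1" using assms(2) by (simp add: power_le_one)
  then show ?thesis unfolding weight_def using assms(1) by (intro powr_mono2) auto
qed

text \<open>Serves the mean value estimates: a derivative evaluated within distance 1 of x may be
  bounded through the weight at x itself.\<close>

lemma inverse_weight_unit_shift_le:
  fixes x u :: "real^'n::finite"
  assumes "0 < s" "norm u \<le> 1"
  shows "1 / weight s (x + u) \<le> (2 powr ((real CARD('n) + 2 * s) / 2))\<^sup>2 / weight s x"
proof -
  have "1 / weight s (x + u) \<le> 2 powr ((real CARD('n) + 2 * s) / 2) * weight s u / weight s x"
    by (rule inverse_weight_le[OF assms(1)])
  also have "\<dots> \<le> 2 powr ((real CARD('n) + 2 * s) / 2) * 2 powr ((real CARD('n) + 2 * s) / 2) / weight s x"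
    using weight_unit_ball_le[OF assms] by (intro divide_right_mono mult_left_mono) auto
  finally show ?thesis by (simp add: power2_eq_square)
qed

subsection \<open>The fundamental cell and its translates\<close>

lemma cell_subset_cbox: "cell \<subseteq> cbox (\<chi> i. - pi) (\<chi> i. pi)"
  by (auto simp: cell_def mem_box_cart less_imp_le)

lemma cell_borel [measurable]: "cell \<in> sets borel"
proof -
  have "cell = (\<Inter>i\<in>UNIV. {x::real^'a. - pi < x $ i \<and> x $ i \<le> pi})"
    by (auto simp: cell_def)
  also have "\<dots> \<in> sets borel" by measurable
  finally show ?thesis .
qed

lemma cell_lmeasurable [simp]: "cell \<in> lmeasurable"
proof (rule bounded_set_imp_lmeasurable)
  show "bounded cell" using bounded_subset[OF bounded_cbox cell_subset_cbox] .
qed simp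

lemma lattice_vec_add: "lattice_vec (j + k) = lattice_vec j + lattice_vec k"
  by (simp add: lattice_vec_def vec_eq_iff)

lemma lattice_vec_minus [simp]: "lattice_vec (- k) = - lattice_vec k"
  by (simp add: lattice_vec_def vec_eq_iff)

lemma lattice_vec_0 [simp]: "lattice_vec 0 = 0"
  by (simp add: lattice_vec_def vec_eq_iff)

lemma cell_translate_unique:
  fixes x :: "real^'n::finite"
  obtains k where "x - per k \<in> cell" "\<And>l. x - per l \<in> cell \<Longrightarrow> l = k"
proof -
  \<comment> \<open>The cell is open at - pi and closed at pi, so the index of the translate that
    contains x is a ceiling, not a floor.\<close>
  define k :: "int^'n" where "k = (\<chi> i. \<lceil>(x $ i - pi) / (2 * pi)\<rceil>)"
  have *: "- pi < x $ i - 2 * pi * of_int m \<and> x $ i - 2 * pi * of_int m \<le> pi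
      \<longleftrightarrow> m = \<lceil>(x $ i - pi) / (2 * pi)\<rceil>" for i m
  proof -
    have "m = \<lceil>(x $ i - pi) / (2 * pi)\<rceil> \<longleftrightarrow>
        of_int m - 1 < (x $ i - pi) / (2 * pi) \<and> (x $ i - pi) / (2 * pi) \<le> of_int m"
      by (metis ceiling_eq_iff)
    also have "\<dots> \<longleftrightarrow> - pi < x $ i - 2 * pi * of_int m \<and> x $ i - 2 * pi * of_int m \<le> pi"
      by (simp add: field_simps)
    finally show ?thesis by simp
  qed
  have "x - per l \<in> cell \<longleftrightarrow> l = k" for l
    using * by (auto simp: cell_def lattice_vec_def k_def vec_eq_iff)
  then show ?thesis using that by blast
qed

lemma repetition_eq:
  assumes "x - per k \<in> cell"
  shows "repetition v x = v (x - per k)"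
proof -
  have "l = k" if "x - per l \<in> cell" for l
    using cell_translate_unique[of x] assms that by metis
  then have "repetition v x = (\<Sum>\<^sub>\<infinity>l\<in>{k}. v (x - per l) * indicator cell (x - per l))"
    unfolding repetition_def by (intro infsum_cong_neutral) (auto simp: indicator_def)
  then show ?thesis using assms by simp
qed

lemma infinite_UNIV_lattice: "infinite (UNIV :: (int^'n::finite) set)"
proof
  assume "finite (UNIV :: (int^'n) set)"
  then have "finite ((\<lambda>k::int^'n. k $ undefined) ` UNIV)" by simp
  moreover have "(\<lambda>k::int^'n. k $ undefined) ` UNIV = UNIV"
    by (auto intro!: image_eqI[where x="\<chi> i. _"])
  ultimately show False by simp
qed

text \<open>The library theorems on termwise integration and differentiation are stated for
  series indexed by the natural numbers.\<close>

definition enum_lattice :: "nat \<Rightarrow> int^'n::finite" where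
  "enum_lattice = from_nat_into UNIV"

lemma bij_enum_lattice: "bij_betw enum_lattice UNIV UNIV"
  unfolding enum_lattice_def
  by (rule bij_betw_from_nat_into) (use infinite_UNIV_lattice in auto)

lemma summable_enum_lattice:
  fixes f :: "int^'n::finite \<Rightarrow> 'b::banach"
  assumes "(\<lambda>k. norm (f k)) summable_on UNIV"
  shows "summable (\<lambda>j. norm (f (enum_lattice j)))"
proof -
  have "(\<lambda>j. norm (f (enum_lattice j))) summable_on UNIV"
    using assms summable_on_reindex_bij_betw[OF bij_enum_lattice, of "\<lambda>k. norm (f k)"] by simp
  then show ?thesis by (rule summable_on_imp_summable)
qed

lemma infsum_enum_lattice:
  fixes f :: "int^'n::finite \<Rightarrow> 'b::banach"
  assumes "(\<lambda>k. norm (f k)) summable_on UNIV"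
  shows "infsum f UNIV = (\<Sum>j. f (enum_lattice j))"
proof -
  note sm = summable_enum_lattice[OF assms]
  have "((\<lambda>j. f (enum_lattice j)) has_sum (\<Sum>j. f (enum_lattice j))) UNIV"
    using norm_summable_imp_has_sum[OF sm summable_sums[OF summable_norm_cancel[OF sm]]] .
  then have "(f has_sum (\<Sum>j. f (enum_lattice j))) UNIV"
    using has_sum_reindex_bij_betw[OF bij_enum_lattice, of f] by simp
  then show ?thesis by (rule infsumI)
qed

section \<open>Translation invariance of Lebesgue measure and unfolding over the cell\<close>

lemma lebesgue_translation_measurable [measurable]:
  fixes c :: "'a::euclidean_space"
  shows "(\<lambda>x. x + c) \<in> lebesgue \<rightarrow>\<^sub>M lebesgue"
  using lebesgue_affine_measurable[of "\<lambda>_. 1" c]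
  by (simp add: euclidean_representation add.commute)

lemma distr_lebesgue_translation:
  fixes c :: "'a::euclidean_space"
  shows "distr lebesgue lebesgue (\<lambda>x. x + c) = lebesgue"
  using lebesgue_affine_euclidean[of "\<lambda>_. 1" c]
  by (simp add: euclidean_representation add.commute density_1)

lemma
  fixes f :: "'a::euclidean_space \<Rightarrow> 'b::{banach, second_countable_topology}"
  assumes "f \<in> borel_measurable lebesgue"
  shows lebesgue_integral_translation: "(LINT x|lebesgue. f (x + c)) = (LINT x|lebesgue. f x)"
    and lebesgue_integrable_translation:
      "integrable lebesgue (\<lambda>x. f (x + c)) \<longleftrightarrow> integrable lebesgue f"
  using integral_distr[OF lebesgue_translation_measurable assms, of c]
    integrable_distr_eq[OF lebesgue_translation_measurable assms, of c]
  by (simp_all add: distr_lebesgue_translation)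

text \<open>The majorant is split into a lattice factor \<open>a\<close> and a cell factor
  \<open>b\<close>, because \<open>b\<close> will be either constant or |v| for a v that is merely
  integrable on the cell. The pieces of F in place and the pieces moved back to the cell have the
  same L1 norms, so one summability statement justifies termwise integration of both series.\<close>

lemma
  fixes F :: "real^'n::finite \<Rightarrow> 'b::{banach, second_countable_topology}"
  assumes F [measurable]: "F \<in> borel_measurable lebesgue"
    and b: "set_integrable lebesgue cell b"
    and a: "a summable_on UNIV" "\<And>k. 0 \<le> a k"
    and bound: "\<And>k z. z \<in> cell \<Longrightarrow> norm (F (z + per k)) \<le> a k * b z"
  shows integrable_unfold: "integrable lebesgue F"
    and set_integrable_periodize: "set_integrable lebesgue cell (\<lambda>z. \<Sum>\<^sub>\<infinity>k. F (z + per k))"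
    and integral_unfold: "(LINT x|lebesgue. F x) = (LINT z:cell|lebesgue. \<Sum>\<^sub>\<infinity>k. F (z + per k))"
proof -
  let ?e = "enum_lattice :: nat \<Rightarrow> int^'n"
  \<comment> \<open>\<open>H j\<close> is the piece of F on the j-th translate of the cell,
    \<open>G j\<close> the same piece moved back to the cell.\<close>
  define G where "G j x = indicator cell x *\<^sub>R F (x + per (?e j))" for j x
  define H where "H j x = indicator cell (x - per (?e j)) *\<^sub>R F x" for j x
  have [measurable]: "H j \<in> borel_measurable lebesgue" for j
  proof -
    have "(\<lambda>x::real^'n. x - per (?e j)) \<in> lebesgue \<rightarrow>\<^sub>M lebesgue"
      using lebesgue_translation_measurable[of "- per (?e j)"] by simp
    moreover have "cell \<in> sets lebesgue" by simp
    ultimately have "(\<lambda>x::real^'n. indicat_real cell (x - per (?e j))) \<in> borel_measurable lebesgue"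
      by measurable
    then show ?thesis unfolding H_def by measurable
  qed
  have GH: "G j x = H j (x + per (?e j))" for j x
    by (simp add: G_def H_def)
  have [measurable]: "G j \<in> borel_measurable lebesgue" for j
    unfolding GH by measurable
  define B where "B x = indicator cell x * \<bar>b x\<bar>" for x
  have B: "integrable lebesgue B"
    unfolding B_def using integrable_norm[OF b[unfolded set_integrable_def]] by (simp add: abs_mult)
  have a_abs: "(\<lambda>k. norm (a k)) summable_on UNIV" using a by simp
  have sum_a: "summable (\<lambda>j. a (?e j))"
    using summable_enum_lattice[OF a_abs] a(2) by simp
  have G_le: "norm (G j x) \<le> a (?e j) * B x" for j x
  proof (cases "x \<in> cell")
    case True
    have "a (?e j) * b x \<le> a (?e j) * \<bar>b x\<bar>" by (intro mult_left_mono a(2)) auto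
    with bound[OF True, of "?e j"] True show ?thesis by (simp add: G_def B_def)
  qed (simp add: G_def B_def)
  have intG: "integrable lebesgue (G j)" for j
  proof (rule Bochner_Integration.integrable_bound[OF integrable_mult_right[OF B, of "a (?e j)"]])
    have "norm (G j x) \<le> norm (a (?e j) * B x)" for x
      using G_le[of j x] by simp
    then show "AE x in lebesgue. norm (G j x) \<le> norm (a (?e j) * B x)" by simp
  qed simp
  then have intH: "integrable lebesgue (H j)" for j
    using lebesgue_integrable_translation[of "H j" "per (?e j)"] by (simp add: GH[abs_def])
  have eqGH: "(LINT x|lebesgue. H j x) = (LINT x|lebesgue. G j x)" for j
    using lebesgue_integral_translation[of "H j" "per (?e j)"] by (simp add: GH)
  have eqnGH: "(LINT x|lebesgue. norm (H j x)) = (LINT x|lebesgue. norm (G j x))" for j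
    using lebesgue_integral_translation[of "\<lambda>x. norm (H j x)" "per (?e j)"] by (simp add: GH)
  have sumG: "summable (\<lambda>j. LINT x|lebesgue. norm (G j x))"
  proof (rule summable_comparison_test')
    show "summable (\<lambda>j. a (?e j) * (LINT x|lebesgue. B x))"
      by (intro summable_mult2 sum_a)
    fix j
    have "(LINT x|lebesgue. norm (G j x)) \<le> (LINT x|lebesgue. a (?e j) * B x)"
      using G_le by (intro integral_mono integrable_norm intG integrable_mult_right[OF B])
    then show "norm (LINT x|lebesgue. norm (G j x)) \<le> a (?e j) * (LINT x|lebesgue. B x)"
      by simp
  qed
  have summ: "summable (\<lambda>j. norm (G j x))" for x
    by (rule summable_comparison_test'[OF summable_mult2[OF sum_a, of "B x"]]) (use G_le in simp)
  \<comment> \<open>The translates partition the space, so at each point at most one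
    \<open>H j\<close> is nonzero and the series sums to F.\<close>
  have H_single: "\<exists>j0. \<forall>j. H j x = (if j = j0 then F x else 0)" for x
  proof -
    obtain k where k: "x - per k \<in> cell" "\<And>l. x - per l \<in> cell \<Longrightarrow> l = k"
      using cell_translate_unique[of x] by blast
    obtain j0 where j0: "?e j0 = k"
      using bij_betw_imp_surj_on[OF bij_enum_lattice] by (metis surjD)
    have "x - per (?e j) \<in> cell \<longleftrightarrow> j = j0" for j
    proof
      assume "x - per (?e j) \<in> cell"
      then have "?e j = ?e j0" using k(2) j0 by blast
      then show "j = j0" using inj_onD[OF bij_betw_imp_inj_on[OF bij_enum_lattice]] by blast
    qed (use k(1) j0 in blast)
    then have "H j x = (if j = j0 then F x else 0)" for j
      by (simp add: H_def indicator_def)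
    then show ?thesis by blast
  qed
  have H_sums: "(\<lambda>j. H j x) sums F x" for x
  proof -
    obtain j0 where "\<forall>j. H j x = (if j = j0 then F x else 0)" using H_single by blast
    then show ?thesis using sums_single[of j0 "\<lambda>_. F x"] by simp
  qed
  have H_summ: "summable (\<lambda>j. norm (H j x))" for x
  proof -
    obtain j0 where "\<forall>j. H j x = (if j = j0 then F x else 0)" using H_single by blast
    then have "norm (H j x) = (if j = j0 then norm (F x) else 0)" for j by simp
    then show ?thesis using sums_single[of j0 "\<lambda>_. norm (F x)"] by (simp add: sums_iff)
  qed
  have suminfH: "(\<Sum>j. H j x) = F x" for x using H_sums by (simp add: sums_iff)
  show "integrable lebesgue F"
    using integrable_suminf[OF intH AE_I2[OF H_summ]] sumG by (simp add: suminfH eqnGH)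
  have inf: "(\<Sum>j. G j z) = indicator cell z *\<^sub>R (\<Sum>\<^sub>\<infinity>k. F (z + per k))" for z
  proof (cases "z \<in> cell")
    case True
    have "(\<lambda>k. norm (F (z + per k))) summable_on UNIV"
      by (rule summable_on_comparison_test[OF summable_on_cmult_left[OF a(1), of "b z"]])
        (use bound True in auto)
    from infsum_enum_lattice[OF this] show ?thesis using True by (simp add: G_def)
  qed (simp add: G_def)
  show "set_integrable lebesgue cell (\<lambda>z. \<Sum>\<^sub>\<infinity>k. F (z + per k))"
    unfolding set_integrable_def
    using integrable_suminf[OF intG AE_I2[OF summ] sumG] by (simp add: inf)
  have "(LINT x|lebesgue. F x) = (\<Sum>j. LINT x|lebesgue. H j x)"
    using integral_suminf[OF intH AE_I2[OF H_summ]] sumG by (simp add: suminfH eqnGH)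
  also have "\<dots> = (LINT x|lebesgue. (\<Sum>j. G j x))"
    unfolding eqGH by (rule integral_suminf[OF intG AE_I2[OF summ] sumG, symmetric])
  finally show "(LINT x|lebesgue. F x) = (LINT z:cell|lebesgue. \<Sum>\<^sub>\<infinity>k. F (z + per k))"
    by (simp add: inf set_lebesgue_integral_def)
qed

subsection \<open>The Riesz kernel\<close>

text \<open>For 0 < s it is integrable away from 0 but not at 0; a factor |y|^2 repairs the
  singularity as long as s < 1. The value at y = 0 is 0, since \<open>0 powr a = 0\<close>.\<close>

definition riesz_kernel :: "real \<Rightarrow> real^'n::finite \<Rightarrow> real" where
  "riesz_kernel s y = norm y powr (- (real CARD('n) + 2 * s))"

lemma riesz_kernel_nonneg [simp]: "0 \<le> riesz_kernel s y"
  by (simp add: riesz_kernel_def)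

lemma riesz_kernel_measurable [measurable]: "riesz_kernel s \<in> borel_measurable borel"
  unfolding riesz_kernel_def by measurable

lemma emeasure_lborel_ball:
  fixes c :: "'a::euclidean_space"
  assumes "0 \<le> r"
  shows "emeasure lborel (ball c r) = ennreal (r ^ DIM('a) * measure lborel (ball (0::'a) 1))"
proof -
  have "emeasure lborel (ball c r) = ennreal (r ^ DIM('a)) * emeasure lborel (ball (0::'a) 1)"
    using emeasure_lebesgue_ball_conv_unit_ball[OF assms, of c] by simp
  also have "emeasure lborel (ball (0::'a) 1) = ennreal (measure lborel (ball (0::'a) 1))"
    using emeasure_lborel_ball_finite[of "0::'a" 1] by (simp add: emeasure_eq_ennreal_measure)
  finally show ?thesis using assms by (simp add: ennreal_mult)
qed

text \<open>Takes the place of polar coordinates: f is at most the sum of \<open>c j\<close> times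
  the indicator of the ball of radius \<open>r j\<close>, whose volume is proportional to
  \<open>r j ^ DIM('a)\<close>. Whole balls instead of shells are harmless when the radii are
  geometric.\<close>

lemma integrable_layers:
  fixes f :: "'a::euclidean_space \<Rightarrow> real"
  assumes [measurable]: "f \<in> borel_measurable borel" and f: "\<And>y. 0 \<le> f y"
    and c: "\<And>j::nat. 0 \<le> c j" and r: "\<And>j. 0 \<le> r j"
    and layer: "\<And>y. f y \<noteq> 0 \<Longrightarrow> \<exists>j. y \<in> ball 0 (r j) \<and> f y \<le> c j"
    and sum: "summable (\<lambda>j. c j * r j ^ DIM('a))"
  shows "integrable lborel f"
proof (rule integrableI_bounded)
  let ?V = "measure lborel (ball (0::'a) 1)"
  have "(\<integral>\<^sup>+ y. ennreal (norm (f y)) \<partial>lborel)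
      \<le> (\<integral>\<^sup>+ y. (\<Sum>j. ennreal (c j) * indicator (ball (0::'a) (r j)) y) \<partial>lborel)"
  proof (rule nn_integral_mono)
    fix y :: 'a
    show "ennreal (norm (f y)) \<le> (\<Sum>j. ennreal (c j) * indicator (ball 0 (r j)) y)"
    proof (cases "f y = 0")
      case False
      then obtain j where j: "y \<in> ball 0 (r j)" "f y \<le> c j" using layer by blast
      have "ennreal (norm (f y)) \<le> ennreal (c j) * indicator (ball 0 (r j)) y"
        using j f[of y] by (simp add: ennreal_leI)
      also have "\<dots> \<le> (\<Sum>j. ennreal (c j) * indicator (ball 0 (r j)) y)"
      proof -
        define g where "g j = ennreal (c j) * indicator (ball 0 (r j)) y" for j
        have "sum g {j} \<le> suminf g" by (rule sum_le_suminf) auto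
        then have "g j \<le> suminf g" by simp
        then show ?thesis unfolding g_def .
      qed
      finally show ?thesis .
    qed simp
  qed
  also have "\<dots> = (\<Sum>j. \<integral>\<^sup>+ y. ennreal (c j) * indicator (ball (0::'a) (r j)) y \<partial>lborel)"
    by (rule nn_integral_suminf) (simp add: borel_measurable_times_ennreal borel_measurable_indicator)
  also have "\<dots> = (\<Sum>j. ennreal (c j * r j ^ DIM('a) * ?V))"
  proof (rule suminf_cong)
    fix j
    have "(\<integral>\<^sup>+ y. ennreal (c j) * indicator (ball (0::'a) (r j)) y \<partial>lborel)
        = ennreal (c j) * emeasure lborel (ball (0::'a) (r j))"
      by (rule nn_integral_cmult_indicator) simp
    then show "(\<integral>\<^sup>+ y. ennreal (c j) * indicator (ball (0::'a) (r j)) y \<partial>lborel)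
        = ennreal (c j * r j ^ DIM('a) * ?V)"
      using c[of j] r[of j] by (simp add: emeasure_lborel_ball ennreal_mult mult.assoc)
  qed
  also have "\<dots> < \<infinity>"
  proof -
    have "summable (\<lambda>j. c j * r j ^ DIM('a) * ?V)" by (intro summable_mult2 sum)
    then show ?thesis
      using c r by (simp add: suminf_ennreal2 less_top[symmetric])
  qed
  finally show "(\<integral>\<^sup>+ y. ennreal (norm (f y)) \<partial>lborel) < \<infinity>" .
qed measurable

lemma dyadic_bracket:
  fixes t :: real
  assumes "0 < t"
  shows "2 powr of_int \<lfloor>log 2 t\<rfloor> \<le> t" "t < 2 powr (of_int \<lfloor>log 2 t\<rfloor> + 1)"
proof -
  have *: "2 powr log 2 t = t" using assms by simp
  have "2 powr of_int \<lfloor>log 2 t\<rfloor> \<le> 2 powr log 2 t" by (intro powr_mono) auto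
  then show "2 powr of_int \<lfloor>log 2 t\<rfloor> \<le> t" using * by simp
  have "2 powr log 2 t < 2 powr (of_int \<lfloor>log 2 t\<rfloor> + 1)"
    by (intro powr_less_mono) linarith+
  then show "t < 2 powr (of_int \<lfloor>log 2 t\<rfloor> + 1)" using * by simp
qed

lemma summable_powr_geometric:
  fixes b d :: real
  assumes "d < 0"
  shows "summable (\<lambda>j::nat. 2 powr (b + d * real j))"
proof -
  have "2 powr (b + d * real j) = 2 powr b * (2 powr d) ^ j" for j
    by (simp add: powr_add powr_powr powr_realpow[symmetric])
  moreover have "summable (\<lambda>j. 2 powr b * (2 powr d) ^ j)"
    using assms by (intro summable_mult summable_geometric) (auto simp: powr_less_one)
  ultimately show ?thesis by simp
qed

text \<open>On the shell 2^(-j-1) <= |y| < 2^(-j) the integrand has size 2^((n+2s-2)j) and the ball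
  has volume of order 2^(-nj); the product is geometric with ratio 2^(2s-2) < 1.\<close>

lemma integrable_riesz_kernel_inner:
  assumes "s < 1"
  shows "integrable lborel (\<lambda>y::real^'n::finite. indicator (ball 0 1) y * ((norm y)\<^sup>2 * riesz_kernel s y))"
proof -
  define a where "a = real CARD('n) + 2 * s"
  let ?r = "\<lambda>j::nat. 2 powr (- real j)"
  \<comment> \<open>The exponent a can be negative here; \<open>t powr (- a)\<close> is then
    controlled by the outer radius of the shell, otherwise by the inner one.\<close>
  let ?c = "\<lambda>j::nat. if 0 \<le> a then (?r j)\<^sup>2 * (2 powr (- real j - 1)) powr (- a) else (?r j)\<^sup>2 * (?r j) powr (- a)"
  show ?thesis
  proof (rule integrable_layers[where r="?r" and c="?c"])
    fix y :: "real^'n"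
    assume nz: "indicator (ball 0 1) y * ((norm y)\<^sup>2 * riesz_kernel s y) \<noteq> 0"
    then have y: "norm y < 1" "y \<noteq> 0" by (auto simp: indicator_def split: if_splits)
    define t where "t = norm y"
    have t: "0 < t" "t < 1" using y by (auto simp: t_def)
    then have "\<lfloor>log 2 t\<rfloor> < 0" by (simp add: floor_less_iff)
    then have j: "\<lfloor>log 2 t\<rfloor> = - int j - 1" if "j = nat (- \<lfloor>log 2 t\<rfloor> - 1)" for j
      using that by simp
    define j where "j = nat (- \<lfloor>log 2 t\<rfloor> - 1)"
    note j = j[OF j_def]
    have br: "2 powr (- real j - 1) \<le> t" "t < ?r j"
      using dyadic_bracket[OF t(1)] by (simp_all add: j)
    have "t\<^sup>2 * t powr (- a) \<le> ?c j"
    proof (cases "0 \<le> a")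
      case True
      have "t powr (- a) \<le> (2 powr (- real j - 1)) powr (- a)"
        using br True by (intro powr_mono2') auto
      moreover have "t\<^sup>2 \<le> (?r j)\<^sup>2" using br t by (intro power_mono) auto
      ultimately show ?thesis using True by (auto intro!: mult_mono)
    next
      case False
      have "t powr (- a) \<le> (?r j) powr (- a)"
        using br False t by (intro powr_mono2) auto
      moreover have "t\<^sup>2 \<le> (?r j)\<^sup>2" using br t by (intro power_mono) auto
      ultimately show ?thesis using False by (auto intro!: mult_mono)
    qed
    then show "\<exists>j. y \<in> ball 0 (?r j) \<and>
        indicator (ball 0 1) y * ((norm y)\<^sup>2 * riesz_kernel s y) \<le> ?c j"
      using br y by (intro exI[of _ j]) (simp add: riesz_kernel_def a_def t_def)
  next
    have p: "(?r j)\<^sup>2 = 2 powr (- 2 * real j)" "?r j ^ m = 2 powr (- real m * real j)" for j m :: nat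
      by (simp_all add: powr_realpow[symmetric] powr_powr mult.commute flip: powr_numeral)
    have "?c j * ?r j ^ DIM(real^'n) = 2 powr ((if 0 \<le> a then a else 0) + (2 * s - 2) * real j)" for j
      unfolding p powr_powr powr_add[symmetric] if_distrib[of "\<lambda>x. x * _"] if_distrib[of "\<lambda>x. 2 powr x"]
      by (auto simp: powr_powr powr_add[symmetric] a_def algebra_simps)
    moreover have "summable (\<lambda>j::nat. 2 powr ((if 0 \<le> a then a else 0) + (2 * s - 2) * real j))"
      using assms by (intro summable_powr_geometric) simp
    ultimately show "summable (\<lambda>j. ?c j * ?r j ^ DIM(real^'n))" by simp
  qed (auto simp: indicator_def)
qed

text \<open>The shells are now 2^j <= |y| < 2^(j+1), and value times volume decays like
  2^(-2sj).\<close>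

lemma integrable_riesz_kernel_outer:
  assumes "0 < s"
  shows "integrable lborel (\<lambda>y::real^'n::finite. indicator (- ball 0 1) y * riesz_kernel s y)"
proof -
  define a where "a = real CARD('n) + 2 * s"
  let ?r = "\<lambda>j::nat. 2 powr (real j + 1)"
  let ?c = "\<lambda>j::nat. (2 powr real j) powr (- a)"
  show ?thesis
  proof (rule integrable_layers[where r="?r" and c="?c"])
    fix y :: "real^'n"
    assume "indicator (- ball 0 1) y * riesz_kernel s y \<noteq> 0"
    then have y: "1 \<le> norm y" by (auto simp: indicator_def split: if_splits)
    define t where "t = norm y"
    have t: "1 \<le> t" using y by (auto simp: t_def)
    then have "0 \<le> \<lfloor>log 2 t\<rfloor>" by simp
    then obtain j :: nat where j: "\<lfloor>log 2 t\<rfloor> = int j"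
      using nonneg_int_cases by blast
    have br: "2 powr real j \<le> t" "t < ?r j"
      using dyadic_bracket[of t] t by (simp_all add: j)
    have "t powr (- a) \<le> ?c j"
      using br assms by (intro powr_mono2') (auto simp: a_def)
    then show "\<exists>j. y \<in> ball 0 (?r j) \<and> indicator (- ball 0 1) y * riesz_kernel s y \<le> ?c j"
      using br y by (intro exI[of _ j]) (simp add: riesz_kernel_def a_def t_def)
  next
    have p: "?r j ^ m = 2 powr (real m * (real j + 1))" for j m :: nat
      by (simp add: powr_realpow[symmetric] powr_powr mult.commute)
    have "?c j * ?r j ^ DIM(real^'n) = 2 powr (CARD('n) + (- 2 * s) * real j)" for j
      unfolding p powr_powr powr_add[symmetric] by (simp add: a_def algebra_simps)
    moreover have "summable (\<lambda>j::nat. 2 powr (CARD('n) + (- 2 * s) * real j))"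
      using assms by (intro summable_powr_geometric) simp
    ultimately show "summable (\<lambda>j. ?c j * ?r j ^ DIM(real^'n))" by simp
  qed (auto simp: indicator_def)
qed

text \<open>Since 1 + |y|^2 <= 2 |y|^2 outside the unit ball, the tail of the kernel may be replaced
  by a reciprocal weight, to which \<open>inverse_weight_le\<close> applies.\<close>

lemma riesz_kernel_le_weight:
  fixes y :: "real^'n::finite"
  assumes "0 < s" "1 \<le> norm y"
  shows "riesz_kernel s y \<le> 2 powr ((real CARD('n) + 2 * s) / 2) / weight s y"
proof -
  have "weight s y \<le> (2 * (norm y)\<^sup>2) powr ((real CARD('n) + 2 * s) / 2)"
    unfolding weight_def using assms by (intro powr_mono2) (auto simp: power2_eq_square mult_le_one one_le_mult_iff intro: order_trans[OF _ mult_mono[of 1 _ 1]])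
  also have "\<dots> = 2 powr ((real CARD('n) + 2 * s) / 2) * ((norm y)\<^sup>2) powr ((real CARD('n) + 2 * s) / 2)"
    by (rule powr_mult)
  also have "((norm y)\<^sup>2) powr ((real CARD('n) + 2 * s) / 2) = norm y powr (real CARD('n) + 2 * s)"
    by (simp add: powr_powr add_divide_distrib flip: powr_numeral)
  finally have "weight s y * norm y powr (- (real CARD('n) + 2 * s)) \<le>
      2 powr ((real CARD('n) + 2 * s) / 2) * (norm y powr (real CARD('n) + 2 * s) * norm y powr (- (real CARD('n) + 2 * s)))"
    by (simp add: mult_right_mono mult.assoc[symmetric])
  also have "norm y powr (real CARD('n) + 2 * s) * norm y powr (- (real CARD('n) + 2 * s)) = 1"
    using assms by (subst powr_add[symmetric]) auto
  finally show ?thesis by (simp add: riesz_kernel_def field_simps)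
qed

lemma inverse_weight_le_riesz_kernel:
  fixes y :: "real^'n::finite"
  assumes "0 < s" "y \<noteq> 0"
  shows "1 / weight s y \<le> riesz_kernel s y"
proof -
  have "norm y powr (real CARD('n) + 2 * s) = ((norm y)\<^sup>2) powr ((real CARD('n) + 2 * s) / 2)"
    by (simp add: powr_powr add_divide_distrib flip: powr_numeral)
  also have "\<dots> \<le> weight s y"
    unfolding weight_def using assms by (intro powr_mono2) auto
  finally show ?thesis
    using assms unfolding riesz_kernel_def powr_minus_divide by (intro divide_left_mono) auto
qed

lemma weight_ge_1: "0 < s \<Longrightarrow> 1 \<le> weight s x"
  unfolding weight_def by (intro ge_one_powr_ge_zero) auto

lemma integrable_inverse_weight:
  assumes "0 < s"
  shows "integrable lborel (\<lambda>y::real^'n::finite. 1 / weight s y)"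
proof (rule Bochner_Integration.integrable_bound)
  show "integrable lborel (\<lambda>y::real^'n. indicator (ball 0 1) y + indicator (- ball 0 1) y * riesz_kernel s y)"
    by (intro Bochner_Integration.integrable_add integrable_riesz_kernel_outer assms integrable_real_indicator)
      (auto simp: emeasure_lborel_ball_finite[unfolded infinity_ennreal_def])
  have "norm (1 / weight s y) \<le> norm (indicator (ball 0 1) y + indicator (- ball 0 1) y * riesz_kernel s y)" for y :: "real^'n"
    using inverse_weight_le_riesz_kernel[OF assms, of y] weight_ge_1[OF assms, of y]
    by (cases "y = 0") (auto simp: indicator_def)
  then show "AE y::real^'n in lborel. norm (1 / weight s y) \<le> norm (indicator (ball 0 1) y + indicator (- ball 0 1) y * riesz_kernel s y)"
    by simp
qed measurable

section \<open>Lattice sums of reciprocal weights and unfolding under decay\<close>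

lemma measure_cell: "measure lebesgue (cell :: (real^'n::finite) set) = (2 * pi) ^ CARD('n)"
proof -
  let ?a = "(\<chi> i. - pi) :: real^'n" and ?b = "(\<chi> i. pi) :: real^'n"
  have "box ?a ?b \<subseteq> cell" by (auto simp: cell_def mem_box_cart less_imp_le)
  have "measure lborel (cbox ?a ?b) = (2 * pi) ^ CARD('n)"
    using content_cbox_cart[of ?a ?b] by (simp add: interval_ne_empty_cart)
  moreover have "measure lborel (box ?a ?b) = measure lborel (cbox ?a ?b)"
    by (simp add: measure_lborel_box_eq measure_lborel_cbox_eq)
  moreover have "measure lebesgue (box ?a ?b) \<le> measure lebesgue (cell :: (real^'n) set)"
    by (rule measure_mono_fmeasurable[OF \<open>box ?a ?b \<subseteq> cell\<close>]) simp_all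
  moreover have "measure lebesgue (cell :: (real^'n) set) \<le> measure lebesgue (cbox ?a ?b)"
    by (rule measure_mono_fmeasurable[OF cell_subset_cbox]) simp_all
  ultimately show ?thesis by simp
qed

lemma set_integrable_cell_const:
  "set_integrable lebesgue cell (\<lambda>z::real^'n::finite. c :: real)"
  unfolding set_integrable_def
  using cell_lmeasurable[where 'a='n] unfolding lmeasurable_iff_integrable by simp

lemma weight_bounded:
  fixes S :: "(real^'n::finite) set"
  assumes "bounded S"
  obtains M where "0 < M" "\<And>z. z \<in> S \<Longrightarrow> weight s z \<le> M"
proof -
  have "compact (weight s ` closure S)"
    using assms by (intro compact_continuous_image continuous_on_weight) simp
  then obtain M where "\<And>z. z \<in> closure S \<Longrightarrow> norm (weight s z) \<le> M" "0 < M"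
    using bounded_pos compact_imp_bounded by (metis imageI)
  then show ?thesis using that[of M] closure_subset[of S] by fastforce
qed

lemma bounded_cell [simp]: "bounded cell"
  using bounded_subset[OF bounded_cbox cell_subset_cbox] .

text \<open>Comparison of a sum with an integral: for x in the translate of the cell at
  \<open>per k\<close>, the reciprocal weight at \<open>per k\<close> is at most C M times the one
  at x. So each term is bounded by an integral over that translate, and the translates are
  disjoint.\<close>

lemma summable_lattice_weight:
  assumes "0 < s"
  shows "(\<lambda>k::int^'n::finite. 1 / weight s (per k)) summable_on UNIV"
proof (rule nonneg_bdd_above_summable_on)
  obtain M where M: "0 < M" "\<And>z::real^'n. z \<in> cell \<Longrightarrow> weight s z \<le> M"
    using weight_bounded[OF bounded_cell, of s] by blast
  define C where "C = 2 powr ((real CARD('n) + 2 * s) / 2)"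
  have C: "0 < C" by (simp add: C_def)
  let ?I = "LINT x|lebesgue. 1 / weight s (x::real^'n)"
  have int: "integrable lebesgue (\<lambda>x::real^'n. 1 / weight s x)"
    using integrable_inverse_weight[OF assms] by (simp add: integrable_completion)
  have intk: "integrable lebesgue (\<lambda>x::real^'n. indicator cell (x - per k) * (1 / weight s x))" for k
  proof -
    have "cell \<in> sets borel" by simp
    then have "(\<lambda>x::real^'n. indicat_real cell (x - per k)) \<in> borel_measurable lebesgue"
      by (intro measurable_completion) measurable
    from borel_measurable_times[OF this borel_measurable_integrable[OF int]] show ?thesis
      by (intro Bochner_Integration.integrable_bound[OF int]) (auto simp: indicator_def)
  qed
  have term_le: "(2 * pi) ^ CARD('n) / weight s (per k) \<le>
      C * M * (LINT x|lebesgue. indicator cell (x - per k) * (1 / weight s x))" for k :: "int^'n"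
  proof -
    have "(2 * pi) ^ CARD('n) / weight s (per k) = (LINT x|lebesgue. indicator cell (x::real^'n) * (1 / weight s (per k)))"
      by (simp add: measure_cell)
    also have "\<dots> = (LINT x|lebesgue. indicator cell (x - per k) * (1 / weight s (per k)))"
      using lebesgue_integral_translation[of "\<lambda>x::real^'n. indicator cell x * (1 / weight s (per k))" "- per k"]
      by (simp add: measurable_completion)
    also have "\<dots> \<le> (LINT x|lebesgue. C * M * (indicator cell (x - per k) * (1 / weight s x)))"
    proof (rule integral_mono)
      have "set_integrable lebesgue cell (\<lambda>z::real^'n. 1 / weight s (per k))"
        by (rule set_integrable_cell_const)
      then have "integrable lebesgue (\<lambda>x::real^'n. indicator cell x * (1 / weight s (per k)))"
        by (simp add: set_integrable_def)
      then show "integrable lebesgue (\<lambda>x. indicator cell (x - per k) * (1 / weight s (per k)))"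
        using lebesgue_integrable_translation[of "\<lambda>x::real^'n. indicator cell x * (1 / weight s (per k))" "- per k"]
        by (simp add: measurable_completion)
      show "integrable lebesgue (\<lambda>x. C * M * (indicator cell (x - per k) * (1 / weight s x)))"
        by (intro integrable_mult_right intk)
      fix x :: "real^'n"
      show "indicator cell (x - per k) * (1 / weight s (per k)) \<le>
          C * M * (indicator cell (x - per k) * (1 / weight s x))"
      proof (cases "x - per k \<in> cell")
        case True
        \<comment> \<open>Here \<open>per k\<close> is written as x shifted by the negative of the
          cell point \<open>x - per k\<close>, whose weight is at most M.\<close>
        have "1 / weight s (x + - (x - per k)) \<le> C * weight s (- (x - per k)) / weight s x"
          unfolding C_def by (rule inverse_weight_le[OF assms])
        also have "\<dots> \<le> C * M / weight s x"
          unfolding weight_minus using M(2)[OF True] C by (intro divide_right_mono mult_left_mono) auto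
        finally show ?thesis using True by simp
      qed simp
    qed
    also have "\<dots> = C * M * (LINT x|lebesgue. indicator cell (x - per k) * (1 / weight s x))"
      by (rule integral_mult_right_zero)
    finally show ?thesis .
  qed
  show "bdd_above (sum (\<lambda>k::int^'n. 1 / weight s (per k)) ` {F. F \<subseteq> UNIV \<and> finite F})"
  proof (rule bdd_aboveI2)
    fix F :: "(int^'n) set" assume F: "F \<in> {F. F \<subseteq> UNIV \<and> finite F}"
    have "(2 * pi) ^ CARD('n) * (\<Sum>k\<in>F. 1 / weight s (per k)) = (\<Sum>k\<in>F. (2 * pi) ^ CARD('n) / weight s (per k))"
      by (simp add: sum_distrib_left)
    also have "\<dots> \<le> (\<Sum>k\<in>F. C * M * (LINT x|lebesgue. indicator cell (x - per k) * (1 / weight s x)))"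
      by (intro sum_mono term_le)
    also have "\<dots> = C * M * (LINT x|lebesgue. (\<Sum>k\<in>F. indicator cell (x - per k) * (1 / weight s x)))"
      using intk by (simp add: sum_distrib_left Bochner_Integration.integral_sum)
    also have "\<dots> \<le> C * M * ?I"
    proof (intro mult_left_mono integral_mono int Bochner_Integration.integrable_sum intk)
      fix x :: "real^'n"
      obtain k where k: "x - per k \<in> cell" "\<And>l. x - per l \<in> cell \<Longrightarrow> l = k"
        using cell_translate_unique[of x] by blast
      have "(\<Sum>l\<in>F. indicator cell (x - per l)) \<le> (\<Sum>l\<in>F. if l = k then 1 else 0 :: real)"
        using k(2) by (intro sum_mono) (auto simp: indicator_def)
      also have "\<dots> \<le> 1" using F by simp
      finally show "(\<Sum>k\<in>F. indicator cell (x - per k) * (1 / weight s x)) \<le> 1 / weight s x"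
        by (simp add: divide_right_mono flip: sum_divide_distrib)
    qed (use C M in auto)
    finally show "(\<Sum>k\<in>F. 1 / weight s (per k)) \<le> C * M * ?I / (2 * pi) ^ CARD('n)"
      by (simp add: field_simps)
  qed
qed simp

lemma summable_lattice_weight_translate:
  fixes z :: "real^'n::finite"
  assumes "0 < s"
  shows "(\<lambda>k. 1 / weight s (z + per k)) summable_on UNIV"
proof (rule summable_on_comparison_test)
  show "(\<lambda>k. 2 powr ((real CARD('n) + 2 * s) / 2) * weight s z * (1 / weight s (per k))) summable_on UNIV"
    by (intro summable_on_cmult_right summable_lattice_weight assms)
  show "1 / weight s (z + per k) \<le> 2 powr ((real CARD('n) + 2 * s) / 2) * weight s z * (1 / weight s (per k))" for k
    using inverse_weight_le[OF assms, of "per k" z] by (simp add: add.commute)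
qed simp

lemma norm_summable_translates:
  fixes F :: "real^'n::finite \<Rightarrow> 'b::real_normed_vector"
  assumes "0 < s" "\<And>x. norm (F x) \<le> C / weight s x"
  shows "(\<lambda>k. norm (F (z + per k))) summable_on UNIV"
proof (rule summable_on_comparison_test)
  show "(\<lambda>k. C * (1 / weight s (z + per k))) summable_on UNIV"
    by (intro summable_on_cmult_right summable_lattice_weight_translate assms)
qed (use assms in auto)

lemma weight_bound_nonneg:
  fixes f :: "real^'n::finite \<Rightarrow> 'b::real_normed_vector"
  assumes "\<And>x. norm (f x) \<le> C / weight s x"
  shows "0 \<le> C"
proof -
  have "0 \<le> C / weight s (0::real^'n)" by (rule order_trans[OF norm_ge_zero assms])
  then have "0 \<le> C / weight s (0::real^'n) * weight s (0::real^'n)" by (intro mult_nonneg_nonneg) simp_all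
  then show ?thesis by simp
qed

text \<open>The majorant behind the interchanges with a lattice sum: for z in a bounded set M can be
  chosen independently of z, and the right side is summable in k.\<close>

lemma weight_bound_translates:
  fixes f :: "real^'n::finite \<Rightarrow> 'b::real_normed_vector"
  assumes "0 < s" "0 \<le> C" "\<And>x. norm (f x) \<le> C / weight s x" "weight s z \<le> M"
  shows "norm (f (z + per k)) \<le> C * (2 powr ((real CARD('n) + 2 * s) / 2) * M) * (1 / weight s (per k))"
proof -
  let ?D = "2 powr ((real CARD('n) + 2 * s) / 2)"
  have "norm (f (z + per k)) \<le> C * (1 / weight s (per k + z))"
    using assms(3)[of "z + per k"] by (simp add: add.commute)
  also have "\<dots> \<le> C * (?D * weight s z / weight s (per k))"
    by (intro mult_left_mono inverse_weight_le assms(1,2))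
  also have "\<dots> \<le> C * (?D * M / weight s (per k))"
    using assms(4) by (intro mult_left_mono divide_right_mono assms(2)) auto
  finally show ?thesis by simp
qed

lemma
  fixes F :: "real^'n::finite \<Rightarrow> 'b::{banach, second_countable_topology}"
  assumes F: "F \<in> borel_measurable lebesgue" and s: "0 < s" and C: "\<And>x. norm (F x) \<le> C / weight s x"
  shows integrable_weight_bound: "integrable lebesgue F"
    and integral_unfold_weight:
      "(LINT x|lebesgue. F x) = (LINT z:cell|lebesgue. \<Sum>\<^sub>\<infinity>k. F (z + per k))"
proof -
  obtain M where M: "0 < M" "\<And>z::real^'n. z \<in> cell \<Longrightarrow> weight s z \<le> M"
    using weight_bounded[OF bounded_cell, of s] by blast
  have C0: "0 \<le> C" using C by (rule weight_bound_nonneg)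
  define a where "a k = C * (2 powr ((real CARD('n) + 2 * s) / 2) * M) * (1 / weight s (per k))" for k :: "int^'n"
  have a: "a summable_on UNIV"
    unfolding a_def by (intro summable_on_cmult_right summable_lattice_weight s)
  have bound: "norm (F (z + per k)) \<le> a k * 1" if "z \<in> cell" for z k
    unfolding a_def mult_1_right by (rule weight_bound_translates[OF s C0 C M(2)[OF that]])
  have nn: "0 \<le> a k" for k
    using C0 M(1) by (simp add: a_def)
  note * = F set_integrable_cell_const[of 1] a nn bound
  show "integrable lebesgue F" by (rule integrable_unfold[OF *])
  show "(LINT x|lebesgue. F x) = (LINT z:cell|lebesgue. \<Sum>\<^sub>\<infinity>k. F (z + per k))"
    by (rule integral_unfold[OF *])
qed

subsection \<open>The singular integral representation of $|\xi|^{2s}$\<close>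

lemma nn_integral_lborel_translation:
  fixes c :: "'a::euclidean_space"
  assumes "f \<in> borel_measurable borel"
  shows "(\<integral>\<^sup>+ x. f (x + c) \<partial>lborel) = (\<integral>\<^sup>+ x. f x \<partial>lborel)"
  using nn_integral_distr[of "(+) c" lborel borel f] assms
  by (simp add: lborel_distr_plus add.commute)

lemma nn_integral_lborel_reflect:
  fixes c :: "'a::euclidean_space"
  assumes [measurable]: "f \<in> borel_measurable borel"
  shows "(\<integral>\<^sup>+ x. f (c - x) \<partial>lborel) = (\<integral>\<^sup>+ x. f x \<partial>lborel)"
proof -
  have "lborel = distr lborel borel (\<lambda>x. c - x)"
    using lborel_affine[of "-1" c] by (simp add: density_1)
  then have "(\<integral>\<^sup>+ x. f x \<partial>lborel) = (\<integral>\<^sup>+ x. f x \<partial>distr lborel borel (\<lambda>x. c - x))" by simp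
  also have "\<dots> = (\<integral>\<^sup>+ x. f (c - x) \<partial>lborel)"
    by (subst nn_integral_distr) auto
  finally show ?thesis ..
qed

text \<open>Uniqueness of Haar measure: with $B$ the unit ball, evaluating
  $\iint 1_A(Tx) 1_B(Tx + y)$ in both orders gives $\lambda(T^{-1}A)\lambda(B) = \lambda(A)\lambda(T^{-1}B)$.\<close>

lemma distr_lborel_orthogonal:
  fixes T :: "'a::euclidean_space \<Rightarrow> 'a"
  assumes "orthogonal_transformation T"
  shows "distr lborel borel T = lborel"
proof (rule measure_eqI)
  fix A assume "A \<in> sets (distr lborel borel T)"
  then have A [measurable]: "A \<in> sets borel" by simp
  have lin: "linear T" using assms by (rule orthogonal_transformation_linear)
  have T [measurable]: "T \<in> borel_measurable borel"
    using lin by (intro borel_measurable_continuous_onI linear_continuous_on linear_conv_bounded_linear[THEN iffD1])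
  obtain S where S: "\<And>x. T (S x) = x"
    using orthogonal_transformation_surj[OF assms] by (metis surjD)
  define B where "B = ball (0::'a) 1"
  have B [measurable]: "B \<in> sets borel" by (simp add: B_def)
  \<comment> \<open>Orthogonality makes the unit ball invariant, so T^(-1) B = B, and the factor
    lambda(B), finite and nonzero, cancels at the end.\<close>
  have TB: "T x \<in> B \<longleftrightarrow> x \<in> B" for x
    using orthogonal_transformation_norm[OF assms, of x] by (simp add: B_def)
  have "emeasure lborel (T -` A) * emeasure lborel B
      = (\<integral>\<^sup>+ x. indicator A (T x) * (\<integral>\<^sup>+ y. indicator B (y + T x) \<partial>lborel) \<partial>lborel)"
  proof -
    have "(\<integral>\<^sup>+ y. indicator B (y + T x) \<partial>lborel) = emeasure lborel B" for x
      by (subst nn_integral_lborel_translation) auto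
    moreover have "(\<integral>\<^sup>+ x. indicator A (T x) \<partial>lborel) = emeasure lborel (T -` A)"
    proof -
      have "T -` A \<in> sets borel" using measurable_sets_borel[OF T A] by simp
      moreover have "(\<lambda>x. indicator A (T x) :: ennreal) = indicator (T -` A)"
        by (auto simp: indicator_def)
      ultimately show ?thesis by simp
    qed
    ultimately show ?thesis by (simp add: nn_integral_multc)
  qed
  also have "\<dots> = (\<integral>\<^sup>+ x. \<integral>\<^sup>+ y. indicator A (T x) * indicator B (y + T x) \<partial>lborel \<partial>lborel)"
    by (intro nn_integral_cong nn_integral_cmult[symmetric]) measurable
  also have "\<dots> = (\<integral>\<^sup>+ y. \<integral>\<^sup>+ x. indicator A (T x) * indicator B (y + T x) \<partial>lborel \<partial>lborel)"
    by (rule lborel_pair.Fubini'[symmetric]) measurable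
  also have "\<dots> = (\<integral>\<^sup>+ y. \<integral>\<^sup>+ x. indicator A (T x - y) * indicator B (T x) \<partial>lborel \<partial>lborel)"
  proof (rule nn_integral_cong)
    fix y :: 'a
    \<comment> \<open>A preimage \<open>S y\<close> of y turns a shift of x into a shift of
      \<open>T x\<close>; translating x thus moves y from the argument of B to that of A.\<close>
    have "T (x + S y) = T x + y" for x using lin S by (simp add: linear_add)
    then show "(\<integral>\<^sup>+ x. indicator A (T x) * indicator B (y + T x) \<partial>lborel)
        = (\<integral>\<^sup>+ x. indicator A (T x - y) * indicator B (T x) \<partial>lborel)"
      using nn_integral_lborel_translation[of "\<lambda>x. indicator A (T x - y) * indicator B (T x)" "S y"]
      by (simp add: add.commute)
  qed
  also have "\<dots> = (\<integral>\<^sup>+ x. \<integral>\<^sup>+ y. indicator A (T x - y) * indicator B (T x) \<partial>lborel \<partial>lborel)"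
    by (rule lborel_pair.Fubini') measurable
  also have "\<dots> = (\<integral>\<^sup>+ x. emeasure lborel A * indicator B x \<partial>lborel)"
  proof (rule nn_integral_cong)
    fix x :: 'a
    have "(\<integral>\<^sup>+ y. indicator A (T x - y) \<partial>lborel) = emeasure lborel A"
      by (subst nn_integral_lborel_reflect) auto
    then show "(\<integral>\<^sup>+ y. indicator A (T x - y) * indicator B (T x) \<partial>lborel) = emeasure lborel A * indicator B x"
      using TB[of x] by (simp add: nn_integral_multc indicator_def)
  qed
  also have "\<dots> = emeasure lborel A * emeasure lborel B"
    by (rule nn_integral_cmult_indicator) simp
  finally have "emeasure lborel (T -` A) * emeasure lborel B = emeasure lborel A * emeasure lborel B" .
  moreover have "emeasure lborel B \<noteq> 0" "emeasure lborel B \<noteq> top"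
    using emeasure_lborel_ball_finite[of "0::'a" 1] open_not_negligible[of "ball (0::'a) 1"]
    by (auto simp: B_def negligible_iff_emeasure0)
  ultimately have "emeasure lborel (T -` A) = emeasure lborel A"
    by (metis ennreal_mult_cancel_left mult.commute)
  then show "emeasure (distr lborel borel T) A = emeasure lborel A"
    by (simp add: emeasure_distr)
qed simp

lemma lborel_integral_scale:
  fixes f :: "'a::euclidean_space \<Rightarrow> 'b::{banach, second_countable_topology}"
  assumes [measurable]: "f \<in> borel_measurable borel" and "0 < r"
  shows "(LINT x|lborel. f x) = r ^ DIM('a) *\<^sub>R (LINT x|lborel. f (r *\<^sub>R x))"
proof -
  have "(LINT x|lborel. f x) = (LINT x|density (distr lborel borel (\<lambda>x. 0 + r *\<^sub>R x)) (\<lambda>_. ennreal (\<bar>r\<bar> ^ DIM('a))). f x)"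
    using lborel_affine[of r "0::'a"] assms by (simp add: ennreal_power)
  also have "\<dots> = (LINT x|distr lborel borel (\<lambda>x. 0 + r *\<^sub>R x). (\<bar>r\<bar> ^ DIM('a)) *\<^sub>R f x)"
    by (rule integral_density) auto
  also have "\<dots> = (LINT x|lborel. (\<bar>r\<bar> ^ DIM('a)) *\<^sub>R f (0 + r *\<^sub>R x))"
    by (rule integral_distr) auto
  finally show ?thesis using assms by simp
qed

text \<open>Near 0, 1 - cos t <= t^2 / 2 and Cauchy-Schwarz give a factor |y|^2 |\<xi>|^2; far away
  1 - cos t <= 2 suffices.\<close>

lemma integrable_riesz_kernel_cos:
  fixes \<xi> :: "real^'n::finite"
  assumes "0 < s" "s < 1"
  shows "integrable lborel (\<lambda>y. (1 - cos (y \<bullet> \<xi>)) * riesz_kernel s y)"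
proof (rule Bochner_Integration.integrable_bound)
  show "integrable lborel (\<lambda>y::real^'n. (norm \<xi>)\<^sup>2 * (indicator (ball 0 1) y * ((norm y)\<^sup>2 * riesz_kernel s y))
      + 2 * (indicator (- ball 0 1) y * riesz_kernel s y))"
    using assms by (intro Bochner_Integration.integrable_add integrable_mult_right
      integrable_riesz_kernel_inner integrable_riesz_kernel_outer)
  have "norm ((1 - cos (y \<bullet> \<xi>)) * riesz_kernel s y) \<le>
      norm ((norm \<xi>)\<^sup>2 * (indicator (ball 0 1) y * ((norm y)\<^sup>2 * riesz_kernel s y))
      + 2 * (indicator (- ball 0 1) y * riesz_kernel s y))" for y :: "real^'n"
  proof (cases "y \<in> ball 0 1")
    case True
    have "(y \<bullet> \<xi>)\<^sup>2 \<le> (norm y * norm \<xi>)\<^sup>2"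
      using Cauchy_Schwarz_ineq2[of y \<xi>] by (metis abs_le_square_iff abs_norm_cancel abs_mult)
    moreover have "1 - cos (y \<bullet> \<xi>) \<le> (y \<bullet> \<xi>)\<^sup>2 / 2"
    proof -
      have "\<bar>sin (y \<bullet> \<xi> / 2)\<bar> \<le> \<bar>y \<bullet> \<xi> / 2\<bar>" by (rule abs_sin_x_le_abs_x)
      then have "(sin (y \<bullet> \<xi> / 2))\<^sup>2 \<le> (y \<bullet> \<xi> / 2)\<^sup>2" by (simp only: abs_le_square_iff)
      then show ?thesis using cos_double_sin[of "y \<bullet> \<xi> / 2"] by (simp add: power_divide)
    qed
    ultimately have "1 - cos (y \<bullet> \<xi>) \<le> (norm \<xi>)\<^sup>2 * (norm y)\<^sup>2"
    proof -
      have "1 - cos (y \<bullet> \<xi>) \<le> (y \<bullet> \<xi>)\<^sup>2"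
        using \<open>1 - cos (y \<bullet> \<xi>) \<le> (y \<bullet> \<xi>)\<^sup>2 / 2\<close> zero_le_power2[of "y \<bullet> \<xi>"] by linarith
      also note \<open>(y \<bullet> \<xi>)\<^sup>2 \<le> (norm y * norm \<xi>)\<^sup>2\<close>
      finally show ?thesis by (simp add: power_mult_distrib mult.commute)
    qed
    then have "(1 - cos (y \<bullet> \<xi>)) * riesz_kernel s y \<le> (norm \<xi>)\<^sup>2 * (norm y)\<^sup>2 * riesz_kernel s y"
      by (intro mult_right_mono) auto
    then show ?thesis using True by (simp add: abs_mult mult.assoc)
  next
    case False
    have "1 - cos (y \<bullet> \<xi>) \<le> 2" using cos_ge_minus_one[of "y \<bullet> \<xi>"] by simp
    then have "(1 - cos (y \<bullet> \<xi>)) * riesz_kernel s y \<le> 2 * riesz_kernel s y"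
      by (intro mult_right_mono) auto
    then show ?thesis using False by (simp add: abs_mult)
  qed
  then show "AE y::real^'n in lborel. norm ((1 - cos (y \<bullet> \<xi>)) * riesz_kernel s y) \<le>
      norm ((norm \<xi>)\<^sup>2 * (indicator (ball 0 1) y * ((norm y)\<^sup>2 * riesz_kernel s y))
      + 2 * (indicator (- ball 0 1) y * riesz_kernel s y))" by simp
qed measurable

text \<open>Substituting a rotation or a dilation in y shows that the integral is invariant under
  rotations of \<xi> and homogeneous of degree 2s. Hence it is |\<xi>|^(2s) times its value at one
  unit vector, and c is that value.\<close>

lemma riesz_kernel_cos_integral:
  assumes "0 < s" "s < 1"
  obtains c where "0 < c"
    "\<And>\<xi>::real^'n::finite. (LINT y|lborel. (1 - cos (y \<bullet> \<xi>)) * riesz_kernel s y) = c * norm \<xi> powr (2 * s)"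
proof -
  define A where "A \<xi> = (LINT y|lborel. (1 - cos (y \<bullet> \<xi>)) * riesz_kernel s y)" for \<xi> :: "real^'n"
  have rot: "A (T \<xi>) = A \<xi>" if T: "orthogonal_transformation T" for T \<xi>
  proof -
    have [measurable]: "T \<in> borel_measurable borel"
      using orthogonal_transformation_linear[OF T]
      by (intro borel_measurable_continuous_onI linear_continuous_on linear_conv_bounded_linear[THEN iffD1])
    have "A (T \<xi>) = (LINT y|distr lborel borel T. (1 - cos (y \<bullet> T \<xi>)) * riesz_kernel s y)"
      by (simp add: A_def distr_lborel_orthogonal[OF T])
    also have "\<dots> = (LINT y|lborel. (1 - cos (T y \<bullet> T \<xi>)) * riesz_kernel s (T y))"
      by (rule integral_distr) measurable
    also have "\<dots> = A \<xi>"
      using T by (simp add: A_def riesz_kernel_def orthogonal_transformation_norm orthogonal_transformation_def)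
    finally show ?thesis .
  qed
  have scale: "A (r *\<^sub>R \<xi>) = r powr (2 * s) * A \<xi>" if r: "0 < r" for r \<xi>
  proof -
    have K: "riesz_kernel s (r *\<^sub>R y) = r powr (- (real CARD('n) + 2 * s)) * riesz_kernel s y" for y :: "real^'n"
      using r by (simp add: riesz_kernel_def powr_mult)
    have "A \<xi> = r ^ CARD('n) * (LINT y|lborel. (1 - cos ((r *\<^sub>R y) \<bullet> \<xi>)) * riesz_kernel s (r *\<^sub>R y))"
      unfolding A_def by (subst lborel_integral_scale[OF _ r]) auto
    also have "\<dots> = r ^ CARD('n) * (LINT y|lborel. r powr (- (real CARD('n) + 2 * s)) * ((1 - cos (y \<bullet> (r *\<^sub>R \<xi>))) * riesz_kernel s y))"
      by (simp add: K algebra_simps)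
    also have "\<dots> = r ^ CARD('n) * r powr (- (real CARD('n) + 2 * s)) * A (r *\<^sub>R \<xi>)"
      unfolding A_def by simp
    also have "r ^ CARD('n) * r powr (- (real CARD('n) + 2 * s)) = r powr (- (2 * s))"
      using r by (simp add: powr_realpow[symmetric] powr_add[symmetric])
    finally show ?thesis using r by (simp add: powr_minus field_simps)
  qed
  define e where "e = (axis undefined 1 :: real^'n)"
  have e: "norm e = 1" by (simp add: e_def)
  have A: "A \<xi> = A e * norm \<xi> powr (2 * s)" for \<xi>
  proof (cases "\<xi> = 0")
    case True
    then show ?thesis by (simp add: A_def)
  next
    case False
    define \<omega> where "\<omega> = \<xi> /\<^sub>R norm \<xi>"
    have "norm e = norm \<omega>" using False e by (simp add: \<omega>_def)
    then obtain T where T: "orthogonal_transformation T" "T e = \<omega>"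
      using orthogonal_transformation_exists by blast
    have "\<xi> = norm \<xi> *\<^sub>R \<omega>" using False by (simp add: \<omega>_def)
    then have "A \<xi> = norm \<xi> powr (2 * s) * A \<omega>" using scale False by (metis zero_less_norm_iff)
    also have "A \<omega> = A e" using rot[OF T(1), of e] T(2) by simp
    finally show ?thesis by (simp add: mult.commute)
  qed
  have nonneg: "0 \<le> (1 - cos (y \<bullet> e)) * riesz_kernel s y" for y by simp
  have "0 < A e"
  proof (rule ccontr)
    assume "\<not> 0 < A e"
    moreover have "0 \<le> A e" unfolding A_def by (intro integral_nonneg_AE) (simp add: nonneg)
    ultimately have "A e = 0" by simp
    then have "AE y in lborel. (1 - cos (y \<bullet> e)) * riesz_kernel s y = 0"
      unfolding A_def using integral_nonneg_eq_0_iff_AE[OF integrable_riesz_kernel_cos[OF assms, of e]] by simp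
    \<comment> \<open>For y in the unit ball about e, 0 < y . e < 2 < pi, so 1 - cos (y . e) is
      positive; a vanishing integral would make this ball a null set.\<close>
    then have "AE y in lborel. \<not> (y \<in> ball e 1)"
    proof (rule AE_mp, intro AE_I2 impI notI)
      fix y assume y: "(1 - cos (y \<bullet> e)) * riesz_kernel s y = 0" "y \<in> ball e 1"
      have "\<bar>(y - e) \<bullet> e\<bar> < 1"
        using Cauchy_Schwarz_ineq2[of "y - e" e] y(2) e by (simp add: dist_norm norm_minus_commute)
      moreover have "e \<bullet> e = 1" using e by (simp add: dot_square_norm)
      ultimately have *: "0 < y \<bullet> e" "y \<bullet> e < 2" by (auto simp: inner_diff_left)
      then have "cos (y \<bullet> e) < cos 0" using pi_gt3 by (intro cos_monotone_0_pi) auto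
      moreover have "riesz_kernel s y \<noteq> 0" using * by (auto simp: riesz_kernel_def)
      ultimately show False using y by simp
    qed
    then have "ball e 1 \<in> null_sets lborel"
      using AE_iff_null_sets[of "ball e 1" lborel] by simp
    then have "emeasure lborel (ball e 1) = 0" by (rule null_setsD1)
    then show False
      using open_not_negligible[of "ball e 1"] by (auto simp: negligible_iff_emeasure0)
  qed
  then show ?thesis using that A unfolding A_def by blast
qed

subsection \<open>Fourier series and Poisson summation\<close>

lemma cis_lattice_periodic [simp]: "cis (lattice_vec k \<bullet> (x + per l)) = cis (lattice_vec k \<bullet> x)"
  and cis_minus_lattice_periodic [simp]: "cis (- (lattice_vec k \<bullet> (x + per l))) = cis (- (lattice_vec k \<bullet> x))"
proof -
  have "lattice_vec k \<bullet> lattice_vec l = of_int (\<Sum>i\<in>UNIV. k $ i * l $ i)"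
    by (simp add: lattice_vec_def inner_vec_def)
  then have *: "lattice_vec k \<bullet> lattice_vec l \<in> \<int>" by (metis Ints_of_int)
  then have "cis (2 * pi * (lattice_vec k \<bullet> lattice_vec l)) = 1" by simp
  then show "cis (lattice_vec k \<bullet> (x + per l)) = cis (lattice_vec k \<bullet> x)"
    by (simp add: inner_add_right cis_mult[symmetric] mult.assoc)
  have "cis (2 * pi * (- (lattice_vec k \<bullet> lattice_vec l))) = 1"
    using * by (intro cis_multiple_2pi) simp
  moreover have "cis (- (lattice_vec k \<bullet> (x + per l)))
      = cis (- (lattice_vec k \<bullet> x)) * cis (2 * pi * (- (lattice_vec k \<bullet> lattice_vec l)))"
    unfolding cis_mult by (simp add: inner_add_right)
  ultimately show "cis (- (lattice_vec k \<bullet> (x + per l))) = cis (- (lattice_vec k \<bullet> x))"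
    by simp
qed

lemma continuous_on_cis [continuous_intros]:
  "continuous_on A f \<Longrightarrow> continuous_on A (\<lambda>x. cis (f x))"
  unfolding cis_conv_exp by (intro continuous_intros)

lemma set_integrable_cell_continuous:
  fixes f :: "real^'n::finite \<Rightarrow> complex"
  assumes "continuous_on (cbox (\<chi> i. - pi) (\<chi> i. pi)) f"
  shows "set_integrable lebesgue cell f"
  by (rule set_integrable_subset[OF absolutely_integrable_continuous[OF assms] _ cell_subset_cbox]) simp

lemma continuous_on_infsum:
  fixes f :: "'k \<Rightarrow> 'a::topological_space \<Rightarrow> complex"
  assumes "\<And>k. continuous_on S (f k)" "\<And>k x. x \<in> S \<Longrightarrow> norm (f k x) \<le> a k" "a summable_on UNIV"
  shows "continuous_on S (\<lambda>x. \<Sum>\<^sub>\<infinity>k. f k x)"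
proof (rule uniform_limit_theorem)
  show "uniform_limit S (\<lambda>X y. \<Sum>x\<in>X. f x y) (\<lambda>y. \<Sum>\<^sub>\<infinity>x. f x y) (finite_subsets_at_top UNIV)"
    using assms by (intro Weierstrass_m_test_general) auto
qed (use assms in \<open>auto intro!: always_eventually continuous_on_sum\<close>)

text \<open>For nonzero k a shift t with k . t = pi changes the sign of the character, so its
  integral equals its own negative. The cell is not invariant under the shift; therefore the
  character is cut off to the shifted cell and unfolded back to the cell, which its periodicity
  allows.\<close>

lemma set_integral_cis_lattice:
  fixes k :: "int^'n::finite"
  shows "(LINT z:cell|lebesgue. cis (lattice_vec k \<bullet> z)) = (if k = 0 then of_real ((2 * pi) ^ CARD('n)) else 0)"
proof (cases "k = 0")
  case True
  then show ?thesis
    using measure_cell[where 'n='n] set_integrable_cell_const[where 'n='n, of 1]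
    by (simp add: set_lebesgue_integral_def set_integrable_def scaleR_conv_of_real)
next
  case False
  then obtain i where i: "k $ i \<noteq> 0" by (auto simp: vec_eq_iff)
  define t :: "real^'n" where "t = axis i (pi / of_int (k $ i))"
  let ?H = "\<lambda>z::real^'n. cis (lattice_vec k \<bullet> z)"
  have kt: "lattice_vec k \<bullet> t = pi"
    using i by (simp add: t_def inner_axis lattice_vec_def)
  have Ht: "?H (z + t) = - ?H z" for z
    by (simp add: inner_add_right kt minus_cis)
  define F where "F x = indicator cell (x - t) *\<^sub>R ?H x" for x
  have "continuous_on UNIV ?H" by (intro continuous_intros)
  then have [measurable]: "?H \<in> borel_measurable borel" by (rule borel_measurable_continuous_onI)
  have F: "F \<in> borel_measurable lebesgue"
    unfolding F_def by (rule measurable_completion) measurable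
  \<comment> \<open>F is bounded and vanishes off a bounded set, so it satisfies a decay bound for
    any weight; the index 1 is an arbitrary choice.\<close>
  obtain M where M: "0 < M" "\<And>z. z \<in> (+) t ` cell \<Longrightarrow> weight 1 z \<le> M"
    using weight_bounded[OF bounded_translation[OF bounded_cell, of t], of 1] by blast
  have F_le: "norm (F x) \<le> M / weight 1 x" for x
  proof (cases "x - t \<in> cell")
    case True
    then have "weight 1 x \<le> M" using M(2)[of x] image_eqI[of x "(+) t" "x - t" cell] by simp
    then show ?thesis using True by (simp add: F_def le_divide_eq)
  qed (use M in \<open>simp add: F_def\<close>)
  have per: "(\<Sum>\<^sub>\<infinity>l. F (z + per l)) = ?H z" for z
  proof -
    obtain l0 where l0: "(z - t) - per l0 \<in> cell" "\<And>l. (z - t) - per l \<in> cell \<Longrightarrow> l = l0"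
      using cell_translate_unique[of "z - t"] by blast
    have eq: "z + per l - t = (z - t) - per (- l)" for l by simp
    have "(\<Sum>\<^sub>\<infinity>l. F (z + per l)) = (\<Sum>\<^sub>\<infinity>l\<in>{- l0}. F (z + per l))"
      using l0(2) unfolding F_def eq
      by (intro infsum_cong_neutral) (auto simp: indicator_def simp del: lattice_vec_minus)
    also have "\<dots> = indicator cell ((z - t) - per l0) *\<^sub>R ?H (z + per (- l0))"
      by (simp add: F_def algebra_simps)
    also have "\<dots> = ?H z" unfolding cis_lattice_periodic using l0(1) by simp
    finally show ?thesis .
  qed
  have "(LINT x|lebesgue. F x) = (LINT z:cell|lebesgue. ?H z)"
    using integral_unfold_weight[OF F _ F_le] by (simp only: per zero_less_one)
  moreover have "(LINT x|lebesgue. F x) = (LINT x|lebesgue. F (x + t))"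
    using lebesgue_integral_translation[OF F, of t] by simp
  moreover have "\<dots> = - (LINT z:cell|lebesgue. ?H z)"
    by (simp add: F_def Ht set_lebesgue_integral_def)
  ultimately have "(LINT z:cell|lebesgue. ?H z) = - (LINT z:cell|lebesgue. ?H z)" by simp
  then show ?thesis using False by simp
qed

text \<open>The trigonometric polynomials $\prod_i ((1 + \cos z_i)/2)^N$ concentrate at the origin
  as $N \to \infty$.\<close>

lemma vanishing_coeffs_concentrate:
  fixes H :: "real^'n::finite \<Rightarrow> complex"
  assumes H: "continuous_on (cbox (\<chi> i. - pi) (\<chi> i. pi)) H"
    and zero: "\<And>k. (LINT z:cell|lebesgue. H z * cis (- (lattice_vec k \<bullet> z))) = 0"
  shows "(LINT z:cell|lebesgue. H z * of_real ((\<Prod>i\<in>UNIV. (1 + cos (z $ i)) / 2) ^ N)) = 0"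
proof -
  \<comment> \<open>Z collects the continuous multipliers f for which all coefficients of H f
    vanish. Multiplication by cos z_i replaces a coefficient by the mean of its two neighbours in
    direction i, hence stays in Z.\<close>
  define Z where "Z = {f :: real^'n \<Rightarrow> complex. continuous_on UNIV f \<and>
    (\<forall>k. (LINT z:cell|lebesgue. H z * f z * cis (- (lattice_vec k \<bullet> z))) = 0)}"
  have step: "(\<lambda>z. f z * of_real ((1 + cos (z $ i)) / 2)) \<in> Z" if f: "f \<in> Z" for f i
  proof -
    have cf: "continuous_on UNIV f" and zf: "\<And>k. (LINT z:cell|lebesgue. H z * f z * cis (- (lattice_vec k \<bullet> z))) = 0"
      using f by (auto simp: Z_def)
    have "(LINT z:cell|lebesgue. H z * (f z * of_real ((1 + cos (z $ i)) / 2)) * cis (- (lattice_vec k \<bullet> z))) = 0" for k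
    proof -
      let ?e = "axis i 1 :: int^'n"
      have "lattice_vec ?e = axis i 1" by (simp add: lattice_vec_def vec_eq_iff axis_def)
      then have e: "lattice_vec ?e \<bullet> z = z $ i" for z by (simp add: inner_axis')
      have eq: "H z * (f z * of_real ((1 + cos (z $ i)) / 2)) * cis (- (lattice_vec k \<bullet> z)) =
          (1/2) * (H z * f z * cis (- (lattice_vec k \<bullet> z)))
          + ((1/4) * (H z * f z * cis (- (lattice_vec (k - ?e) \<bullet> z)))
          + (1/4) * (H z * f z * cis (- (lattice_vec (k + ?e) \<bullet> z))))" for z
      proof -
        have c: "of_real (cos (z $ i)) = (cis (z $ i) + cis (- (z $ i))) / 2"
          by (simp add: complex_eq_iff)
        have l: "lattice_vec (k - ?e) \<bullet> z = lattice_vec k \<bullet> z - z $ i"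
          "lattice_vec (k + ?e) \<bullet> z = lattice_vec k \<bullet> z + z $ i"
          using lattice_vec_add[of k "- ?e"] by (simp_all add: lattice_vec_add e inner_add_left inner_diff_left)
        have "cis (- (lattice_vec k \<bullet> z - z $ i)) = cis (- (lattice_vec k \<bullet> z)) * cis (z $ i)"
          "cis (- (lattice_vec k \<bullet> z + z $ i)) = cis (- (lattice_vec k \<bullet> z)) * cis (- (z $ i))"
          by (simp_all add: cis_mult)
        then show ?thesis unfolding l by (simp add: c field_simps)
      qed
      have si: "set_integrable lebesgue cell (\<lambda>z. H z * f z * cis (- (lattice_vec l \<bullet> z)))" for l
        by (intro set_integrable_cell_continuous continuous_intros H continuous_on_subset[OF cf]) auto
      show ?thesis
        unfolding eq
        by (subst set_integral_add | intro set_integral_add set_integrable_mult_right si | simp add: zf si)+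
    qed
    then show ?thesis by (auto simp: Z_def intro!: continuous_intros continuous_on_subset[OF cf])
  qed
  have step_prod: "(\<lambda>z. f z * of_real (\<Prod>i\<in>A. (1 + cos (z $ i)) / 2)) \<in> Z" if "f \<in> Z" for f A
  proof -
    have "finite A" by simp
    then show ?thesis
    proof (induction A rule: finite_induct)
      case (insert i A)
      have "(\<lambda>z. f z * of_real (\<Prod>i\<in>A. (1 + cos (z $ i)) / 2) * of_real ((1 + cos (z $ i)) / 2)) \<in> Z"
        by (rule step[OF insert.IH])
      then show ?case using insert.hyps by (simp add: mult_ac)
    qed (use that in simp)
  qed
  have "(\<lambda>z. of_real ((\<Prod>i\<in>UNIV. (1 + cos (z $ i)) / 2) ^ N)) \<in> Z"
  proof (induction N)
    case 0
    then show ?case using zero by (simp add: Z_def)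
  next
    case (Suc N)
    from step_prod[OF this, of UNIV] show ?case by (simp add: mult_ac)
  qed
  then have "(LINT z:cell|lebesgue. H z * of_real ((\<Prod>i\<in>UNIV. (1 + cos (z $ i)) / 2) ^ N)
      * cis (- (lattice_vec 0 \<bullet> z))) = 0"
    unfolding Z_def by blast
  then show ?thesis by simp
qed

lemma prod_one_plus_cos_lt_1:
  fixes z :: "real^'n::finite"
  assumes "z \<in> cbox (\<chi> i. - pi) (\<chi> i. pi)" "z \<noteq> 0"
  shows "(\<Prod>i\<in>UNIV. (1 + cos (z $ i)) / 2) < 1"
proof -
  obtain i where i: "z $ i \<noteq> 0" using assms(2) by (auto simp: vec_eq_iff)
  have "\<bar>z $ i\<bar> \<le> pi" using assms(1) by (auto simp: mem_box_cart abs_le_iff minus_le_iff)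
  then have "cos \<bar>z $ i\<bar> < cos 0" using i by (intro cos_monotone_0_pi) auto
  then have "(1 + cos (z $ i)) / 2 < 1" by simp
  have b: "0 \<le> (1 + cos (z $ j)) / 2" "(1 + cos (z $ j)) / 2 \<le> 1" for j
    using add_left_mono[OF cos_ge_minus_one[of "z $ j"], of 1] by simp_all
  have "(\<Prod>j\<in>UNIV. (1 + cos (z $ j)) / 2)
      = (1 + cos (z $ i)) / 2 * (\<Prod>j\<in>UNIV - {i}. (1 + cos (z $ j)) / 2)"
    by (rule prod.remove) auto
  also have "\<dots> \<le> (1 + cos (z $ i)) / 2 * 1"
    using b by (intro mult_left_mono prod_le_1) auto
  finally show ?thesis using \<open>(1 + cos (z $ i)) / 2 < 1\<close> by simp
qed

text \<open>If H 0 is nonzero, normalise to g 0 = 1. The integral of g q^N is 0 for every N; yet a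
  small ball of volume V about 0 contributes at least r'^N V / 2, while the region where g may be
  negative contributes at least - M r^N times the volume of the cell, with r < r'. A large N gives
  the contradiction. The conclusion concerns only the interior point 0, so H may take different
  values on opposite faces of the cube.\<close>

lemma vanishing_coeffs_imp_zero:
  fixes H :: "real^'n::finite \<Rightarrow> complex"
  assumes H: "continuous_on (cbox (\<chi> i. - pi) (\<chi> i. pi)) H"
    and zero: "\<And>k. (LINT z:cell|lebesgue. H z * cis (- (lattice_vec k \<bullet> z))) = 0"
  shows "H 0 = 0"
proof (rule ccontr)
  assume H0: "H 0 \<noteq> 0"
  let ?Q = "cbox (\<chi> i. - pi) (\<chi> i. pi) :: (real^'n) set"
  define q where "q z = (\<Prod>i\<in>UNIV. (1 + cos (z $ i)) / 2)" for z :: "real^'n"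
  define g where "g z = Re (H z / H 0)" for z
  have cg: "continuous_on ?Q g" unfolding g_def using H H0 by (intro continuous_intros) auto
  have cq: "continuous_on A q" for A unfolding q_def by (intro continuous_intros) auto
  have q0: "q 0 = 1" by (simp add: q_def)
  have q_nonneg: "0 \<le> q z" for z
  proof -
    have "0 \<le> (1 + cos (z $ j)) / 2" for j using add_left_mono[OF cos_ge_minus_one[of "z $ j"], of 1] by simp
    then show ?thesis unfolding q_def by (intro prod_nonneg) auto
  qed
  have int_gq: "set_integrable lebesgue cell (\<lambda>z. g z * q z ^ N)" for N
    by (rule set_integrable_subset[OF absolutely_integrable_continuous _ cell_subset_cbox])
      (auto intro!: continuous_intros cg cq)
  have gq0: "(LINT z:cell|lebesgue. g z * q z ^ N) = 0" for N
  proof -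
    have si: "set_integrable lebesgue cell (\<lambda>z. H z / H 0 * of_real (q z ^ N))"
      using H H0 by (intro set_integrable_cell_continuous continuous_intros cq) auto
    have "(LINT z:cell|lebesgue. H z / H 0 * of_real (q z ^ N))
        = (LINT z:cell|lebesgue. (1 / H 0) * (H z * of_real (q z ^ N)))"
      by (simp add: field_simps)
    also have "\<dots> = 0"
      unfolding q_def using vanishing_coeffs_concentrate[OF H zero, of N] by simp
    finally have "Re (LINT z:cell|lebesgue. H z / H 0 * of_real (q z ^ N)) = 0" by (simp only: zero_complex.sel)
    moreover have "Re (LINT z:cell|lebesgue. H z / H 0 * of_real (q z ^ N))
        = (LINT z|lebesgue. Re (indicator cell z *\<^sub>R (H z / H 0 * of_real (q z ^ N))))"
      using si unfolding set_integrable_def set_lebesgue_integral_def by (rule integral_Re[symmetric])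
    moreover have "Re (indicator cell z *\<^sub>R (H z / H 0 * of_real (q z ^ N))) = indicator cell z * (g z * q z ^ N)" for z
      unfolding scaleR_complex.sel g_def Re_complex_of_real times_complex.sel Im_complex_of_real by simp
    ultimately have "(LINT z|lebesgue. indicator cell z * (g z * q z ^ N)) = 0"
      by (metis (no_types, lifting) Bochner_Integration.integral_cong)
    then show ?thesis by (simp add: set_lebesgue_integral_def)
  qed
  have zero_int: "0 \<in> interior ?Q" by (auto simp: interior_cbox mem_box_cart)
  then have "isCont g 0" using continuous_on_interior[OF cg] by blast
  moreover have "g 0 = 1" using H0 by (simp add: g_def)
  ultimately obtain d1 where d1: "0 < d1" "\<And>z. dist z 0 < d1 \<Longrightarrow> dist (g z) 1 < 1/2"
    unfolding continuous_at_eps_delta using half_gt_zero[OF zero_less_one] by metis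
  have g_half: "1/2 \<le> g z" if "norm z < d1" for z
    using d1(2)[of z] that by (simp add: dist_norm abs_real_def split: if_splits)
  \<comment> \<open>Away from 0 the function q stays below some r < 1 by compactness; the maximum
    with 1/2 keeps r positive, since q can vanish there.\<close>
  obtain r where r: "0 < r" "r < 1" "\<And>z. z \<in> ?Q \<Longrightarrow> d1 \<le> norm z \<Longrightarrow> q z \<le> r"
  proof (cases "?Q - ball 0 d1 = {}")
    case True
    then show ?thesis using that[of "1/2"] by (force simp: not_less[symmetric])
  next
    case False
    have "compact (?Q - ball 0 d1)" by (intro compact_diff) auto
    then obtain w where w: "w \<in> ?Q - ball 0 d1" "\<And>z. z \<in> ?Q - ball 0 d1 \<Longrightarrow> q z \<le> q w"
      using continuous_attains_sup[OF _ False cq] by blast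
    have "q w < 1"
      unfolding q_def using w(1) d1(1) by (intro prod_one_plus_cos_lt_1) auto
    then show ?thesis
      using that[of "max (q w) (1/2)"] w(2) by (force simp: not_less le_max_iff_disj)
  qed
  \<comment> \<open>A level strictly between r and 1: q exceeds it on a small ball about 0, and (r /
    r')^N tends to 0.\<close>
  define r' where "r' = (1 + r) / 2"
  have r': "r < r'" "r' < 1" "0 < r'" using r by (auto simp: r'_def)
  have "isCont q 0" using cq[of UNIV] by (simp add: continuous_on_eq_continuous_at)
  then obtain d2 where d2: "0 < d2" "\<And>z. dist z 0 < d2 \<Longrightarrow> dist (q z) 1 < 1 - r'"
    unfolding continuous_at_eps_delta q0 using r'(2) by (metis diff_gt_0_iff_gt)
  have q_ge: "r' \<le> q z" if "norm z < d2" for z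
    using d2(2)[of z] that by (simp add: dist_norm abs_less_iff)
  obtain d3 where d3: "0 < d3" "ball 0 d3 \<subseteq> interior ?Q"
    using zero_int open_contains_ball[of "interior ?Q"] by auto
  define d where "d = min (min d1 d2) d3"
  have d: "0 < d" "d \<le> d1" "d \<le> d2" "d \<le> d3" using d1 d2 d3 by (auto simp: d_def)
  have "bounded (g ` ?Q)" by (intro compact_imp_bounded compact_continuous_image cg) simp
  then obtain M where M: "0 < M" "\<And>z. z \<in> ?Q \<Longrightarrow> \<bar>g z\<bar> \<le> M"
    using bounded_pos[of "g ` ?Q"] by auto
  define B where "B = ball (0::real^'n) d"
  have B_cell: "B \<subseteq> cell"
  proof -
    have "box (\<chi> i. - pi) (\<chi> i. pi :: real^'n) \<subseteq> cell"
      by (auto simp: cell_def mem_box_cart less_imp_le)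
    then show ?thesis using d3 d by (force simp: B_def interior_cbox)
  qed
  define V where "V = measure lebesgue B"
  have "\<not> negligible B" unfolding B_def using d by (intro open_not_negligible) auto
  then have V: "0 < V"
    unfolding V_def using negligible_iff_measure0[of B] by (simp add: B_def zero_less_measure_iff)
  let ?c = "measure lebesgue (cell :: (real^'n) set)"
  have ineq: "r' ^ N / 2 * V \<le> M * r ^ N * ?c" for N
  proof -
    have lo: "r' ^ N / 2 * indicator B z - M * r ^ N * indicator cell z \<le> indicator cell z * (g z * q z ^ N)" for z
    proof (cases "z \<in> cell")
      case zc: True
      then have zQ: "z \<in> ?Q" using cell_subset_cbox by blast
      have Mr: "0 \<le> M * r ^ N" using M r by simp
      consider "z \<in> B" | "z \<notin> B" "norm z < d1" | "z \<notin> B" "d1 \<le> norm z" by linarith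
      then show ?thesis
      proof cases
        case 1
        then have "norm z < d1" "norm z < d2" using d by (auto simp: B_def)
        then have "1/2 * r' ^ N \<le> g z * q z ^ N"
          using g_half[of z] q_ge[of z] r' by (intro mult_mono power_mono) auto
        then show ?thesis using 1 zc Mr by simp
      next
        case 2
        then have "0 \<le> g z * q z ^ N" using g_half[of z] q_nonneg[of z] by simp
        then show ?thesis using 2 zc Mr by simp
      next
        case 3
        then have "q z ^ N \<le> r ^ N" using r(3)[OF zQ] q_nonneg by (intro power_mono) auto
        then have "\<bar>g z\<bar> * q z ^ N \<le> M * r ^ N"
          using M(2)[OF zQ] q_nonneg[of z] M(1) by (intro mult_mono) auto
        moreover have "- (\<bar>g z\<bar> * q z ^ N) \<le> g z * q z ^ N"
          using mult_right_mono[of "- \<bar>g z\<bar>" "g z" "q z ^ N"] q_nonneg[of z] by simp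
        ultimately show ?thesis using 3 zc by simp
      qed
    qed (use B_cell in \<open>auto simp: indicator_def\<close>)
    have iB: "integrable lebesgue (indicator B :: _ \<Rightarrow> real)"
      unfolding B_def by (simp flip: lmeasurable_iff_integrable)
    have ic: "integrable lebesgue (indicator cell :: real^'n \<Rightarrow> real)"
      by (simp flip: lmeasurable_iff_integrable)
    have "(LINT z|lebesgue. r' ^ N / 2 * indicator B z - M * r ^ N * indicator cell z)
        \<le> (LINT z|lebesgue. indicator cell z * (g z * q z ^ N))"
      using int_gq[of N] iB ic lo
      by (intro integral_mono) (auto simp: set_integrable_def)
    also have "\<dots> = 0" using gq0[of N] by (simp add: set_lebesgue_integral_def)
    also have "(LINT z|lebesgue. r' ^ N / 2 * indicator B z - M * r ^ N * indicator cell z)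
        = r' ^ N / 2 * V - M * r ^ N * ?c"
      using iB ic by (subst Bochner_Integration.integral_diff) (auto simp: V_def)
    finally show ?thesis by simp
  qed
  have c: "0 < ?c" by (simp add: measure_cell)
  have "r / r' < 1" using r r' by simp
  moreover have "0 < V / (2 * M * ?c)" using V M c by simp
  ultimately obtain N where "(r / r') ^ N < V / (2 * M * ?c)"
    using real_arch_pow_inv by blast
  then have "M * r ^ N * ?c < r' ^ N / 2 * V"
    using M c r' by (simp add: power_divide field_simps)
  then show False using ineq[of N] by simp
qed

lemma set_integral_fourier_series:
  fixes c :: "int^'n::finite \<Rightarrow> complex"
  assumes sum: "(\<lambda>k. norm (c k)) summable_on UNIV"
  shows "(LINT z:cell|lebesgue. (\<Sum>\<^sub>\<infinity>k. c k * cis (lattice_vec k \<bullet> z)) * cis (- (lattice_vec l \<bullet> z)))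
    = (2 * pi) ^ CARD('n) * c l"
proof -
  define G where "G z = (\<Sum>\<^sub>\<infinity>k. c k * cis (lattice_vec k \<bullet> z))" for z
  let ?e = "enum_lattice :: nat \<Rightarrow> int^'n"
  define h where "h j z = indicator cell z *\<^sub>R (c (?e j) * cis (lattice_vec (?e j - l) \<bullet> z))" for j z
  have sumc: "summable (\<lambda>j. norm (c (?e j)))"
    using summable_enum_lattice[OF sum] .
  have inth: "integrable lebesgue (h j)" for j
  proof -
    have "set_integrable lebesgue cell (\<lambda>z. c (?e j) * cis (lattice_vec (?e j - l) \<bullet> z))"
      by (intro set_integrable_cell_continuous continuous_intros)
    then show ?thesis by (simp add: h_def[abs_def] set_integrable_def)
  qed
  have normh: "norm (h j z) = norm (c (?e j)) * indicator cell z" for j z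
    by (simp add: h_def norm_mult indicator_def)
  have Gh: "indicator cell z *\<^sub>R (G z * cis (- (lattice_vec l \<bullet> z))) = (\<Sum>j. h j z)" for z
  proof -
    have "G z * cis (- (lattice_vec l \<bullet> z))
        = (\<Sum>\<^sub>\<infinity>k. c k * cis (lattice_vec k \<bullet> z) * cis (- (lattice_vec l \<bullet> z)))"
      unfolding G_def by (simp add: infsum_cmult_left')
    also have "\<dots> = (\<Sum>\<^sub>\<infinity>k. c k * cis (lattice_vec (k - l) \<bullet> z))"
      using lattice_vec_add[of _ "- l"] by (simp add: mult.assoc cis_mult inner_diff_left)
    also have "\<dots> = (\<Sum>j. c (?e j) * cis (lattice_vec (?e j - l) \<bullet> z))"
      using sum by (intro infsum_enum_lattice) (simp add: norm_mult)
    finally show ?thesis by (simp add: h_def indicator_def)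
  qed
  have delta: "(LINT z|lebesgue. h j z) = (if ?e j = l then (2 * pi) ^ CARD('n) * c l else 0)" for j
  proof -
    have "(LINT z|lebesgue. h j z) = c (?e j) * (LINT z:cell|lebesgue. cis (lattice_vec (?e j - l) \<bullet> z))"
      unfolding h_def by (simp flip: set_lebesgue_integral_def)
    then show ?thesis by (simp add: set_integral_cis_lattice)
  qed
  obtain j0 where j0: "?e j0 = l"
    using bij_betw_imp_surj_on[OF bij_enum_lattice] by (metis surjD)
  have ej: "?e j = l \<longleftrightarrow> j = j0" for j
    using inj_onD[OF bij_betw_imp_inj_on[OF bij_enum_lattice], of j j0] j0 by auto
  have "(LINT z|lebesgue. (\<Sum>j. h j z)) = (\<Sum>j. LINT z|lebesgue. h j z)"
  proof (rule integral_suminf[OF inth])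
    show "AE z in lebesgue. summable (\<lambda>j. norm (h j z))"
      unfolding normh by (intro AE_I2 summable_mult2 sumc)
    show "summable (\<lambda>j. LINT z|lebesgue. norm (h j z))"
      unfolding normh using summable_mult2[OF sumc] by simp
  qed
  also have "\<dots> = (2 * pi) ^ CARD('n) * c l"
    unfolding delta ej using sums_single[of j0 "\<lambda>_. (2 * pi) ^ CARD('n) * c l"] by (simp add: sums_iff)
  finally show ?thesis by (simp add: set_lebesgue_integral_def Gh flip: G_def)
qed

text \<open>The periodization F of f and the series G with coefficients \<open>c k\<close> are
  continuous on the closed cube and have the same Fourier coefficients, so F - G vanishes at 0. The
  point 0 is enough, because translates and modulations of a function can be inserted for f.\<close>

lemma poisson_summation_zero:
  fixes f :: "real^'n::finite \<Rightarrow> complex"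
  assumes f: "continuous_on UNIV f" and s: "0 < s" and C: "\<And>x. norm (f x) \<le> C / weight s x"
    and sum: "(\<lambda>k. norm (fourier f (lattice_vec k))) summable_on UNIV"
  shows "(\<Sum>\<^sub>\<infinity>k. f (per k)) = (\<Sum>\<^sub>\<infinity>k. fourier f (lattice_vec k))"
proof -
  let ?Q = "cbox (\<chi> i. - pi) (\<chi> i. pi) :: (real^'n) set"
  define F where "F z = (\<Sum>\<^sub>\<infinity>k. f (z + per k))" for z
  define c where "c k = fourier f (lattice_vec k)" for k
  define G where "G z = (\<Sum>\<^sub>\<infinity>k. c k * cis (lattice_vec k \<bullet> z))" for z
  have C0: "0 \<le> C" using C by (rule weight_bound_nonneg)
  obtain M where M: "0 < M" "\<And>z. z \<in> ?Q \<Longrightarrow> weight s z \<le> M"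
    using weight_bounded[OF bounded_cbox[of "\<chi> i. - pi" "\<chi> i. pi :: real^'n"], of s] by blast
  define a where "a k = C * (2 powr ((real CARD('n) + 2 * s) / 2) * M) * (1 / weight s (per k))" for k :: "int^'n"
  have a: "a summable_on UNIV"
    unfolding a_def by (intro summable_on_cmult_right summable_lattice_weight s)
  have cF: "continuous_on ?Q F"
    unfolding F_def
  proof (rule continuous_on_infsum[OF _ _ a])
    show "continuous_on ?Q (\<lambda>z. f (z + per k))" for k
      by (intro continuous_on_compose2[OF f] continuous_intros) auto
    show "norm (f (z + per k)) \<le> a k" if "z \<in> ?Q" for k z
      unfolding a_def by (rule weight_bound_translates[OF s C0 C M(2)[OF that]])
  qed
  have cG: "continuous_on ?Q G"
    unfolding G_def using sum
    by (intro continuous_on_infsum[where a="\<lambda>k. norm (c k)"] continuous_intros) (auto simp: norm_mult c_def)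
  have coF: "(LINT z:cell|lebesgue. F z * cis (- (lattice_vec l \<bullet> z))) = (2 * pi) ^ CARD('n) * c l" for l
  proof -
    let ?g = "\<lambda>x. f x * cis (- (lattice_vec l \<bullet> x))"
    have "continuous_on UNIV ?g" by (intro continuous_intros f)
    then have m: "?g \<in> borel_measurable lebesgue"
      by (intro measurable_completion) (simp add: borel_measurable_continuous_onI)
    have "(LINT x|lebesgue. ?g x) = (LINT z:cell|lebesgue. \<Sum>\<^sub>\<infinity>k. ?g (z + per k))"
      by (rule integral_unfold_weight[OF m s, of C]) (use C in \<open>auto simp: norm_mult\<close>)
    also have "\<dots> = (LINT z:cell|lebesgue. F z * cis (- (lattice_vec l \<bullet> z)))"
      unfolding cis_minus_lattice_periodic F_def by (simp add: infsum_cmult_left')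
    finally show ?thesis
      unfolding c_def fourier_def by (simp add: scaleR_conv_of_real inner_commute)
  qed
  have coG: "(LINT z:cell|lebesgue. G z * cis (- (lattice_vec l \<bullet> z))) = (2 * pi) ^ CARD('n) * c l" for l
    unfolding G_def using sum by (intro set_integral_fourier_series) (simp add: c_def)
  have "(\<lambda>z. F z - G z) 0 = 0"
  proof (rule vanishing_coeffs_imp_zero)
    show "continuous_on ?Q (\<lambda>z. F z - G z)" by (intro continuous_intros cF cG)
    fix k
    have "set_integrable lebesgue cell (\<lambda>z. F z * cis (- (lattice_vec k \<bullet> z)))"
      "set_integrable lebesgue cell (\<lambda>z. G z * cis (- (lattice_vec k \<bullet> z)))"
      by (intro set_integrable_cell_continuous continuous_intros cF cG)+
    then show "(LINT z:cell|lebesgue. (F z - G z) * cis (- (lattice_vec k \<bullet> z))) = 0"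
      by (simp add: left_diff_distrib set_integral_diff coF coG)
  qed
  then show ?thesis by (simp add: F_def G_def c_def)
qed

subsection \<open>Schwartz functions and their Fourier transforms\<close>

lemma iter_deriv_append: "iter_deriv \<gamma> (iter_deriv \<delta> f) = iter_deriv (\<gamma> @ \<delta>) f"
  by (induction \<gamma>) auto

lemma has_vector_derivative_along_axis:
  fixes f :: "real^'n::finite \<Rightarrow> complex"
  assumes f': "(f has_derivative f') (at x)" and lin: "linear f'"
  shows "((\<lambda>t. f (x + t *\<^sub>R axis i 1)) has_vector_derivative f' (axis i 1)) (at 0)"
proof -
  have "((\<lambda>t. x + t *\<^sub>R axis i 1) has_derivative (\<lambda>t. t *\<^sub>R axis i 1)) (at 0)"
    by (auto intro!: derivative_eq_intros)
  moreover have "(f has_derivative f') (at (x + 0 *\<^sub>R axis i 1))" using f' by simp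
  ultimately have "((\<lambda>t. f (x + t *\<^sub>R axis i 1)) has_derivative (\<lambda>t. f' (t *\<^sub>R axis i 1))) (at 0)"
    by (rule has_derivative_compose)
  then show "((\<lambda>t. f (x + t *\<^sub>R axis i 1)) has_vector_derivative f' (axis i 1)) (at 0)"
    by (simp add: has_vector_derivative_def linear_scale[OF lin])
qed

lemma has_vector_derivative_partial_deriv:
  fixes f :: "real^'n::finite \<Rightarrow> complex"
  assumes "f differentiable (at x)"
  shows "((\<lambda>t. f (x + t *\<^sub>R axis i 1)) has_vector_derivative partial_deriv i f x) (at 0)"
proof -
  obtain f' where f': "(f has_derivative f') (at x)"
    using assms by (auto simp: differentiable_def)
  note d = has_vector_derivative_along_axis[OF f' has_derivative_linear[OF f'], of i]
  show ?thesis unfolding partial_deriv_def using d by (simp add: vector_derivative_at[OF d])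
qed

lemma has_derivative_partial_deriv:
  fixes f :: "real^'n::finite \<Rightarrow> complex"
  assumes "f differentiable (at x)"
  shows "(f has_derivative (\<lambda>h. \<Sum>i\<in>UNIV. h $ i *\<^sub>R partial_deriv i f x)) (at x)"
proof -
  obtain f' where f': "(f has_derivative f') (at x)"
    using assms by (auto simp: differentiable_def)
  have lin: "linear f'" using f' by (rule has_derivative_linear)
  have pd: "partial_deriv i f x = f' (axis i 1)" for i
  proof -
    from f' lin have "((\<lambda>t. f (x + t *\<^sub>R axis i 1)) has_vector_derivative f' (axis i 1)) (at 0)"
      by (rule has_vector_derivative_along_axis)
    then show ?thesis unfolding partial_deriv_def by (rule vector_derivative_at)
  qed
  have expand: "f' h = (\<Sum>i\<in>UNIV. h $ i *\<^sub>R f' (axis i 1))" for h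
  proof -
    have "h = (\<Sum>i\<in>UNIV. h $ i *\<^sub>R axis i 1)"
      using basis_expansion[of h] by (simp add: scalar_mult_eq_scaleR)
    then have "f' h = f' (\<Sum>i\<in>UNIV. h $ i *\<^sub>R axis i 1)" by (rule arg_cong)
    also have "\<dots> = (\<Sum>i\<in>UNIV. h $ i *\<^sub>R f' (axis i 1))"
      unfolding linear_sum[OF lin] linear_scale[OF lin] ..
    finally show ?thesis .
  qed
  have eq: "f' = (\<lambda>h. \<Sum>i\<in>UNIV. h $ i *\<^sub>R partial_deriv i f x)"
    unfolding pd
  proof (rule ext)
    show "f' h = (\<Sum>i\<in>UNIV. h $ i *\<^sub>R f' (axis i 1))" for h by (rule expand)
  qed
  show ?thesis using f' unfolding eq .
qed

lemma sum_axis_scaleR: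
  fixes p :: "'n::finite \<Rightarrow> 'b::real_vector"
  shows "(\<Sum>j\<in>UNIV. axis i 1 $ j *\<^sub>R p j) = p i"
proof -
  have "(\<Sum>j\<in>UNIV. axis i 1 $ j *\<^sub>R p j) = (\<Sum>j\<in>UNIV. if j = i then p j else 0)"
    by (intro sum.cong) (auto simp: axis_def)
  then show ?thesis by simp
qed

lemma partial_deriv_eqI:
  fixes f :: "real^'n::finite \<Rightarrow> complex"
  assumes "(f has_derivative f') (at x)"
  shows "partial_deriv i f x = f' (axis i 1)"
proof -
  have "f' = (\<lambda>h. \<Sum>j\<in>UNIV. h $ j *\<^sub>R partial_deriv j f x)"
    by (rule has_derivative_unique[OF assms has_derivative_partial_deriv[OF differentiableI[OF assms]]])
  then have "f' (axis i 1) = (\<Sum>j\<in>UNIV. axis i 1 $ j *\<^sub>R partial_deriv j f x)"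
    by (rule fun_cong)
  then show ?thesis by (simp add: sum_axis_scaleR)
qed

lemma norm_partial_sum_le:
  fixes h :: "real^'n::finite" and p :: "'n \<Rightarrow> complex"
  assumes "\<And>i. norm (p i) \<le> B"
  shows "norm (\<Sum>i\<in>UNIV. h $ i *\<^sub>R p i) \<le> real CARD('n) * B * norm h"
proof -
  have "norm (\<Sum>i\<in>UNIV. h $ i *\<^sub>R p i) \<le> (\<Sum>i\<in>(UNIV::'n set). norm h * B)"
  proof (rule order_trans[OF norm_sum], rule sum_mono)
    show "norm (h $ i *\<^sub>R p i) \<le> norm h * B" for i
      unfolding norm_scaleR by (intro mult_mono component_le_norm_cart assms) auto
  qed
  then show ?thesis by (simp add: mult_ac)
qed

lemma norm_diff_le_partial_deriv:
  fixes f :: "real^'n::finite \<Rightarrow> complex"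
  assumes "\<And>x. f differentiable (at x)"
    and "\<And>t i. 0 \<le> t \<Longrightarrow> t \<le> 1 \<Longrightarrow> norm (partial_deriv i f (x + t *\<^sub>R h)) \<le> B"
  shows "norm (f (x + h) - f x) \<le> real CARD('n) * B * norm h"
proof -
  have "norm (f (x + h) - f x) \<le> norm h * (real CARD('n) * B)"
  proof (rule differentiable_bound_segment[where G=UNIV])
    show "(f has_derivative (\<lambda>h. \<Sum>i\<in>UNIV. h $ i *\<^sub>R partial_deriv i f x)) (at x within UNIV)" for x
      using has_derivative_partial_deriv[OF assms(1)] by simp
    show "onorm (\<lambda>h'. \<Sum>i\<in>UNIV. h' $ i *\<^sub>R partial_deriv i f (x + t *\<^sub>R h)) \<le> real CARD('n) * B"
      if "t \<in> {0..1}" for t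
      using that assms(2)[of t] by (intro onorm_le norm_partial_sum_le) auto
  qed auto
  then show ?thesis by (simp add: mult_ac)
qed

lemma has_vector_derivative_quotient:
  fixes f :: "real \<Rightarrow> 'a::real_normed_vector"
  assumes "(f has_vector_derivative D) (at 0)"
  shows "((\<lambda>h. (f h - f 0) /\<^sub>R h) \<longlongrightarrow> D) (at 0)"
proof (rule LIM_zero_cancel, rule tendsto_norm_zero_cancel)
  have "((\<lambda>h. norm (f (0 + h) - f 0 - h *\<^sub>R D) / norm h) \<longlongrightarrow> 0) (at 0)"
    using assms unfolding has_vector_derivative_def has_derivative_at by blast
  moreover have "\<forall>\<^sub>F h in at 0. norm (f (0 + h) - f 0 - h *\<^sub>R D) / norm h = norm ((f h - f 0) /\<^sub>R h - D)"
    unfolding eventually_at_filter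
  proof (intro always_eventually allI impI)
    fix h :: real assume "h \<noteq> 0"
    then have "(f h - f 0) /\<^sub>R h - D = (f (0 + h) - f 0 - h *\<^sub>R D) /\<^sub>R h"
      by (simp add: scaleR_diff_right)
    then show "norm (f (0 + h) - f 0 - h *\<^sub>R D) / norm h = norm ((f h - f 0) /\<^sub>R h - D)"
      by (simp add: divide_inverse mult.commute)
  qed
  ultimately show "((\<lambda>h. norm ((f h - f 0) /\<^sub>R h - D)) \<longlongrightarrow> 0) (at 0)"
    by (rule Lim_transform_eventually)
qed

section \<open>Polynomial bounds for Schwartz functions and their derivatives\<close>

lemma schwartz_differentiable: "\<phi> \<in> schwartz \<Longrightarrow> iter_deriv \<gamma> \<phi> differentiable (at x)"
  by (auto simp: schwartz_def smooth_def)

lemma schwartz_iter_deriv: "\<phi> \<in> schwartz \<Longrightarrow> iter_deriv \<gamma> \<phi> \<in> schwartz"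
  by (auto simp: schwartz_def smooth_def iter_deriv_append)

lemma schwartz_partial_deriv: "\<phi> \<in> schwartz \<Longrightarrow> partial_deriv i \<phi> \<in> schwartz"
  using schwartz_iter_deriv[of \<phi> "[i]"] by simp

lemma schwartz_continuous: "\<phi> \<in> schwartz \<Longrightarrow> continuous_on A \<phi>"
  using schwartz_differentiable[of \<phi> "[]"]
  by (auto intro!: continuous_at_imp_continuous_on differentiable_imp_continuous_within)

lemma schwartz_measurable: "\<phi> \<in> schwartz \<Longrightarrow> \<phi> \<in> borel_measurable borel"
  by (intro borel_measurable_continuous_onI schwartz_continuous)

lemma schwartz_power_bound:
  fixes \<phi> :: "real^'n::finite \<Rightarrow> complex"
  assumes "\<phi> \<in> schwartz"
  obtains C where "0 < C" "\<And>x. (1 + (norm x)\<^sup>2) ^ N * norm (\<phi> x) \<le> C"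
proof -
  have "bounded (range (\<lambda>x. (1 + (norm x)\<^sup>2) ^ N *\<^sub>R iter_deriv [] \<phi> x))"
    using assms unfolding schwartz_def by blast
  then show ?thesis
    unfolding bounded_pos using that by (auto simp: abs_mult)
qed

text \<open>The weight appears twice for the sake of \<open>frac_laplacian_bound\<close>: one factor
  is absorbed when the tail of the kernel is compared with the weight at x, the other makes what is
  left integrable.\<close>

lemma schwartz_weight_bound:
  fixes \<phi> :: "real^'n::finite \<Rightarrow> complex"
  assumes "\<phi> \<in> schwartz" "s \<le> 1"
  obtains C where "0 < C" "\<And>x. norm (\<phi> x) \<le> C / (weight s x * weight s x)"
proof -
  obtain C where C: "0 < C" "\<And>x. (1 + (norm x)\<^sup>2) ^ (2 * (CARD('n) + 1)) * norm (\<phi> x) \<le> C"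
    using schwartz_power_bound[OF assms(1)] by blast
  have "norm (\<phi> x) \<le> C / (weight s x * weight s x)" for x
  proof -
    have "weight s x * weight s x \<le> (1 + (norm x)\<^sup>2) ^ (CARD('n) + 1) * (1 + (norm x)\<^sup>2) ^ (CARD('n) + 1)"
      using weight_le_power[OF assms(2), of x] by (intro mult_mono) auto
    also have "\<dots> = (1 + (norm x)\<^sup>2) ^ (2 * (CARD('n) + 1))"
      by (simp only: power_add[symmetric] mult_2)
    finally have "weight s x * weight s x * norm (\<phi> x) \<le> C"
      using mult_right_mono[OF _ norm_ge_zero[of "\<phi> x"]] C(2)[of x] order_trans by blast
    then show ?thesis by (simp add: le_divide_eq mult_ac)
  qed
  with C(1) show ?thesis using that by blast
qed

lemma schwartz_weight_bound1:
  fixes \<phi> :: "real^'n::finite \<Rightarrow> complex"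
  assumes "\<phi> \<in> schwartz" "0 < s" "s \<le> 1"
  obtains C where "0 < C" "\<And>x. norm (\<phi> x) \<le> C / weight s x"
proof -
  obtain C where C: "0 < C" "\<And>x. norm (\<phi> x) \<le> C / (weight s x * weight s x)"
    using schwartz_weight_bound[OF assms(1,3)] by blast
  have "C / (weight s x * weight s x) \<le> C / weight s x" for x :: "real^'n"
    using C(1) weight_ge_1[OF assms(2), of x] by (intro divide_left_mono) auto
  then show ?thesis using that C order_trans by blast
qed

lemma schwartz_partial_deriv_bound:
  fixes \<phi> :: "real^'n::finite \<Rightarrow> complex"
  assumes "\<phi> \<in> schwartz" "0 < s" "s \<le> 1"
  obtains C where "0 < C" "\<And>j x. norm (partial_deriv j \<phi> x) \<le> C / weight s x"
proof -
  have "\<forall>j. \<exists>C>0. \<forall>x. norm (partial_deriv j \<phi> x) \<le> C / weight s x"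
  proof
    fix j
    obtain C where "0 < C" "\<And>x. norm (partial_deriv j \<phi> x) \<le> C / weight s x"
      using schwartz_weight_bound1[OF schwartz_partial_deriv[OF assms(1)] assms(2,3)] by blast
    then show "\<exists>C>0. \<forall>x. norm (partial_deriv j \<phi> x) \<le> C / weight s x" by blast
  qed
  from choice[OF this] obtain c where c: "\<And>j. 0 < c j" "\<And>j x. norm (partial_deriv j \<phi> x) \<le> c j / weight s x"
    by blast
  have "norm (partial_deriv j \<phi> x) \<le> (\<Sum>j\<in>UNIV. c j) / weight s x" for j and x :: "real^'n"
  proof -
    have "c j / weight s x \<le> (\<Sum>j\<in>UNIV. c j) / weight s x"
      using c(1) by (intro divide_right_mono member_le_sum) (auto simp: less_imp_le)
    then show ?thesis using c(2)[of j x] by linarith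
  qed
  moreover have "0 < (\<Sum>j\<in>UNIV. c j)" using c(1) by (intro sum_pos) auto
  ultimately show ?thesis using that by blast
qed

lemma schwartz_second_deriv_bound:
  fixes \<phi> :: "real^'n::finite \<Rightarrow> complex"
  assumes "\<phi> \<in> schwartz" "0 < s" "s \<le> 1"
  obtains C where "0 < C" "\<And>i j x. norm (partial_deriv j (partial_deriv i \<phi>) x) \<le> C / weight s x"
proof -
  have "\<forall>i. \<exists>C>0. \<forall>j x. norm (partial_deriv j (partial_deriv i \<phi>) x) \<le> C / weight s x"
  proof
    fix i
    obtain C where "0 < C" "\<And>j x. norm (partial_deriv j (partial_deriv i \<phi>) x) \<le> C / weight s x"
      using schwartz_partial_deriv_bound[OF schwartz_partial_deriv[OF assms(1)] assms(2,3)] by blast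
    then show "\<exists>C>0. \<forall>j x. norm (partial_deriv j (partial_deriv i \<phi>) x) \<le> C / weight s x" by blast
  qed
  from choice[OF this] obtain c where c: "\<And>i. 0 < c i"
    "\<And>i j x. norm (partial_deriv j (partial_deriv i \<phi>) x) \<le> c i / weight s x" by blast
  have "norm (partial_deriv j (partial_deriv i \<phi>) x) \<le> (\<Sum>i\<in>UNIV. c i) / weight s x" for i j x
  proof -
    have "c i / weight s x \<le> (\<Sum>i\<in>UNIV. c i) / weight s x"
      using c(1) by (intro divide_right_mono member_le_sum) (auto simp: less_imp_le)
    then show ?thesis using c(2)[of j i x] by linarith
  qed
  moreover have "0 < (\<Sum>i\<in>UNIV. c i)" using c(1) by (intro sum_pos) auto
  ultimately show ?thesis using that by blast
qed

lemma schwartz_integrable: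
  fixes \<phi> :: "real^'n::finite \<Rightarrow> complex"
  assumes "\<phi> \<in> schwartz"
  shows "integrable lebesgue \<phi>"
proof -
  obtain C where "0 < C" "\<And>x. norm (\<phi> x) \<le> C / weight 1 x"
    using schwartz_weight_bound1[OF assms, of 1] by auto
  then show ?thesis
    using schwartz_measurable[OF assms] by (intro integrable_weight_bound[of _ 1 C] measurable_completion) auto
qed

section \<open>The Fourier transform: continuity, derivatives and decay\<close>

lemma integrable_mult_cis:
  fixes f :: "'a \<Rightarrow> complex"
  assumes "integrable M f" "g \<in> borel_measurable M"
  shows "integrable M (\<lambda>x. f x * cis (g x))"
proof (rule Bochner_Integration.integrable_bound[OF assms(1)])
  have "cis \<in> borel_measurable borel"
    by (intro borel_measurable_continuous_onI continuous_intros)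
  then have "(\<lambda>x. cis (g x)) \<in> borel_measurable M"
    by (rule measurable_compose[OF assms(2)])
  then show "(\<lambda>x. f x * cis (g x)) \<in> borel_measurable M"
    using assms(1) by measurable
qed (simp add: norm_mult)

lemma continuous_on_fourier_integral:
  fixes f :: "real^'n::finite \<Rightarrow> complex"
  assumes "integrable lebesgue f"
  shows "continuous_on UNIV (\<lambda>\<xi>. LINT x|lebesgue. f x * cis (x \<bullet> \<xi>))"
  unfolding continuous_on_sequentially
proof (intro ballI allI impI, elim conjE)
  fix u :: "nat \<Rightarrow> real^'n" and \<xi>
  assume u: "u \<longlonglongrightarrow> \<xi>"
  have int: "integrable lebesgue (\<lambda>x. f x * cis (x \<bullet> \<xi>))" for \<xi>
    by (intro integrable_mult_cis assms measurable_completion) simp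
  show "((\<lambda>\<xi>. LINT x|lebesgue. f x * cis (x \<bullet> \<xi>)) \<circ> u) \<longlonglongrightarrow> (LINT x|lebesgue. f x * cis (x \<bullet> \<xi>))"
    unfolding comp_def
  proof (rule integral_dominated_convergence)
    show "integrable lebesgue (\<lambda>x. norm (f x))" using assms by simp
    show "AE x in lebesgue. (\<lambda>j. f x * cis (x \<bullet> u j)) \<longlonglongrightarrow> f x * cis (x \<bullet> \<xi>)"
      unfolding cis_conv_exp by (intro AE_I2 tendsto_intros u)
  qed (use int in \<open>auto simp: norm_mult\<close>)
qed

lemma continuous_on_fourier:
  assumes "integrable lebesgue f"
  shows "continuous_on A (fourier f)"
proof -
  have "continuous_on UNIV (\<lambda>\<xi>. LINT x|lebesgue. f x * cis (x \<bullet> (- \<xi>)))"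
    by (rule continuous_on_compose2[OF continuous_on_fourier_integral[OF assms]]) (auto intro: continuous_intros)
  then have "continuous_on A (\<lambda>\<xi>. LINT x|lebesgue. f x * cis (- (x \<bullet> \<xi>)))"
    by (simp add: continuous_on_subset[OF _ subset_UNIV])
  then show ?thesis unfolding fourier_def by (intro continuous_intros)
qed

lemma fourier_translation:
  fixes f :: "real^'n::finite \<Rightarrow> complex"
  assumes "f \<in> borel_measurable borel"
  shows "fourier (\<lambda>x. f (x + a)) \<xi> = cis (a \<bullet> \<xi>) * fourier f \<xi>"
proof -
  have c: "cis (- (x \<bullet> \<xi>)) = cis (- ((x + a) \<bullet> \<xi>)) * cis (a \<bullet> \<xi>)" for x
    by (simp add: cis_mult inner_add_left)
  have "(\<lambda>x. cis (- (x \<bullet> \<xi>))) \<in> borel_measurable borel"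
    by (intro borel_measurable_continuous_onI continuous_intros)
  then have "(\<lambda>x. f x * cis (- (x \<bullet> \<xi>))) \<in> borel_measurable lebesgue"
    using assms by (intro measurable_completion) simp
  from lebesgue_integral_translation[OF this, of a]
  have "(LINT x|lebesgue. f (x + a) * cis (- ((x + a) \<bullet> \<xi>))) = (LINT x|lebesgue. f x * cis (- (x \<bullet> \<xi>)))" .
  moreover have "(LINT x|lebesgue. f (x + a) * cis (- (x \<bullet> \<xi>)))
      = (LINT x|lebesgue. f (x + a) * cis (- ((x + a) \<bullet> \<xi>)) * cis (a \<bullet> \<xi>))"
    by (simp only: mult.assoc c[symmetric])
  ultimately show ?thesis by (simp add: fourier_def mult.commute)
qed

text \<open>The difference quotients of $f$ in direction $e_i$ have Fourier transform
  $\frac{e^{i t \xi_i} - 1}{t} \widehat f(\xi)$ and converge dominatedly.\<close>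

lemma fourier_partial_deriv:
  fixes \<phi> :: "real^'n::finite \<Rightarrow> complex"
  assumes \<phi>: "\<phi> \<in> schwartz"
  shows "fourier (partial_deriv i \<phi>) \<xi> = \<i> * of_real (\<xi> $ i) * fourier \<phi> \<xi>"
proof -
  let ?e = "axis i 1 :: real^'n"
  \<comment> \<open>The steps have length at most 1, so the unit shift bound applies at all
    intermediate points; they form a sequence, because dominated convergence is along
    sequences.\<close>
  define t where "t m = 1 / real (Suc m)" for m
  have t: "0 < t m" "t m \<le> 1" for m by (auto simp: t_def)
  have t0: "t \<longlonglongrightarrow> 0" unfolding t_def by (rule LIMSEQ_Suc[OF lim_1_over_n])
  have t_at: "filterlim t (at 0) sequentially"
    using t0 t(1) by (simp add: filterlim_at less_imp_neq[symmetric])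
  have mphi: "\<phi> \<in> borel_measurable borel" by (rule schwartz_measurable[OF \<phi>])
  have mcis: "(\<lambda>x. cis (- (x \<bullet> \<xi>))) \<in> borel_measurable borel"
    by (intro borel_measurable_continuous_onI continuous_intros)
  have mneg: "(\<lambda>x. - (x \<bullet> \<xi>)) \<in> borel_measurable lebesgue"
    by (intro measurable_completion) simp
  define q where "q m x = (\<phi> (x + t m *\<^sub>R ?e) - \<phi> x) /\<^sub>R t m" for m x
  have q_lim: "(\<lambda>m. q m x) \<longlonglongrightarrow> partial_deriv i \<phi> x" for x
  proof -
    have "((\<lambda>t. \<phi> (x + t *\<^sub>R ?e)) has_vector_derivative partial_deriv i \<phi> x) (at 0)"
      using has_vector_derivative_partial_deriv[OF schwartz_differentiable[OF \<phi>, of "[]"]] by simp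
    from has_vector_derivative_quotient[OF this]
    have "((\<lambda>h. (\<phi> (x + h *\<^sub>R ?e) - \<phi> x) /\<^sub>R h) \<longlongrightarrow> partial_deriv i \<phi> x) (at 0)" by simp
    from filterlim_compose[OF this t_at] show ?thesis by (simp add: q_def)
  qed
  obtain C where C: "0 < C" "\<And>j x. norm (partial_deriv j \<phi> x) \<le> C / weight 1 x"
    using schwartz_partial_deriv_bound[OF \<phi> zero_less_one order_refl] by blast
  define D where "D = 2 powr ((real CARD('n) + 2 * 1) / 2)"
  \<comment> \<open>The mean value inequality gives this majorant: n times a bound for the partial
    derivatives on a segment of length at most 1 that starts at x.\<close>
  define B where "B x = real CARD('n) * (C * (D\<^sup>2 / weight 1 x))" for x :: "real^'n"
  have q_le: "norm (q m x) \<le> B x" for m x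
  proof -
    have "norm (\<phi> (x + t m *\<^sub>R ?e) - \<phi> x) \<le> real CARD('n) * (C * (D\<^sup>2 / weight 1 x)) * norm (t m *\<^sub>R ?e)"
    proof (rule norm_diff_le_partial_deriv)
      fix r :: real and j assume r: "0 \<le> r" "r \<le> 1"
      have "norm (partial_deriv j \<phi> (x + r *\<^sub>R (t m *\<^sub>R ?e))) \<le> C * (1 / weight 1 (x + r *\<^sub>R (t m *\<^sub>R ?e)))"
        using C(2) by simp
      also have "\<dots> \<le> C * (D\<^sup>2 / weight 1 x)"
        unfolding D_def using C(1) r t[of m]
        by (intro mult_left_mono inverse_weight_unit_shift_le) (auto simp: mult_le_one)
      finally show "norm (partial_deriv j \<phi> (x + r *\<^sub>R (t m *\<^sub>R ?e))) \<le> C * (D\<^sup>2 / weight 1 x)" .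
    qed (use schwartz_differentiable[OF \<phi>, of "[]"] in simp)
    then show ?thesis using t[of m] by (simp add: q_def B_def divide_simps mult_ac)
  qed
  have mq: "q m \<in> borel_measurable borel" for m
    unfolding q_def using mphi by measurable
  have "(\<lambda>m. LINT x|lebesgue. q m x * cis (- (x \<bullet> \<xi>))) \<longlonglongrightarrow>
      (LINT x|lebesgue. partial_deriv i \<phi> x * cis (- (x \<bullet> \<xi>)))"
  proof (rule integral_dominated_convergence)
    show "integrable lebesgue B"
      unfolding B_def using integrable_inverse_weight[of 1, where 'n='n]
      by (simp add: integrable_completion divide_inverse)
    show "(\<lambda>x. partial_deriv i \<phi> x * cis (- (x \<bullet> \<xi>))) \<in> borel_measurable lebesgue"
      using schwartz_measurable[OF schwartz_partial_deriv[OF \<phi>]] mcis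
      by (intro measurable_completion borel_measurable_times) simp_all
    show "(\<lambda>x. q m x * cis (- (x \<bullet> \<xi>))) \<in> borel_measurable lebesgue" for m
      using mq mcis by (intro measurable_completion borel_measurable_times) simp_all
    show "AE x in lebesgue. (\<lambda>m. q m x * cis (- (x \<bullet> \<xi>))) \<longlonglongrightarrow> partial_deriv i \<phi> x * cis (- (x \<bullet> \<xi>))"
      by (intro AE_I2 tendsto_mult q_lim tendsto_const)
  qed (use q_le in \<open>auto simp: norm_mult\<close>)
  then have lim1: "(\<lambda>m. fourier (q m) \<xi>) \<longlonglongrightarrow> fourier (partial_deriv i \<phi>) \<xi>"
    unfolding fourier_def by (intro tendsto_intros)
  have eq: "fourier (q m) \<xi> = (cis (t m * \<xi> $ i) - 1) /\<^sub>R t m * fourier \<phi> \<xi>" for m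
  proof -
    have int: "integrable lebesgue (\<lambda>x. \<phi> x * cis (- (x \<bullet> \<xi>)))"
      by (rule integrable_mult_cis[OF schwartz_integrable[OF \<phi>] mneg])
    have int2: "integrable lebesgue (\<lambda>x. \<phi> (x + a) * cis (- (x \<bullet> \<xi>)))" for a
    proof -
      have "integrable lebesgue (\<lambda>x. \<phi> (x + a))"
        using lebesgue_integrable_translation[of \<phi> a] mphi schwartz_integrable[OF \<phi>]
        by (simp add: measurable_completion)
      then show ?thesis by (rule integrable_mult_cis[OF _ mneg])
    qed
    have "fourier (q m) \<xi> = (fourier (\<lambda>x. \<phi> (x + t m *\<^sub>R ?e)) \<xi> - fourier \<phi> \<xi>) /\<^sub>R t m"
      unfolding fourier_def q_def
      by (simp add: left_diff_distrib Bochner_Integration.integral_diff int int2 scaleR_diff_right)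
    also have "fourier (\<lambda>x. \<phi> (x + t m *\<^sub>R ?e)) \<xi> = cis (t m * \<xi> $ i) * fourier \<phi> \<xi>"
      by (subst fourier_translation[OF mphi]) (simp add: inner_axis')
    finally show ?thesis by (simp add: algebra_simps)
  qed
  have lim2: "(\<lambda>m. (cis (t m * \<xi> $ i) - 1) /\<^sub>R t m) \<longlonglongrightarrow> \<i> * of_real (\<xi> $ i)"
  proof -
    have "((\<lambda>z. exp (\<i> * (z * of_real (\<xi> $ i)))) has_field_derivative \<i> * of_real (\<xi> $ i)) (at (of_real 0))"
      by (auto intro!: derivative_eq_intros)
    from has_vector_derivative_real_field[OF this]
    have "((\<lambda>r. exp (\<i> * (of_real r * of_real (\<xi> $ i)))) has_vector_derivative \<i> * of_real (\<xi> $ i)) (at 0)" .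
    then have "((\<lambda>r. cis (r * \<xi> $ i)) has_vector_derivative \<i> * of_real (\<xi> $ i)) (at 0)"
      by (simp add: cis_conv_exp)
    from has_vector_derivative_quotient[OF this]
    have "((\<lambda>h. (cis (h * \<xi> $ i) - 1) /\<^sub>R h) \<longlongrightarrow> \<i> * of_real (\<xi> $ i)) (at 0)"
      by simp
    from filterlim_compose[OF this t_at] show ?thesis .
  qed
  have "(\<lambda>m. fourier (q m) \<xi>) \<longlonglongrightarrow> \<i> * of_real (\<xi> $ i) * fourier \<phi> \<xi>"
    unfolding eq by (intro tendsto_mult lim2 tendsto_const)
  with lim1 show ?thesis by (rule LIMSEQ_unique)
qed

lemma fourier_iter_deriv_replicate:
  assumes "\<phi> \<in> schwartz"
  shows "fourier (iter_deriv (replicate m i) \<phi>) \<xi> = (\<i> * of_real (\<xi> $ i)) ^ m * fourier \<phi> \<xi>"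
  by (induction m) (simp_all add: fourier_partial_deriv schwartz_iter_deriv assms)

lemma norm_fourier_le:
  fixes f :: "real^'n::finite \<Rightarrow> complex"
  assumes "integrable lebesgue f"
  shows "norm (fourier f \<xi>) \<le> (1 / (2 * pi) ^ CARD('n)) * (LINT x|lebesgue. norm (f x))"
proof -
  have "norm (LINT x|lebesgue. f x * cis (- (x \<bullet> \<xi>))) \<le> (LINT x|lebesgue. norm (f x * cis (- (x \<bullet> \<xi>))))"
    by (rule integral_norm_bound)
  then show ?thesis
    unfolding fourier_def by (simp add: norm_mult divide_right_mono)
qed

lemma fourier_component_power_bound:
  fixes \<phi> :: "real^'n::finite \<Rightarrow> complex"
  assumes "\<phi> \<in> schwartz"
  obtains C where "0 \<le> C" "\<And>i \<xi>. \<bar>\<xi> $ i\<bar> ^ m * norm (fourier \<phi> \<xi>) \<le> C"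
proof -
  define c where "c i = (1 / (2 * pi) ^ CARD('n)) * (LINT x|lebesgue. norm (iter_deriv (replicate m i) \<phi> x))" for i
  have c: "0 \<le> c i" for i unfolding c_def by simp
  have "\<bar>\<xi> $ i\<bar> ^ m * norm (fourier \<phi> \<xi>) \<le> (\<Sum>i\<in>UNIV. c i)" for i \<xi>
  proof -
    have "\<bar>\<xi> $ i\<bar> ^ m * norm (fourier \<phi> \<xi>) = norm (fourier (iter_deriv (replicate m i) \<phi>) \<xi>)"
      by (simp add: fourier_iter_deriv_replicate[OF assms] norm_mult norm_power)
    also have "\<dots> \<le> c i"
      unfolding c_def by (intro norm_fourier_le schwartz_integrable schwartz_iter_deriv assms)
    also have "\<dots> \<le> (\<Sum>i\<in>UNIV. c i)" using c by (intro member_le_sum) auto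
    finally show ?thesis .
  qed
  moreover have "0 \<le> (\<Sum>i\<in>UNIV. c i)" using c by (intro sum_nonneg) auto
  ultimately show ?thesis using that by blast
qed

text \<open>Repeated derivatives in a single direction suffice: if i is the index of the coordinate
  of largest modulus, then |\<xi>| <= n |\<xi>_i|, so |\<xi>_i|^(2N) controls |\<xi>|^(2N). For
  |\<xi>| <= 1 the bound without derivatives is used.\<close>

lemma fourier_power_bound:
  fixes \<phi> :: "real^'n::finite \<Rightarrow> complex"
  assumes "\<phi> \<in> schwartz"
  obtains C where "0 < C" "\<And>\<xi>. (1 + (norm \<xi>)\<^sup>2) ^ N * norm (fourier \<phi> \<xi>) \<le> C"
proof -
  let ?n = "real CARD('n)"
  obtain C0 where C0: "0 \<le> C0" "\<And>i \<xi>. \<bar>\<xi> $ i\<bar> ^ 0 * norm (fourier \<phi> \<xi>) \<le> C0"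
    using fourier_component_power_bound[OF assms, where m=0] by blast
  obtain C1 where C1: "0 \<le> C1" "\<And>i \<xi>. \<bar>\<xi> $ i\<bar> ^ (2 * N) * norm (fourier \<phi> \<xi>) \<le> C1"
    using fourier_component_power_bound[OF assms, where m="2 * N"] by blast
  have "(1 + (norm \<xi>)\<^sup>2) ^ N * norm (fourier \<phi> \<xi>) \<le> 2 ^ N * C0 + 2 ^ N * ?n ^ (2 * N) * C1 + 1" for \<xi>
  proof (cases "norm \<xi> \<le> 1")
    case True
    then have "(norm \<xi>)\<^sup>2 \<le> 1" by (simp add: power_le_one)
    then have "(1 + (norm \<xi>)\<^sup>2) ^ N \<le> 2 ^ N" by (intro power_mono) auto
    then have "(1 + (norm \<xi>)\<^sup>2) ^ N * norm (fourier \<phi> \<xi>) \<le> 2 ^ N * C0"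
      using C0 by (intro mult_mono) auto
    moreover have "0 \<le> 2 ^ N * ?n ^ (2 * N) * C1" using C1 by simp
    ultimately show ?thesis by linarith
  next
    case False
    obtain i where i: "\<And>j. \<bar>\<xi> $ j\<bar> \<le> \<bar>\<xi> $ i\<bar>"
    proof -
      have "Max (range (\<lambda>j. \<bar>\<xi> $ j\<bar>)) \<in> range (\<lambda>j. \<bar>\<xi> $ j\<bar>)" by (intro Max_in) auto
      then obtain i where "Max (range (\<lambda>j. \<bar>\<xi> $ j\<bar>)) = \<bar>\<xi> $ i\<bar>" by blast
      then have "\<bar>\<xi> $ j\<bar> \<le> \<bar>\<xi> $ i\<bar>" for j by (metis Max_ge finite finite_imageI rangeI)
      then show ?thesis using that by blast
    qed
    have "norm \<xi> \<le> (\<Sum>j\<in>UNIV. \<bar>\<xi> $ j\<bar>)" by (rule norm_le_l1_cart)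
    also have "\<dots> \<le> ?n * \<bar>\<xi> $ i\<bar>" using sum_mono[of UNIV, OF i] by simp
    finally have le: "norm \<xi> \<le> ?n * \<bar>\<xi> $ i\<bar>" .
    have "1 \<le> (norm \<xi>)\<^sup>2" using False by simp
    then have "(1 + (norm \<xi>)\<^sup>2) ^ N \<le> (2 * (norm \<xi>)\<^sup>2) ^ N" by (intro power_mono) auto
    also have "\<dots> = 2 ^ N * norm \<xi> ^ (2 * N)" by (simp add: power_mult_distrib power_mult)
    also have "\<dots> \<le> 2 ^ N * (?n * \<bar>\<xi> $ i\<bar>) ^ (2 * N)" using le by (intro mult_left_mono power_mono) auto
    also have "\<dots> = 2 ^ N * ?n ^ (2 * N) * \<bar>\<xi> $ i\<bar> ^ (2 * N)" by (simp only: power_mult_distrib mult.assoc)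
    finally have "(1 + (norm \<xi>)\<^sup>2) ^ N * norm (fourier \<phi> \<xi>)
        \<le> 2 ^ N * ?n ^ (2 * N) * \<bar>\<xi> $ i\<bar> ^ (2 * N) * norm (fourier \<phi> \<xi>)"
      by (rule mult_right_mono) simp
    also have "\<dots> \<le> 2 ^ N * ?n ^ (2 * N) * C1"
      using mult_left_mono[OF C1(2)[of \<xi> i], of "2 ^ N * ?n ^ (2 * N)"] by (simp only: mult.assoc) simp
    finally have "(1 + (norm \<xi>)\<^sup>2) ^ N * norm (fourier \<phi> \<xi>) \<le> 2 ^ N * ?n ^ (2 * N) * C1" .
    moreover have "0 \<le> 2 ^ N * C0" using C0(1) by simp
    ultimately show ?thesis by linarith
  qed
  moreover have "0 < 2 ^ N * C0 + 2 ^ N * ?n ^ (2 * N) * C1 + 1"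
    using C0(1) C1(1) by (simp add: add_nonneg_pos)
  ultimately show ?thesis using that by blast
qed

lemma weight_scale_le:
  fixes x :: "real^'n::finite"
  assumes "0 < s" "1 \<le> r"
  shows "weight s x \<le> r powr (real CARD('n) + 2 * s) * weight s (x /\<^sub>R r)"
proof -
  have "1 + (norm x)\<^sup>2 \<le> r\<^sup>2 * (1 + (norm (x /\<^sub>R r))\<^sup>2)"
  proof -
    have "r\<^sup>2 * (norm (x /\<^sub>R r))\<^sup>2 = (norm x)\<^sup>2"
      using assms(2) by (simp add: power_mult_distrib[symmetric])
    then show ?thesis using one_le_power[OF assms(2), of 2] by (simp add: distrib_left)
  qed
  then have "weight s x \<le> (r\<^sup>2 * (1 + (norm (x /\<^sub>R r))\<^sup>2)) powr ((real CARD('n) + 2 * s) / 2)"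
    unfolding weight_def using assms(1) by (intro powr_mono2) auto
  also have "\<dots> = (r\<^sup>2) powr ((real CARD('n) + 2 * s) / 2) * weight s (x /\<^sub>R r)"
    unfolding weight_def by (rule powr_mult)
  also have "(r\<^sup>2) powr ((real CARD('n) + 2 * s) / 2) = r powr (real CARD('n) + 2 * s)"
    using assms(2) by (simp add: powr_powr add_divide_distrib flip: powr_numeral)
  finally show ?thesis .
qed

lemma norm_powr_le:
  assumes "0 \<le> p" "p \<le> 2"
  shows "norm \<xi> powr p \<le> (1 + (norm \<xi>)\<^sup>2)\<^sup>2"
proof (cases "norm \<xi> \<le> 1")
  case True
  then have "norm \<xi> powr p \<le> 1" using assms(1) by (simp add: powr_le1)
  also have "\<dots> \<le> (1 + (norm \<xi>)\<^sup>2)\<^sup>2" by (rule one_le_power) simp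
  finally show ?thesis .
next
  case False
  then have "norm \<xi> powr p \<le> norm \<xi> powr 2" using assms(2) by (intro powr_mono) auto
  also have "\<dots> = (norm \<xi>)\<^sup>2" using False by simp
  also have "\<dots> \<le> (1 + (norm \<xi>)\<^sup>2) ^ 1" by simp
  also have "\<dots> \<le> (1 + (norm \<xi>)\<^sup>2)\<^sup>2" by (rule power_increasing) auto
  finally show ?thesis .
qed

lemma norm_le_polynomial_mult: "norm z \<le> (1 + (norm \<xi>)\<^sup>2)\<^sup>2 * norm z"
  using mult_right_mono[of 1 "(1 + (norm \<xi>)\<^sup>2)\<^sup>2" "norm z"] by (simp add: one_le_power)

text \<open>Covers both \<open>fourier \<phi>\<close> and its product with the symbol |\<xi>|^(2s).
  The exponent n + 3 is n + 1 for the weight plus 2 for the polynomial factor allowed to h. The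
  bound at y / (2 pi) serves Poisson summation, where a sample at y = \<open>per k\<close> has to
  become a sample at the integer frequency k.\<close>

lemma fourier_weight_bound:
  fixes \<phi> :: "real^'n::finite \<Rightarrow> complex"
  assumes "\<phi> \<in> schwartz" "0 < s" "s \<le> 1"
    and h: "\<And>\<xi>. norm (h \<xi>) \<le> (1 + (norm \<xi>)\<^sup>2)\<^sup>2 * norm (fourier \<phi> \<xi>)"
  obtains C where "0 < C" "\<And>\<xi>. norm (h \<xi>) \<le> C / weight s \<xi>"
    "\<And>y. norm (h (y /\<^sub>R (2 * pi))) \<le> C / weight s y"
proof -
  obtain C where C: "0 < C" "\<And>\<xi>. (1 + (norm \<xi>)\<^sup>2) ^ (CARD('n) + 3) * norm (fourier \<phi> \<xi>) \<le> C"
    using fourier_power_bound[OF assms(1), where N="CARD('n) + 3"] by blast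
  have b1: "norm (h \<xi>) \<le> C / weight s \<xi>" for \<xi> :: "real^'n"
  proof -
    have "weight s \<xi> * norm (h \<xi>) \<le>
        (1 + (norm \<xi>)\<^sup>2) ^ (CARD('n) + 1) * ((1 + (norm \<xi>)\<^sup>2)\<^sup>2 * norm (fourier \<phi> \<xi>))"
      using weight_le_power[OF assms(3), of \<xi>] h[of \<xi>] by (intro mult_mono) auto
    also have "\<dots> = (1 + (norm \<xi>)\<^sup>2) ^ (CARD('n) + 3) * norm (fourier \<phi> \<xi>)"
    proof -
      have "CARD('n) + 3 = CARD('n) + 1 + 2" by simp
      then show ?thesis by (simp only: power_add mult.assoc)
    qed
    also note C(2)[of \<xi>]
    finally show ?thesis by (simp add: le_divide_eq mult_ac)
  qed
  define R where "R = (2 * pi) powr (real CARD('n) + 2 * s)"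
  have "1 \<le> 2 * pi" using pi_gt3 by simp
  then have R: "1 \<le> R" unfolding R_def using assms(2) by (intro ge_one_powr_ge_zero) auto
  have b2: "norm (h (y /\<^sub>R (2 * pi))) \<le> C * R / weight s y" for y :: "real^'n"
  proof -
    have "weight s y \<le> R * weight s (y /\<^sub>R (2 * pi))"
      unfolding R_def by (rule weight_scale_le[OF assms(2) \<open>1 \<le> 2 * pi\<close>])
    then have "1 / weight s (y /\<^sub>R (2 * pi)) \<le> R / weight s y" by (simp add: field_simps)
    then have "C * (1 / weight s (y /\<^sub>R (2 * pi))) \<le> C * (R / weight s y)"
      using C(1) by (intro mult_left_mono) auto
    then show ?thesis using b1[of "y /\<^sub>R (2 * pi)"] by simp
  qed
  have CR: "C / weight s \<xi> \<le> C * R / weight s \<xi>" for \<xi> :: "real^'n"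
    using C(1) R by (intro divide_right_mono) (auto simp: mult_le_cancel_left1)
  show ?thesis
  proof (rule that[of "C * R"])
    show "0 < C * R" using C(1) R by simp
    show "norm (h \<xi>) \<le> C * R / weight s \<xi>" for \<xi>
      using b1[of \<xi>] CR[of \<xi>] by linarith
  qed (rule b2)
qed

lemma schwartz_fourier_weight_bound:
  fixes \<phi> :: "real^'n::finite \<Rightarrow> complex"
  assumes "\<phi> \<in> schwartz"
  obtains C where "0 < C" "\<And>\<xi>. norm (fourier \<phi> \<xi>) \<le> C / weight 1 \<xi>"
    "\<And>y. norm (fourier \<phi> (y /\<^sub>R (2 * pi))) \<le> C / weight 1 y"
  by (rule fourier_weight_bound[where h="fourier \<phi>", OF assms zero_less_one order_refl norm_le_polynomial_mult])
    (rule that)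

section \<open>Fourier inversion\<close>

lemma lebesgue_integral_scale:
  fixes f :: "'a::euclidean_space \<Rightarrow> 'b::{banach, second_countable_topology}"
  assumes "f \<in> borel_measurable borel" and "0 < r"
  shows "(LINT x|lebesgue. f (x /\<^sub>R r)) = r ^ DIM('a) *\<^sub>R (LINT x|lebesgue. f x)"
proof -
  have "(\<lambda>x. f (x /\<^sub>R r)) \<in> borel_measurable borel" using assms(1) by measurable
  from lborel_integral_scale[OF this assms(2)] show ?thesis
    using assms \<open>(\<lambda>x. f (x /\<^sub>R r)) \<in> borel_measurable borel\<close> by (simp add: integral_completion)
qed

lemma infsum_lattice_minus: "(\<Sum>\<^sub>\<infinity>k. f (- k)) = (\<Sum>\<^sub>\<infinity>k :: int^'n::finite. f k)"
  by (rule infsum_reindex_bij_betw) (auto intro!: bij_betw_byWitness[where f'=uminus])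

lemma summable_on_lattice_minus:
  fixes f :: "int^'n::finite \<Rightarrow> 'b::{comm_monoid_add, topological_space}"
  assumes "f summable_on UNIV"
  shows "(\<lambda>k. f (- k)) summable_on UNIV"
proof -
  have "bij_betw uminus (UNIV :: (int^'n) set) UNIV"
    by (auto intro!: bij_betw_byWitness[where f'=uminus])
  from summable_on_reindex_bij_betw[OF this, of f] assms show ?thesis by blast
qed

lemma continuous_on_schwartz_fourier:
  "\<phi> \<in> schwartz \<Longrightarrow> continuous_on A (fourier \<phi>)"
  by (intro continuous_on_fourier schwartz_integrable)

text \<open>Zak transform: Poisson summation for $y \mapsto \varphi(x + y) e^{-i z \cdot y/2\pi}$ is integrated over $z$.\<close>

lemma fourier_inversion:
  fixes \<phi> :: "real^'n::finite \<Rightarrow> complex"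
  assumes \<phi>: "\<phi> \<in> schwartz"
  shows "(LINT \<xi>|lebesgue. fourier \<phi> \<xi> * cis (x \<bullet> \<xi>)) = \<phi> x"
proof -
  have mphi: "\<phi> \<in> borel_measurable borel" by (rule schwartz_measurable[OF \<phi>])
  obtain C where C: "0 < C" "\<And>x. norm (\<phi> x) \<le> C / weight 1 x"
    using schwartz_weight_bound1[OF \<phi>, of 1] by auto
  define D where "D = 2 powr ((real CARD('n) + 2 * 1) / 2)"
  define \<Psi> where "\<Psi> y = fourier \<phi> (y /\<^sub>R (2 * pi)) * cis (x \<bullet> (y /\<^sub>R (2 * pi)))" for y :: "real^'n"
  obtain C' where C': "0 < C'" "\<And>y. norm (fourier \<phi> (y /\<^sub>R (2 * pi))) \<le> C' / weight 1 y"
    by (rule schwartz_fourier_weight_bound[OF \<phi>]) (rule that)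
  have \<Psi>_le: "norm (\<Psi> y) \<le> C' / weight 1 y" for y using C'(2)[of y] by (simp add: \<Psi>_def norm_mult)
  have c\<Psi>0: "continuous_on UNIV (\<lambda>\<xi>. fourier \<phi> \<xi> * cis (x \<bullet> \<xi>))"
    by (intro continuous_intros continuous_on_schwartz_fourier \<phi>)
  then have m\<Psi>0: "(\<lambda>\<xi>. fourier \<phi> \<xi> * cis (x \<bullet> \<xi>)) \<in> borel_measurable borel"
    by (rule borel_measurable_continuous_onI)
  have "(\<lambda>y::real^'n. y /\<^sub>R (2 * pi)) \<in> borel_measurable borel"
    by (intro borel_measurable_continuous_onI continuous_intros)
  from measurable_compose[OF this m\<Psi>0] have m\<Psi>: "\<Psi> \<in> borel_measurable borel"
    unfolding \<Psi>_def .
  have zak: "(\<Sum>\<^sub>\<infinity>k. \<phi> (x - per k) * cis (lattice_vec k \<bullet> z)) = (\<Sum>\<^sub>\<infinity>k. \<Psi> (z + per k))" for z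
  proof -
    define f where "f y = \<phi> (x + y) * cis (- (z \<bullet> y) / (2 * pi))" for y
    have ff: "fourier f \<eta> = fourier \<phi> (\<eta> + z /\<^sub>R (2 * pi)) * cis (x \<bullet> (\<eta> + z /\<^sub>R (2 * pi)))" for \<eta>
    proof -
      have "- (z \<bullet> y) / (2 * pi) + - (y \<bullet> \<eta>) = - (y \<bullet> (\<eta> + z /\<^sub>R (2 * pi)))" for y
        by (simp add: inner_add_right inner_commute field_simps)
      then have "f y * cis (- (y \<bullet> \<eta>)) = \<phi> (y + x) * cis (- (y \<bullet> (\<eta> + z /\<^sub>R (2 * pi))))" for y
        by (simp only: f_def mult.assoc cis_mult add.commute[of x])
      then have "fourier f \<eta> = fourier (\<lambda>y. \<phi> (y + x)) (\<eta> + z /\<^sub>R (2 * pi))"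
        by (simp only: fourier_def)
      then show ?thesis by (simp add: fourier_translation[OF mphi] mult.commute)
    qed
    have f\<Psi>: "fourier f (lattice_vec k) = \<Psi> (z + per k)" for k
      unfolding ff \<Psi>_def by (simp add: scaleR_add_right add.commute)
    have "(\<Sum>\<^sub>\<infinity>k. f (per k)) = (\<Sum>\<^sub>\<infinity>k. fourier f (lattice_vec k))"
    proof (rule poisson_summation_zero)
      show "continuous_on UNIV f" unfolding f_def
        by (intro continuous_intros continuous_on_compose2[OF schwartz_continuous[OF \<phi>, of UNIV]]) auto
      show "norm (f y) \<le> C * (D * weight 1 x) / weight 1 y" for y
      proof -
        have "norm (f y) \<le> C * (1 / weight 1 (y + x))"
          using C(2)[of "x + y"] by (simp add: f_def norm_mult add.commute)
        also have "\<dots> \<le> C * (D * weight 1 x / weight 1 y)"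
          unfolding D_def using C(1) inverse_weight_le[of 1 y x] by (intro mult_left_mono) auto
        finally show ?thesis by simp
      qed
      show "(\<lambda>k. norm (fourier f (lattice_vec k))) summable_on UNIV"
        unfolding f\<Psi> by (rule norm_summable_translates[OF _ \<Psi>_le]) simp
    qed simp
    moreover have "f (per (- k)) = \<phi> (x - per k) * cis (lattice_vec k \<bullet> z)" for k
      by (simp add: f_def inner_commute)
    ultimately show ?thesis using infsum_lattice_minus[of "\<lambda>k. f (per k)"] by (simp add: f\<Psi>)
  qed
  have sum: "(\<lambda>k. norm (\<phi> (x - per k))) summable_on UNIV"
    using summable_on_lattice_minus[OF norm_summable_translates[OF _ C(2), of x]] by simp
  \<comment> \<open>Integration over the cell in z leaves only the term k = 0 of the left side of
    \<open>zak\<close>, that is \<phi> x; the right side unfolds to the integral of \<Psi> over the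
    whole space.\<close>
  have "(2 * pi) ^ CARD('n) * \<phi> x = (LINT z:cell|lebesgue. \<Sum>\<^sub>\<infinity>k. \<phi> (x - per k) * cis (lattice_vec k \<bullet> z))"
    using set_integral_fourier_series[OF sum, of 0] by simp
  also have "\<dots> = (LINT y|lebesgue. \<Psi> y)"
    unfolding zak using integral_unfold_weight[OF measurable_completion _ \<Psi>_le] m\<Psi> by simp
  also have "\<dots> = (2 * pi) ^ CARD('n) *\<^sub>R (LINT \<xi>|lebesgue. fourier \<phi> \<xi> * cis (x \<bullet> \<xi>))"
    unfolding \<Psi>_def using lebesgue_integral_scale[OF m\<Psi>0, of "2 * pi"] by simp
  finally show ?thesis by (simp add: scaleR_conv_of_real)
qed

subsection \<open>The fractional Laplacian of a Schwartz function\<close>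

text \<open>The gradient of the even function \<psi> u = \<phi> (x + u) + \<phi> (x - u) is a
  difference of gradients of \<phi> at x + u and x - u. The mean value inequality is applied to
  \<psi>, and then to each partial derivative of \<phi> along a segment of length 2 |u|; each
  application costs a factor n.\<close>

lemma norm_second_difference_le:
  fixes \<phi> :: "real^'n::finite \<Rightarrow> complex"
  assumes \<phi>: "\<phi> \<in> schwartz"
    and B: "\<And>u i j. norm u \<le> norm y \<Longrightarrow> norm (partial_deriv j (partial_deriv i \<phi>) (x + u)) \<le> B"
  shows "norm (\<phi> (x + y) + \<phi> (x - y) - 2 * \<phi> x) \<le> 2 * (real CARD('n))\<^sup>2 * B * (norm y)\<^sup>2"
proof -
  define \<psi> where "\<psi> u = \<phi> (x + u) + \<phi> (x - u)" for u
  have d\<phi>: "\<phi> differentiable (at z)" for z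
    using schwartz_differentiable[OF \<phi>, of "[]"] by simp
  have d\<psi>: "(\<psi> has_derivative (\<lambda>h. (\<Sum>i\<in>UNIV. h $ i *\<^sub>R partial_deriv i \<phi> (x + u))
      + (\<Sum>i\<in>UNIV. (- h) $ i *\<^sub>R partial_deriv i \<phi> (x - u)))) (at u)" for u
  proof -
    have "((\<lambda>u. x + u) has_derivative (\<lambda>h. h)) (at u)" by (auto intro!: derivative_eq_intros)
    from has_derivative_compose[OF this has_derivative_partial_deriv[OF d\<phi>]]
    have 1: "((\<lambda>u. \<phi> (x + u)) has_derivative (\<lambda>h. \<Sum>i\<in>UNIV. h $ i *\<^sub>R partial_deriv i \<phi> (x + u))) (at u)" .
    have "((\<lambda>u. x - u) has_derivative (\<lambda>h. - h)) (at u)" by (auto intro!: derivative_eq_intros)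
    from has_derivative_compose[OF this has_derivative_partial_deriv[OF d\<phi>]]
    have 2: "((\<lambda>u. \<phi> (x - u)) has_derivative (\<lambda>h. \<Sum>i\<in>UNIV. (- h) $ i *\<^sub>R partial_deriv i \<phi> (x - u))) (at u)" .
    show ?thesis unfolding \<psi>_def by (rule has_derivative_add[OF 1 2])
  qed
  have p\<psi>: "partial_deriv i \<psi> u = partial_deriv i \<phi> (x + u) - partial_deriv i \<phi> (x - u)" for i u
    using partial_deriv_eqI[OF d\<psi>, of i u] by (simp add: sum_negf sum_axis_scaleR)
  have "norm (\<psi> (0 + y) - \<psi> 0) \<le> real CARD('n) * (real CARD('n) * B * (2 * norm y)) * norm y"
  proof (rule norm_diff_le_partial_deriv)
    show "\<psi> differentiable (at u)" for u using d\<psi> by (rule differentiableI)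
    fix t :: real and i assume t: "0 \<le> t" "t \<le> 1"
    define v where "v = t *\<^sub>R y"
    have v: "norm v \<le> norm y" using t by (simp add: v_def mult_left_le_one_le)
    have "norm (partial_deriv i \<phi> ((x - v) + 2 *\<^sub>R v) - partial_deriv i \<phi> (x - v))
        \<le> real CARD('n) * B * norm (2 *\<^sub>R v)"
    proof (rule norm_diff_le_partial_deriv)
      show "partial_deriv i \<phi> differentiable (at z)" for z
        using schwartz_differentiable[OF \<phi>, of "[i]"] by simp
      fix r :: real and j assume r: "0 \<le> r" "r \<le> 1"
      have eq: "(x - v) + r *\<^sub>R (2 *\<^sub>R v) = x + (2 * r - 1) *\<^sub>R v"
        by (simp add: algebra_simps)
      have "norm ((2 * r - 1) *\<^sub>R v) \<le> norm y"
        using r mult_mono[of "\<bar>2 * r - 1\<bar>" 1 "norm v" "norm y"] v by (simp add: abs_le_iff)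
      then show "norm (partial_deriv j (partial_deriv i \<phi>) ((x - v) + r *\<^sub>R (2 *\<^sub>R v))) \<le> B"
        unfolding eq by (rule B)
    qed
    also have "(x - v) + 2 *\<^sub>R v = x + v" by (simp add: scaleR_2)
    also have "real CARD('n) * B * norm (2 *\<^sub>R v) \<le> real CARD('n) * B * (2 * norm y)"
    proof -
      have "0 \<le> B" by (rule order_trans[OF norm_ge_zero B[of 0 i i]]) simp
      then show ?thesis using v by (intro mult_left_mono) auto
    qed
    finally show "norm (partial_deriv i \<psi> (0 + t *\<^sub>R y)) \<le> real CARD('n) * B * (2 * norm y)"
      unfolding p\<psi> add_0_left v_def .
  qed
  then show ?thesis by (simp add: \<psi>_def power2_eq_square mult_ac)
qed

lemma measurable_cis [measurable]: "cis \<in> borel_measurable borel"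
  by (intro borel_measurable_continuous_onI continuous_intros)

lemma schwartz_fourier_measurable:
  "\<phi> \<in> schwartz \<Longrightarrow> fourier \<phi> \<in> borel_measurable borel"
  by (intro borel_measurable_continuous_onI continuous_on_schwartz_fourier)

lemma symbol_fourier_bound:
  fixes \<phi> :: "real^'n::finite \<Rightarrow> complex"
  assumes "\<phi> \<in> schwartz" "0 < s" "s \<le> 1"
  obtains C where "0 < C" "\<And>\<xi>. norm (norm \<xi> powr (2 * s) *\<^sub>R fourier \<phi> \<xi>) \<le> C / weight s \<xi>"
    "\<And>y. norm (norm (y /\<^sub>R (2 * pi)) powr (2 * s) *\<^sub>R fourier \<phi> (y /\<^sub>R (2 * pi))) \<le> C / weight s y"
proof -
  have "norm (norm \<xi> powr (2 * s) *\<^sub>R fourier \<phi> \<xi>) \<le> (1 + (norm \<xi>)\<^sup>2)\<^sup>2 * norm (fourier \<phi> \<xi>)" for \<xi>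
    using norm_powr_le[of "2 * s" \<xi>] assms(2,3) by (simp add: mult_right_mono)
  from fourier_weight_bound[OF assms(1-3) this] show ?thesis using that by metis
qed

lemma symbol_fourier_integrable:
  fixes \<phi> :: "real^'n::finite \<Rightarrow> complex"
  assumes "\<phi> \<in> schwartz" "0 < s" "s \<le> 1"
  shows "integrable lborel (\<lambda>\<xi>. norm \<xi> powr (2 * s) *\<^sub>R fourier \<phi> \<xi>)"
proof -
  note [measurable] = schwartz_fourier_measurable[OF assms(1)]
  have m: "(\<lambda>\<xi>. norm \<xi> powr (2 * s) *\<^sub>R fourier \<phi> \<xi>) \<in> borel_measurable borel" by measurable
  obtain C where "\<And>\<xi>. norm (norm \<xi> powr (2 * s) *\<^sub>R fourier \<phi> \<xi>) \<le> C / weight s \<xi>"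
    using symbol_fourier_bound[OF assms] by metis
  from integrable_weight_bound[OF measurable_completion[of _ lborel] assms(2) this] m
  show ?thesis by (simp add: integrable_completion)
qed

lemma schwartz_fourier_integrable:
  fixes \<phi> :: "real^'n::finite \<Rightarrow> complex"
  assumes "\<phi> \<in> schwartz"
  shows "integrable lborel (fourier \<phi>)"
proof -
  have m: "fourier \<phi> \<in> borel_measurable borel" by (rule schwartz_fourier_measurable[OF assms])
  obtain C where "\<And>\<xi>. norm (fourier \<phi> \<xi>) \<le> C / weight 1 \<xi>"
    by (rule schwartz_fourier_weight_bound[OF assms]) (rule that)
  from integrable_weight_bound[OF measurable_completion[of _ lborel] zero_less_one this] m
  show ?thesis by (simp add: integrable_completion)
qed

text \<open>The cosine, which pairs y with - y, makes the double integral absolutely convergent: the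
  y-integral of |F| is c |\<xi>|^(2s) times the modulus of \<open>fourier \<phi> \<xi>\<close>,
  which is integrable in \<xi>. With 1 - e^(i y . \<xi>) in its place absolute convergence at y = 0
  would fail for s >= 1/2.\<close>

lemma frac_laplacian_singular_integral:
  fixes \<phi> :: "real^'n::finite \<Rightarrow> complex"
  assumes \<phi>: "\<phi> \<in> schwartz" and s: "0 < s" "s < 1"
    and c: "\<And>\<xi>::real^'n. (LINT y|lborel. (1 - cos (y \<bullet> \<xi>)) * riesz_kernel s y) = c * norm \<xi> powr (2 * s)"
  shows "c *\<^sub>R frac_laplacian s \<phi> x
    = (LINT y|lborel. riesz_kernel s y *\<^sub>R (\<phi> x - (\<phi> (x + y) + \<phi> (x - y)) / 2))"
proof -
  note [measurable] = schwartz_fourier_measurable[OF \<phi>]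
  define F where "F \<xi> y = ((1 - cos (y \<bullet> \<xi>)) * riesz_kernel s y) *\<^sub>R (fourier \<phi> \<xi> * cis (x \<bullet> \<xi>))" for \<xi> y :: "real^'n"
  have mF: "case_prod F \<in> borel_measurable (lborel \<Otimes>\<^sub>M lborel)"
    unfolding F_def by measurable
  have nonneg: "0 \<le> (1 - cos (y \<bullet> \<xi>)) * riesz_kernel s y" for y \<xi> :: "real^'n" by simp
  have intF: "integrable (lborel \<Otimes>\<^sub>M lborel) (case_prod F)"
  proof (rule lborel_pair.Fubini_integrable[OF mF])
    have "(LINT y|lborel. norm (F \<xi> y)) = c * norm (norm \<xi> powr (2 * s) *\<^sub>R fourier \<phi> \<xi>)" for \<xi>
    proof -
      have "norm (F \<xi> y) = (1 - cos (y \<bullet> \<xi>)) * riesz_kernel s y * norm (fourier \<phi> \<xi>)" for y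
        using nonneg[of y \<xi>] by (simp only: F_def norm_scaleR norm_mult norm_cis mult_1_right abs_of_nonneg)
      then have "(LINT y|lborel. norm (F \<xi> y)) = c * norm \<xi> powr (2 * s) * norm (fourier \<phi> \<xi>)"
        by (simp only: integral_mult_left_zero c)
      then show ?thesis by simp
    qed
    moreover have "integrable lborel (\<lambda>\<xi>. c * norm (norm \<xi> powr (2 * s) *\<^sub>R fourier \<phi> \<xi>))"
      using s by (intro integrable_mult_right integrable_norm symbol_fourier_integrable \<phi>) auto
    ultimately show "integrable lborel (\<lambda>\<xi>. LINT y|lborel. norm (case_prod F (\<xi>, y)))" by simp
    have "integrable lborel (F \<xi>)" for \<xi>
      unfolding F_def by (intro integrable_scaleR_left integrable_riesz_kernel_cos s)
    then show "AE \<xi> in lborel. integrable lborel (\<lambda>y. case_prod F (\<xi>, y))" by simp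
  qed
  have "c *\<^sub>R frac_laplacian s \<phi> x = c *\<^sub>R (LINT \<xi>|lborel. norm \<xi> powr (2 * s) *\<^sub>R (fourier \<phi> \<xi> * cis (x \<bullet> \<xi>)))"
    unfolding frac_laplacian_def by (subst integral_completion) auto
  also have "\<dots> = (LINT \<xi>|lborel. (c * norm \<xi> powr (2 * s)) *\<^sub>R (fourier \<phi> \<xi> * cis (x \<bullet> \<xi>)))"
    by (simp flip: integral_scaleR_right)
  also have "\<dots> = (LINT \<xi>|lborel. (LINT y|lborel. F \<xi> y))"
  proof (rule Bochner_Integration.integral_cong[OF refl])
    fix \<xi> :: "real^'n"
    show "(c * norm \<xi> powr (2 * s)) *\<^sub>R (fourier \<phi> \<xi> * cis (x \<bullet> \<xi>)) = (LINT y|lborel. F \<xi> y)"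
      unfolding F_def using integrable_riesz_kernel_cos[OF s, of \<xi>] c[of \<xi>]
      by (subst integral_scaleR_left) auto
  qed
  also have "\<dots> = (LINT y|lborel. (LINT \<xi>|lborel. F \<xi> y))"
    by (rule lborel_pair.Fubini_integral[OF intF, symmetric])
  also have "\<dots> = (LINT y|lborel. riesz_kernel s y *\<^sub>R (\<phi> x - (\<phi> (x + y) + \<phi> (x - y)) / 2))"
  proof (rule Bochner_Integration.integral_cong[OF refl])
    fix y :: "real^'n"
    define I where "I z = (LINT \<xi>|lborel. fourier \<phi> \<xi> * cis (z \<bullet> \<xi>))" for z :: "real^'n"
    have I: "I z = \<phi> z" for z
      using fourier_inversion[OF \<phi>, of z] unfolding I_def by (subst (asm) integral_completion) auto
    have int: "integrable lborel (\<lambda>\<xi>. fourier \<phi> \<xi> * cis (z \<bullet> \<xi>))" for z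
      by (intro integrable_mult_cis schwartz_fourier_integrable \<phi>) simp
    have "F \<xi> y = riesz_kernel s y *\<^sub>R (fourier \<phi> \<xi> * cis (x \<bullet> \<xi>)
        - (fourier \<phi> \<xi> * cis ((x + y) \<bullet> \<xi>) + fourier \<phi> \<xi> * cis ((x - y) \<bullet> \<xi>)) / 2)" for \<xi>
    proof -
      have cc: "of_real (cos (y \<bullet> \<xi>)) = (cis (y \<bullet> \<xi>) + cis (- (y \<bullet> \<xi>))) / 2"
        by (simp add: complex_eq_iff)
      have "cis ((x + y) \<bullet> \<xi>) = cis (x \<bullet> \<xi>) * cis (y \<bullet> \<xi>)"
        "cis ((x - y) \<bullet> \<xi>) = cis (x \<bullet> \<xi>) * cis (- (y \<bullet> \<xi>))"
        by (simp_all add: cis_mult inner_add_left inner_diff_left)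
      then show ?thesis
        unfolding F_def by (simp add: scaleR_conv_of_real cc field_simps)
    qed
    then have "(LINT \<xi>|lborel. F \<xi> y) = riesz_kernel s y *\<^sub>R (I x - (I (x + y) + I (x - y)) / 2)"
      unfolding I_def by (simp add: int)
    then show "(LINT \<xi>|lborel. F \<xi> y) = riesz_kernel s y *\<^sub>R (\<phi> x - (\<phi> (x + y) + \<phi> (x - y)) / 2)"
      by (simp only: I)
  qed
  finally show ?thesis .
qed

lemma lborel_integrable_translation:
  fixes f :: "'a::euclidean_space \<Rightarrow> 'b::{banach, second_countable_topology}"
  assumes "integrable lborel f"
  shows "integrable lborel (\<lambda>y. f (x + y))" "integrable lborel (\<lambda>y. f (x - y))"
proof -
  have m [measurable]: "f \<in> borel_measurable borel" using borel_measurable_integrable[OF assms] by simp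
  show "integrable lborel (\<lambda>y. f (x + y))"
    using assms unfolding integrable_iff_bounded
    using nn_integral_lborel_translation[of "\<lambda>y. ennreal (norm (f y))" x] by (simp add: add.commute)
  show "integrable lborel (\<lambda>y. f (x - y))"
    using assms unfolding integrable_iff_bounded
    using nn_integral_lborel_reflect[of "\<lambda>y. ennreal (norm (f y))" x] by simp
qed

lemma lborel_integral_translation:
  fixes f :: "'a::euclidean_space \<Rightarrow> real"
  assumes [measurable]: "f \<in> borel_measurable borel" and "\<And>y. 0 \<le> f y"
  shows "(LINT y|lborel. f (x + y)) = (LINT y|lborel. f y)" "(LINT y|lborel. f (x - y)) = (LINT y|lborel. f y)"
  using nn_integral_lborel_translation[of "\<lambda>y. ennreal (f y)" x]
    nn_integral_lborel_reflect[of "\<lambda>y. ennreal (f y)" x]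
  by (simp_all add: integral_eq_nn_integral assms(2) add.commute)

text \<open>For |y| < 1 the second difference gains |y|^2 and inherits the decay of the second
  derivatives. For |y| >= 1 the term \<phi> x meets the integrable tail of the kernel. For \<phi> (x
  + y) and \<phi> (x - y) it is the kernel that supplies the decay in x, since it is at most D^2
  times the weight at the shifted point divided by the weight at x.\<close>

lemma frac_laplacian_bound:
  fixes \<phi> :: "real^'n::finite \<Rightarrow> complex"
  assumes \<phi>: "\<phi> \<in> schwartz" and s: "0 < s" "s < 1"
  obtains C where "0 < C" "\<And>x. norm (frac_laplacian s \<phi> x) \<le> C / weight s x"
proof -
  obtain c where c: "0 < c"
    "\<And>\<xi>::real^'n. (LINT y|lborel. (1 - cos (y \<bullet> \<xi>)) * riesz_kernel s y) = c * norm \<xi> powr (2 * s)"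
    using riesz_kernel_cos_integral[OF s] by blast
  obtain C2 where C2: "0 < C2" "\<And>i j x. norm (partial_deriv j (partial_deriv i \<phi>) x) \<le> C2 / weight s x"
    using schwartz_second_deriv_bound[OF \<phi>, of s] s by auto
  obtain C1 where C1: "0 < C1" "\<And>x. norm (\<phi> x) \<le> C1 / (weight s x * weight s x)"
    using schwartz_weight_bound[OF \<phi>, of s] s by auto
  have C1': "norm (\<phi> x) \<le> C1 / weight s x" for x
  proof -
    have "C1 / (weight s x * weight s x) \<le> C1 / weight s x"
      using C1(1) weight_ge_1[OF s(1), of x] by (intro divide_left_mono) auto
    then show ?thesis using C1(2)[of x] by linarith
  qed
  note [measurable] = schwartz_measurable[OF \<phi>]
  let ?n = "real CARD('n)"
  define D where "D = 2 powr ((?n + 2 * s) / 2)"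
  have D: "0 < D" by (simp add: D_def)
  define A where "A = ?n\<^sup>2 * C2 * D\<^sup>2"
  have A: "0 \<le> A" using C2(1) by (simp add: A_def)
  define k1 where "k1 y = indicator (ball 0 1) y * ((norm y)\<^sup>2 * riesz_kernel s y)" for y :: "real^'n"
  define k2 where "k2 y = indicator (- ball 0 1) y * riesz_kernel s y" for y :: "real^'n"
  define w where "w y = weight s y * norm (\<phi> y)" for y
  have ik1: "integrable lborel k1" unfolding k1_def by (rule integrable_riesz_kernel_inner[OF s(2)])
  have ik2: "integrable lborel k2" unfolding k2_def by (rule integrable_riesz_kernel_outer[OF s(1)])
  have mw: "w \<in> borel_measurable borel" unfolding w_def by measurable
  have w0: "0 \<le> w y" for y by (simp add: w_def)
  have iw: "integrable lborel w"
  proof -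
    have "norm (w y) \<le> C1 / weight s y" for y
      using mult_left_mono[OF C1(2)[of y], of "weight s y"] by (simp add: w_def)
    from integrable_weight_bound[OF measurable_completion[of _ lborel] s(1) this] mw
    show ?thesis by (simp add: integrable_completion)
  qed
  define \<Delta> where "\<Delta> x y = \<phi> x - (\<phi> (x + y) + \<phi> (x - y)) / 2" for x y
  \<comment> \<open>Each summand is 1 / \<open>weight s x\<close> times a function whose y-integral
    does not depend on x, for the last one by translation and reflection invariance. Hence
    \<open>h x\<close> integrates to I / \<open>weight s x\<close>.\<close>
  define h where "h x y = (A / weight s x) * k1 y + ((C1 / weight s x) * k2 y + (D * D / weight s x) * (w (x + y) + w (x - y)))" for x y
  have ih: "integrable lborel (h x)" for x
    unfolding h_def
    by (intro Bochner_Integration.integrable_add integrable_mult_right ik1 ik2 lborel_integrable_translation iw)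
  have le_h: "norm (riesz_kernel s y *\<^sub>R \<Delta> x y) \<le> h x y" for x y
  proof (cases "norm y < 1")
    case True
    have "norm (partial_deriv j (partial_deriv i \<phi>) (x + u)) \<le> C2 * (D\<^sup>2 / weight s x)" if "norm u \<le> norm y" for u i j
    proof -
      have "norm (partial_deriv j (partial_deriv i \<phi>) (x + u)) \<le> C2 * (1 / weight s (x + u))"
        using C2(2) by simp
      also have "\<dots> \<le> C2 * (D\<^sup>2 / weight s x)"
        unfolding D_def using C2(1) that True s by (intro mult_left_mono inverse_weight_unit_shift_le) auto
      finally show ?thesis .
    qed
    from norm_second_difference_le[OF \<phi> this]
    have "norm (\<phi> (x + y) + \<phi> (x - y) - 2 * \<phi> x) \<le> 2 * ?n\<^sup>2 * (C2 * (D\<^sup>2 / weight s x)) * (norm y)\<^sup>2" .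
    moreover have "norm (\<Delta> x y) = norm (\<phi> (x + y) + \<phi> (x - y) - 2 * \<phi> x) / 2"
    proof -
      have "\<Delta> x y = - ((\<phi> (x + y) + \<phi> (x - y) - 2 * \<phi> x) / 2)" by (simp add: \<Delta>_def field_simps)
      then show ?thesis by (simp only: norm_minus_cancel norm_divide norm_numeral)
    qed
    ultimately have "norm (\<Delta> x y) \<le> A / weight s x * (norm y)\<^sup>2" by (simp add: A_def)
    then have "riesz_kernel s y * norm (\<Delta> x y) \<le> riesz_kernel s y * (A / weight s x * (norm y)\<^sup>2)"
      by (intro mult_left_mono) auto
    also have "\<dots> = (A / weight s x) * k1 y" using True by (simp add: k1_def)
    also have "\<dots> \<le> h x y"
      using C1(1) D w0[of "x + y"] w0[of "x - y"] by (simp add: h_def k2_def)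
    finally show ?thesis by simp
  next
    case False
    have K: "riesz_kernel s y \<le> D / weight s y"
      unfolding D_def using False by (intro riesz_kernel_le_weight s(1)) auto
    \<comment> \<open>\<open>inverse_weight_le\<close> with the shifts - (x + y) and - (x - y),
      which take x to - y and to y; the weight is even.\<close>
    have wy: "1 / weight s y \<le> D * weight s (x + y) / weight s x" "1 / weight s y \<le> D * weight s (x - y) / weight s x"
      using inverse_weight_le[OF s(1), of x "- (x + y)"] inverse_weight_le[OF s(1), of x "- (x - y)"]
      unfolding weight_minus D_def by (simp_all add: weight_minus[of s y, symmetric] del: weight_minus)
    have tail: "riesz_kernel s y * norm (\<phi> z) \<le> D * D / weight s x * w z" if "1 / weight s y \<le> D * weight s z / weight s x" for z
    proof -
      have "riesz_kernel s y \<le> D * (1 / weight s y)" using K by simp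
      also have "\<dots> \<le> D * (D * weight s z / weight s x)" using that D by (intro mult_left_mono) auto
      finally have "riesz_kernel s y * norm (\<phi> z) \<le> D * (D * weight s z / weight s x) * norm (\<phi> z)"
        by (intro mult_right_mono) auto
      then show ?thesis by (simp add: w_def)
    qed
    have nonneg: "0 \<le> D * D / weight s x * w z" for z using D w0 by simp
    have "norm (\<Delta> x y) \<le> norm (\<phi> x) + norm ((\<phi> (x + y) + \<phi> (x - y)) / 2)"
      unfolding \<Delta>_def by (rule norm_triangle_ineq4)
    also have "norm ((\<phi> (x + y) + \<phi> (x - y)) / 2) \<le> norm (\<phi> (x + y)) + norm (\<phi> (x - y))"
    proof -
      have "norm ((\<phi> (x + y) + \<phi> (x - y)) / 2) = norm (\<phi> (x + y) + \<phi> (x - y)) / 2"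
        by (simp add: norm_divide)
      then show ?thesis
        using norm_triangle_ineq[of "\<phi> (x + y)" "\<phi> (x - y)"] norm_ge_zero[of "\<phi> (x + y) + \<phi> (x - y)"]
        by linarith
    qed
    finally have "riesz_kernel s y * norm (\<Delta> x y)
        \<le> riesz_kernel s y * (norm (\<phi> x) + (norm (\<phi> (x + y)) + norm (\<phi> (x - y))))"
      by (intro mult_left_mono) auto
    also have "\<dots> = riesz_kernel s y * norm (\<phi> x) + (riesz_kernel s y * norm (\<phi> (x + y)) + riesz_kernel s y * norm (\<phi> (x - y)))"
      by (simp add: distrib_left)
    also have "\<dots> \<le> (C1 / weight s x) * k2 y + (D * D / weight s x * w (x + y) + D * D / weight s x * w (x - y))"
    proof (intro add_mono tail wy)
      have "norm (\<phi> x) * riesz_kernel s y \<le> C1 / weight s x * riesz_kernel s y"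
        using C1'[of x] by (intro mult_right_mono) auto
      then show "riesz_kernel s y * norm (\<phi> x) \<le> (C1 / weight s x) * k2 y"
        using False by (simp add: k2_def mult.commute)
    qed
    also have "\<dots> = h x y" using False by (simp add: h_def k1_def distrib_left)
    finally show ?thesis by simp
  qed
  define I where "I = A * (LINT y|lborel. k1 y) + (C1 * (LINT y|lborel. k2 y) + D * D * ((LINT y|lborel. w y) + (LINT y|lborel. w y)))"
  have I0: "0 \<le> I"
    unfolding I_def using A C1(1) D w0
    by (intro add_nonneg_nonneg mult_nonneg_nonneg integral_nonneg_AE) (auto simp: k1_def k2_def)
  have Ih: "(LINT y|lborel. h x y) = I / weight s x" for x
  proof -
    have "(LINT y|lborel. h x y) = (A / weight s x) * (LINT y|lborel. k1 y) + ((C1 / weight s x) * (LINT y|lborel. k2 y)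
        + (D * D / weight s x) * ((LINT y|lborel. w (x + y)) + (LINT y|lborel. w (x - y))))"
      unfolding h_def
      by (simp only: Bochner_Integration.integral_add integrable_mult_right ik1 ik2 lborel_integrable_translation iw
          Bochner_Integration.integrable_add integral_mult_right_zero)
    then show ?thesis
      unfolding lborel_integral_translation[OF mw w0] by (simp add: I_def add_divide_distrib)
  qed
  \<comment> \<open>I is known only to be nonnegative; adding 1 makes the constant positive.\<close>
  have "norm (frac_laplacian s \<phi> x) \<le> (I / c + 1) / weight s x" for x
  proof -
    have "c * norm (frac_laplacian s \<phi> x) = norm (LINT y|lborel. riesz_kernel s y *\<^sub>R \<Delta> x y)"
      using frac_laplacian_singular_integral[OF \<phi> s c(2), of x] c(1) unfolding \<Delta>_def
      by (metis abs_of_pos norm_scaleR)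
    also have "\<dots> \<le> (LINT y|lborel. h x y)"
    proof (rule Bochner_Integration.integral_norm_bound_integral)
      show "integrable lborel (\<lambda>y. riesz_kernel s y *\<^sub>R \<Delta> x y)"
      proof (rule Bochner_Integration.integrable_bound[OF ih[of x]])
        show "(\<lambda>y. riesz_kernel s y *\<^sub>R \<Delta> x y) \<in> borel_measurable lborel"
          unfolding \<Delta>_def by measurable
        show "AE y in lborel. norm (riesz_kernel s y *\<^sub>R \<Delta> x y) \<le> norm (h x y)"
          using le_h order_trans[OF _ abs_ge_self] by (intro AE_I2) (simp only: real_norm_def, blast)
      qed
    qed (use le_h ih in auto)
    finally have "c * norm (frac_laplacian s \<phi> x) \<le> I / weight s x" unfolding Ih .
    then have "norm (frac_laplacian s \<phi> x) \<le> I / c / weight s x" using c(1) by (simp add: field_simps)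
    also have "\<dots> \<le> (I / c + 1) / weight s x" by (intro divide_right_mono) auto
    finally show ?thesis .
  qed
  moreover have "0 < I / c + 1" using I0 c(1) by (simp add: add_nonneg_pos)
  ultimately show ?thesis using that by blast
qed

lemma frac_laplacian_poisson:
  fixes \<phi> :: "real^'n::finite \<Rightarrow> complex"
  assumes \<phi>: "\<phi> \<in> schwartz" and s: "0 < s" "s < 1"
  shows "(\<Sum>\<^sub>\<infinity>k. frac_laplacian s \<phi> (z + per k))
    = (\<Sum>\<^sub>\<infinity>k. norm (lattice_vec k) powr (2 * s) *\<^sub>R (fourier \<phi> (lattice_vec k) * cis (lattice_vec k \<bullet> z)))"
proof -
  define W where "W \<xi> = norm \<xi> powr (2 * s) *\<^sub>R fourier \<phi> \<xi>" for \<xi> :: "real^'n"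
  define f where "f y = W (y /\<^sub>R (2 * pi)) * cis ((y /\<^sub>R (2 * pi)) \<bullet> z)" for y
  have cW: "continuous_on A W" for A
    unfolding W_def using s
    by (intro continuous_intros continuous_on_powr' continuous_on_schwartz_fourier \<phi>) auto
  obtain C where C: "0 < C" "\<And>y. norm (W (y /\<^sub>R (2 * pi))) \<le> C / weight s y"
    unfolding W_def using symbol_fourier_bound[OF \<phi>, of s] s by (metis less_imp_le)
  obtain C' where C': "0 < C'" "\<And>x. norm (frac_laplacian s \<phi> x) \<le> C' / weight s x"
    using frac_laplacian_bound[OF \<phi> s] by blast
  have ff: "fourier f (lattice_vec k) = frac_laplacian s \<phi> (z - per k)" for k
  proof -
    define g where "g \<xi> = W \<xi> * cis ((z - per k) \<bullet> \<xi>)" for \<xi>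
    have "continuous_on UNIV g" unfolding g_def by (intro continuous_intros cW)
    then have mg: "g \<in> borel_measurable borel" by (rule borel_measurable_continuous_onI)
    have "f y * cis (- (y \<bullet> lattice_vec k)) = g (y /\<^sub>R (2 * pi))" for y
    proof -
      have "(y /\<^sub>R (2 * pi)) \<bullet> z + - (y \<bullet> lattice_vec k) = (z - per k) \<bullet> (y /\<^sub>R (2 * pi))"
        by (simp add: inner_diff_left inner_diff_right inner_commute field_simps)
      then show ?thesis by (simp only: f_def g_def mult.assoc cis_mult)
    qed
    then have "fourier f (lattice_vec k) = (1 / (2 * pi) ^ CARD('n)) *\<^sub>R (LINT y|lebesgue. g (y /\<^sub>R (2 * pi)))"
      by (simp only: fourier_def)
    also have "\<dots> = (LINT \<xi>|lebesgue. g \<xi>)"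
      using lebesgue_integral_scale[OF mg, of "2 * pi"] by simp
    finally show ?thesis by (simp add: g_def W_def frac_laplacian_def)
  qed
  have "(\<Sum>\<^sub>\<infinity>k. f (per k)) = (\<Sum>\<^sub>\<infinity>k. fourier f (lattice_vec k))"
  proof (rule poisson_summation_zero)
    show "continuous_on UNIV f"
      unfolding f_def by (intro continuous_intros continuous_on_compose2[OF cW[of UNIV]]) auto
    show "norm (f y) \<le> C / weight s y" for y using C(2)[of y] by (simp add: f_def norm_mult)
    have "(\<lambda>k. norm (frac_laplacian s \<phi> (z + per k))) summable_on UNIV"
      by (rule norm_summable_translates[OF s(1) C'(2)])
    from summable_on_lattice_minus[OF this]
    show "(\<lambda>k. norm (fourier f (lattice_vec k))) summable_on UNIV" unfolding ff by simp
  qed (rule s)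
  moreover have "f (per k) = norm (lattice_vec k) powr (2 * s) *\<^sub>R (fourier \<phi> (lattice_vec k) * cis (lattice_vec k \<bullet> z))" for k
    by (simp add: f_def W_def)
  ultimately show ?thesis
    using infsum_lattice_minus[of "\<lambda>k. frac_laplacian s \<phi> (z + per k)"] by (simp add: ff)
qed

lemma continuous_on_frac_laplacian:
  fixes \<phi> :: "real^'n::finite \<Rightarrow> complex"
  assumes "\<phi> \<in> schwartz" "0 < s" "s < 1"
  shows "continuous_on UNIV (frac_laplacian s \<phi>)"
proof -
  have "integrable lborel (\<lambda>\<xi>. norm \<xi> powr (2 * s) *\<^sub>R fourier \<phi> \<xi>)"
    using assms by (intro symbol_fourier_integrable) auto
  moreover from borel_measurable_integrable[OF this]
  have "(\<lambda>\<xi>. norm \<xi> powr (2 * s) *\<^sub>R fourier \<phi> \<xi>) \<in> borel_measurable lborel" .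
  ultimately have "integrable lebesgue (\<lambda>\<xi>. norm \<xi> powr (2 * s) *\<^sub>R fourier \<phi> \<xi>)"
    by (simp add: integrable_completion)
  from continuous_on_fourier_integral[OF this]
  show ?thesis by (simp add: frac_laplacian_def[abs_def] inner_commute)
qed

subsection \<open>Periodization of Schwartz functions\<close>

text \<open>Termwise differentiation: on a ball that contains x the weight is bounded, so the series
  of partial derivatives converges uniformly by the Weierstrass test. The differentiation theorem
  for series returns some limit g within the ball; uniqueness of sums identifies it with the
  periodization, and openness removes the restriction to the ball.\<close>

lemma periodization_has_derivative:
  fixes f :: "real^'n::finite \<Rightarrow> complex"
  assumes s: "0 < s" and d: "\<And>x. f differentiable (at x)"
    and C: "\<And>x. norm (f x) \<le> C / weight s x" and C': "\<And>i x. norm (partial_deriv i f x) \<le> C' / weight s x"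
  shows "(periodization f has_derivative (\<lambda>h. \<Sum>i\<in>UNIV. h $ i *\<^sub>R periodization (partial_deriv i f) x)) (at x)"
proof -
  let ?e = "enum_lattice :: nat \<Rightarrow> int^'n"
  let ?S = "ball 0 (norm x + 1) :: (real^'n) set"
  have C'0: "0 \<le> C'" using C' by (rule weight_bound_nonneg)
  obtain M where M: "0 < M" "\<And>z. z \<in> ?S \<Longrightarrow> weight s z \<le> M"
    using weight_bounded[OF bounded_ball[of "0::real^'n" "norm x + 1"], of s] by blast
  define a where "a k = C' * (2 powr ((real CARD('n) + 2 * s) / 2) * M) * (1 / weight s (per k))" for k :: "int^'n"
  have a: "a summable_on UNIV"
    unfolding a_def by (intro summable_on_cmult_right summable_lattice_weight s)
  have a0: "0 \<le> a k" for k using C'0 M(1) by (simp add: a_def)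
  have sa: "summable (\<lambda>j. a (?e j))" using summable_enum_lattice[of a] a a0 by simp
  have sumf: "(\<lambda>j. f (y + per (?e j))) sums periodization f y" for y
  proof -
    note sm = norm_summable_translates[OF s C, of y]
    show ?thesis
      unfolding periodization_def infsum_enum_lattice[OF sm]
      by (rule summable_sums[OF summable_norm_cancel[OF summable_enum_lattice[OF sm]]])
  qed
  define p where "p i y = periodization (partial_deriv i f) y" for i y
  have p: "p i y = (\<Sum>j. partial_deriv i f (y + per (?e j)))" for i y
    unfolding p_def periodization_def
    by (rule infsum_enum_lattice[OF norm_summable_translates[OF s C']])
  have unif: "uniform_limit ?S (\<lambda>N y. \<Sum>j<N. partial_deriv i f (y + per (?e j))) (p i) sequentially" for i
    unfolding p[abs_def]
  proof (rule Weierstrass_m_test[OF _ sa])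
    show "norm (partial_deriv i f (y + per (?e j))) \<le> a (?e j)" if "y \<in> ?S" for j y
      unfolding a_def by (rule weight_bound_translates[OF s C'0 C' M(2)[OF that]])
  qed
  have "\<exists>g. \<forall>y\<in>?S. (\<lambda>j. f (y + per (?e j))) sums g y \<and> (g has_derivative (\<lambda>h. \<Sum>i\<in>UNIV. h $ i *\<^sub>R p i y)) (at y within ?S)"
  proof (rule has_derivative_series)
    show "convex ?S" by simp
    show "((\<lambda>y. f (y + per (?e j))) has_derivative (\<lambda>h. \<Sum>i\<in>UNIV. h $ i *\<^sub>R partial_deriv i f (y + per (?e j)))) (at y within ?S)" for j y
    proof -
      have "((\<lambda>y. y + per (?e j)) has_derivative (\<lambda>h. h)) (at y within ?S)" by (auto intro!: derivative_eq_intros)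
      from has_derivative_compose[OF this has_derivative_partial_deriv[OF d]] show ?thesis .
    qed
    show "x \<in> ?S" by simp
    show "(\<lambda>j. f (x + per (?e j))) sums periodization f x" by (rule sumf)
    fix e :: real assume e: "0 < e"
    \<comment> \<open>The derivative is a sum over n coordinates, so each of them may deviate by e /
      n.\<close>
    define e' where "e' = e / real CARD('n)"
    have e': "0 < e'" using e by (simp add: e'_def)
    have "\<forall>\<^sub>F N in sequentially. \<forall>i. \<forall>y\<in>?S. dist (\<Sum>j<N. partial_deriv i f (y + per (?e j))) (p i y) < e'"
      using unif e' unfolding uniform_limit_iff by (intro eventually_all_finite) blast
    then show "\<forall>\<^sub>F N in sequentially. \<forall>y\<in>?S. \<forall>h. norm ((\<Sum>j<N. \<Sum>i\<in>UNIV. h $ i *\<^sub>R partial_deriv i f (y + per (?e j))) - (\<Sum>i\<in>UNIV. h $ i *\<^sub>R p i y)) \<le> e * norm h"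
    proof (rule eventually_mono, intro ballI allI)
      fix N y and h :: "real^'n"
      assume N: "\<forall>i. \<forall>y\<in>?S. dist (\<Sum>j<N. partial_deriv i f (y + per (?e j))) (p i y) < e'" and y: "y \<in> ?S"
      have "(\<Sum>j<N. \<Sum>i\<in>UNIV. h $ i *\<^sub>R partial_deriv i f (y + per (?e j))) - (\<Sum>i\<in>UNIV. h $ i *\<^sub>R p i y)
          = (\<Sum>i\<in>UNIV. h $ i *\<^sub>R ((\<Sum>j<N. partial_deriv i f (y + per (?e j))) - p i y))"
        by (subst sum.swap) (simp add: scaleR_diff_right sum_subtractf scaleR_sum_right)
      moreover have "norm (\<Sum>i\<in>UNIV. h $ i *\<^sub>R ((\<Sum>j<N. partial_deriv i f (y + per (?e j))) - p i y))
          \<le> real CARD('n) * e' * norm h"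
        using N y by (intro norm_partial_sum_le) (auto simp: dist_norm less_imp_le)
      ultimately show "norm ((\<Sum>j<N. \<Sum>i\<in>UNIV. h $ i *\<^sub>R partial_deriv i f (y + per (?e j))) - (\<Sum>i\<in>UNIV. h $ i *\<^sub>R p i y)) \<le> e * norm h"
        by (simp add: e'_def)
    qed
  qed
  then obtain g where g0: "\<forall>y\<in>?S. (\<lambda>j. f (y + per (?e j))) sums g y \<and>
      (g has_derivative (\<lambda>h. \<Sum>i\<in>UNIV. h $ i *\<^sub>R p i y)) (at y within ?S)" ..
  have "x \<in> ?S" by simp
  with g0 have g: "\<And>y. y \<in> ?S \<Longrightarrow> (\<lambda>j. f (y + per (?e j))) sums g y"
    "(g has_derivative (\<lambda>h. \<Sum>i\<in>UNIV. h $ i *\<^sub>R p i x)) (at x within ?S)"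
    by blast+
  have "g y = periodization f y" if "y \<in> ?S" for y
    using sums_unique2[OF g(1)[OF that] sumf] .
  moreover have "(g has_derivative (\<lambda>h. \<Sum>i\<in>UNIV. h $ i *\<^sub>R p i x)) (at x)"
    using g(2) at_within_open[of x ?S] by simp
  ultimately have "(periodization f has_derivative (\<lambda>h. \<Sum>i\<in>UNIV. h $ i *\<^sub>R p i x)) (at x)"
    using has_derivative_transform_within_open[of g _ x UNIV ?S "periodization f"] by simp
  then show ?thesis by (simp add: p_def)
qed

lemma schwartz_periodization_has_derivative:
  fixes \<phi> :: "real^'n::finite \<Rightarrow> complex"
  assumes \<phi>: "\<phi> \<in> schwartz"
  shows "(periodization \<phi> has_derivative (\<lambda>h. \<Sum>i\<in>UNIV. h $ i *\<^sub>R periodization (partial_deriv i \<phi>) x)) (at x)"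
proof -
  obtain C where C: "\<And>x. norm (\<phi> x) \<le> C / weight 1 x"
    using schwartz_weight_bound1[OF \<phi> zero_less_one order_refl] by blast
  obtain C' where C': "\<And>j x. norm (partial_deriv j \<phi> x) \<le> C' / weight 1 x"
    by (rule schwartz_partial_deriv_bound[OF \<phi> zero_less_one order_refl]) (rule that)
  have d: "\<phi> differentiable (at x)" for x
    using schwartz_differentiable[OF \<phi>, of "[]"] by simp
  show ?thesis by (rule periodization_has_derivative[OF zero_less_one d C C'])
qed

lemma iter_deriv_periodization:
  fixes \<phi> :: "real^'n::finite \<Rightarrow> complex"
  assumes \<phi>: "\<phi> \<in> schwartz"
  shows "iter_deriv \<gamma> (periodization \<phi>) = periodization (iter_deriv \<gamma> \<phi>)"
proof (induction \<gamma>)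
  case (Cons i \<gamma>)
  have "partial_deriv i (periodization (iter_deriv \<gamma> \<phi>)) x = periodization (partial_deriv i (iter_deriv \<gamma> \<phi>)) x" for x
    using partial_deriv_eqI[OF schwartz_periodization_has_derivative[OF schwartz_iter_deriv[OF \<phi>]]]
    by (simp add: sum_axis_scaleR)
  then show ?case using Cons by auto
qed simp

lemma periodization_periodic:
  "periodization f (x + per l) = periodization f x"
proof -
  have "periodization f (x + per l) = (\<Sum>\<^sub>\<infinity>k. f (x + per (k + l)))"
    unfolding periodization_def by (simp add: lattice_vec_add scaleR_add_right add_ac)
  also have "\<dots> = periodization f x"
    unfolding periodization_def
    by (rule infsum_reindex_bij_betw[of "\<lambda>k. k + l" UNIV UNIV "\<lambda>k. f (x + per k)"])
      (auto intro!: bij_betw_byWitness[where f'="\<lambda>k. k - l"])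
  finally show ?thesis .
qed

lemma periodization_torus_smooth: "\<phi> \<in> schwartz \<Longrightarrow> periodization \<phi> \<in> torus_smooth"
  unfolding torus_smooth_def smooth_def
  using schwartz_periodization_has_derivative[OF schwartz_iter_deriv]
  by (auto simp: iter_deriv_periodization periodization_periodic intro: differentiableI)

text \<open>Unfolding: the character e^(-i k . z) has the lattice as periods, so it comes out of the
  sum over translates.\<close>

lemma fourier_coeff_periodization:
  fixes \<phi> :: "real^'n::finite \<Rightarrow> complex"
  assumes \<phi>: "\<phi> \<in> schwartz"
  shows "fourier_coeff (periodization \<phi>) k = fourier \<phi> (lattice_vec k)"
proof -
  let ?g = "\<lambda>x. \<phi> x * cis (- (lattice_vec k \<bullet> x))"
  obtain C where C: "\<And>x. norm (\<phi> x) \<le> C / weight 1 x"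
    using schwartz_weight_bound1[OF \<phi> zero_less_one order_refl] by blast
  have "continuous_on UNIV ?g" by (intro continuous_intros schwartz_continuous \<phi>)
  then have m: "?g \<in> borel_measurable lebesgue"
    by (intro measurable_completion) (simp add: borel_measurable_continuous_onI)
  have "(LINT x|lebesgue. ?g x) = (LINT z:cell|lebesgue. \<Sum>\<^sub>\<infinity>l. ?g (z + per l))"
    by (rule integral_unfold_weight[OF m zero_less_one, of C]) (use C in \<open>auto simp: norm_mult\<close>)
  also have "\<dots> = (LINT z:cell|lebesgue. periodization \<phi> z * cis (- (lattice_vec k \<bullet> z)))"
    unfolding cis_minus_lattice_periodic periodization_def by (simp add: infsum_cmult_left')
  finally show ?thesis
    unfolding fourier_coeff_def fourier_def by (simp add: inner_commute)
qed

subsection \<open>The repetition of a function on the cell\<close>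

lemma repetition_translate:
  assumes "z \<in> cell"
  shows "repetition v (z + per k) = v z"
  using repetition_eq[of "z + per k" k v] assms by simp

lemma repetition_measurable:
  fixes v :: "real^'n::finite \<Rightarrow> real"
  assumes "set_integrable lebesgue cell v"
  shows "repetition v \<in> borel_measurable lebesgue"
proof -
  let ?e = "enum_lattice :: nat \<Rightarrow> int^'n"
  \<comment> \<open>Measurability of v is known on the cell only, hence the cut-off; the series of
    its translates has at most one nonzero term at each point.\<close>
  define v0 where "v0 x = v x * indicator cell x" for x
  have m: "v0 \<in> borel_measurable lebesgue"
    using borel_measurable_integrable[OF assms[unfolded set_integrable_def]]
    by (simp add: v0_def[abs_def] mult.commute)
  have "repetition v x = (\<Sum>j. v0 (x - per (?e j)))" for x
  proof -
    obtain k where k: "\<And>l. x - per l \<in> cell \<Longrightarrow> l = k"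
      using cell_translate_unique[of x] by blast
    have zero: "v0 (x - per l) = 0" if "l \<noteq> k" for l
      using that k[of l] by (auto simp: v0_def indicator_def)
    have "(\<lambda>l. norm (v0 (x - per l))) summable_on {k}" by simp
    moreover have "(\<lambda>l. norm (v0 (x - per l))) summable_on {k} \<longleftrightarrow> (\<lambda>l. norm (v0 (x - per l))) summable_on UNIV"
      by (intro summable_on_cong_neutral) (auto simp: zero)
    ultimately have "(\<lambda>l. norm (v0 (x - per l))) summable_on UNIV" by blast
    from infsum_enum_lattice[OF this] show ?thesis by (simp add: repetition_def v0_def)
  qed
  moreover have "(\<lambda>x. v0 (x - per k)) \<in> borel_measurable lebesgue" for k
    using measurable_compose[OF lebesgue_translation_measurable[of "- per k"] m] by simp
  then have "(\<lambda>x. \<Sum>j. v0 (x - per (?e j))) \<in> borel_measurable lebesgue"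
    by (rule borel_measurable_suminf)
  ultimately show ?thesis by (simp add: fun_eq_iff[symmetric] cong: measurable_cong)
qed

text \<open>The unfolding lemma with cell factor |v|: at z + \<open>per k\<close> the repetition
  equals v z, so the decay of \<Phi> controls the lattice sum. It is applied to the reciprocal
  weight, to test functions and to the fractional Laplacian of a Schwartz function.\<close>

lemma
  fixes v :: "real^'n::finite \<Rightarrow> real" and \<Phi> :: "real^'n \<Rightarrow> 'b::{banach, second_countable_topology}"
  assumes v: "set_integrable lebesgue cell v"
    and \<Phi>: "\<Phi> \<in> borel_measurable lebesgue" and s: "0 < s" and C: "\<And>x. norm (\<Phi> x) \<le> C / weight s x"
  shows integrable_repetition: "integrable lebesgue (\<lambda>x. repetition v x *\<^sub>R \<Phi> x)"
    and set_integrable_repetition: "set_integrable lebesgue cell (\<lambda>z. v z *\<^sub>R (\<Sum>\<^sub>\<infinity>k. \<Phi> (z + per k)))"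
    and integral_repetition: "(LINT x|lebesgue. repetition v x *\<^sub>R \<Phi> x)
      = (LINT z:cell|lebesgue. v z *\<^sub>R (\<Sum>\<^sub>\<infinity>k. \<Phi> (z + per k)))"
proof -
  let ?F = "\<lambda>x. repetition v x *\<^sub>R \<Phi> x"
  have C0: "0 \<le> C" using C by (rule weight_bound_nonneg)
  obtain M where M: "0 < M" "\<And>z::real^'n. z \<in> cell \<Longrightarrow> weight s z \<le> M"
    using weight_bounded[OF bounded_cell, of s] by blast
  define a where "a k = C * (2 powr ((real CARD('n) + 2 * s) / 2) * M) * (1 / weight s (per k))" for k :: "int^'n"
  have a: "a summable_on UNIV"
    unfolding a_def by (intro summable_on_cmult_right summable_lattice_weight s)
  have a0: "0 \<le> a k" for k using C0 M(1) by (simp add: a_def)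
  have m: "?F \<in> borel_measurable lebesgue"
    using repetition_measurable[OF v] \<Phi> by measurable
  have b: "set_integrable lebesgue cell (\<lambda>z. \<bar>v z\<bar>)" using set_integrable_abs[OF v] .
  have bound: "norm (?F (z + per k)) \<le> a k * \<bar>v z\<bar>" if "z \<in> cell" for k z
  proof -
    have "norm (?F (z + per k)) = norm (\<Phi> (z + per k)) * \<bar>v z\<bar>"
      by (simp add: repetition_translate[OF that])
    also have "\<dots> \<le> a k * \<bar>v z\<bar>"
      unfolding a_def by (intro mult_right_mono weight_bound_translates[OF s C0 C M(2)[OF that]]) simp
    finally show ?thesis .
  qed
  have eq: "indicator cell z *\<^sub>R (\<Sum>\<^sub>\<infinity>k. ?F (z + per k)) = indicator cell z *\<^sub>R (v z *\<^sub>R (\<Sum>\<^sub>\<infinity>k. \<Phi> (z + per k)))" for z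
    by (cases "z \<in> cell") (simp_all add: repetition_translate infsum_scaleR_right)
  show "integrable lebesgue ?F" by (rule integrable_unfold[OF m b a a0 bound])
  show "set_integrable lebesgue cell (\<lambda>z. v z *\<^sub>R (\<Sum>\<^sub>\<infinity>k. \<Phi> (z + per k)))"
    using set_integrable_periodize[OF m b a a0 bound] unfolding set_integrable_def eq .
  show "(LINT x|lebesgue. ?F x) = (LINT z:cell|lebesgue. v z *\<^sub>R (\<Sum>\<^sub>\<infinity>k. \<Phi> (z + per k)))"
    using integral_unfold[OF m b a a0 bound] unfolding set_lebesgue_integral_def eq .
qed

lemma integrable_repetition_weight:
  fixes v :: "real^'n::finite \<Rightarrow> real"
  assumes "set_integrable lebesgue cell v" "0 < s"
  shows "integrable lebesgue (\<lambda>x. repetition v x * (1 / weight s x))"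
proof -
  have "(\<lambda>x::real^'n. 1 / weight s x) \<in> borel_measurable lebesgue"
    by (intro measurable_completion) simp
  from integrable_repetition[OF assms(1) this assms(2), of 1] show ?thesis by simp
qed

lemma repetition_L_space:
  fixes v :: "real^'n::finite \<Rightarrow> real"
  assumes "set_integrable lebesgue cell v" "0 < s"
  shows "repetition v \<in> L_space s"
proof -
  have "(\<lambda>x::real^'n. 1 / weight s x) \<in> borel_measurable lebesgue"
    by (intro measurable_completion) simp
  then show ?thesis
    using integrable_repetition_weight[OF assms] repetition_measurable[OF assms(1)]
    unfolding L_space_def by (simp add: integrable_density)
qed

section \<open>Test functions and the continuity of their pairing with the repetition\<close>

lemma S_space_weight_bound:
  assumes "\<phi> \<in> S_space s"
  obtains C where "\<And>x. norm (\<phi> x) \<le> C / weight s x"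
proof -
  have "bounded (range (\<lambda>x. weight s x *\<^sub>R iter_deriv [] \<phi> x))"
    using assms unfolding S_space_def by blast
  then obtain C where "\<And>x. norm (weight s x *\<^sub>R \<phi> x) \<le> C"
    unfolding bounded_iff by auto
  then have "norm (\<phi> x) \<le> C / weight s x" for x
    by (simp add: le_divide_eq mult.commute)
  then show ?thesis using that by blast
qed

lemma S_space_measurable:
  assumes "\<phi> \<in> S_space s"
  shows "\<phi> \<in> borel_measurable lebesgue"
proof -
  have "iter_deriv [] \<phi> differentiable (at x)" for x
    using assms unfolding S_space_def smooth_def by blast
  then have "continuous_on UNIV \<phi>"
    by (auto intro!: continuous_at_imp_continuous_on differentiable_imp_continuous_within)
  then show ?thesis by (intro measurable_completion) (simp add: borel_measurable_continuous_onI)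
qed

lemma S_space_norm_diff_le_seminorm:
  assumes "\<phi> \<in> S_space s" "\<psi> \<in> S_space s"
  shows "norm (\<psi> x - \<phi> x) \<le> S_seminorm s [] (\<lambda>x. \<psi> x - \<phi> x) / weight s x"
proof -
  obtain C C' where C: "\<And>x. norm (\<phi> x) \<le> C / weight s x" "\<And>x. norm (\<psi> x) \<le> C' / weight s x"
    using S_space_weight_bound[OF assms(1)] S_space_weight_bound[OF assms(2)] by metis
  \<comment> \<open>\<open>S_seminorm\<close> is a supremum of reals, which is an upper bound only
    once the set is known to be bounded above.\<close>
  have "bdd_above (range (\<lambda>x. norm (weight s x *\<^sub>R iter_deriv [] (\<lambda>x. \<psi> x - \<phi> x) x)))"
  proof (rule bdd_aboveI2)
    fix x
    have "norm (\<psi> x - \<phi> x) \<le> C' / weight s x + C / weight s x"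
      using norm_triangle_ineq4[of "\<psi> x" "\<phi> x"] C(1)[of x] C(2)[of x] by linarith
    then have "weight s x * norm (\<psi> x - \<phi> x) \<le> C' + C"
      by (simp add: field_simps)
    then show "norm (weight s x *\<^sub>R iter_deriv [] (\<lambda>x. \<psi> x - \<phi> x) x) \<le> C' + C"
      by simp
  qed
  then have "norm (weight s x *\<^sub>R iter_deriv [] (\<lambda>x. \<psi> x - \<phi> x) x) \<le> S_seminorm s [] (\<lambda>x. \<psi> x - \<phi> x)"
    unfolding S_seminorm_def by (rule cSUP_upper[rotated]) simp
  then show ?thesis by (simp add: le_divide_eq mult.commute)
qed

text \<open>The functional is Lipschitz for the seminorm with index \<open>[]\<close>; the constant
  J is the norm of the repetition in the weighted L1 space. So a single generating set of the
  topology serves as neighbourhood.\<close>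

lemma repetition_defines_S_distribution:
  fixes v :: "real^'n::finite \<Rightarrow> real"
  assumes v: "set_integrable lebesgue cell v" and s: "0 < s"
  shows "defines_S_distribution s (repetition v)"
proof -
  let ?u = "repetition v"
  define T where "T \<phi> = (LINT x|lebesgue. ?u x *\<^sub>R \<phi> x)" for \<phi> :: "real^'n \<Rightarrow> complex"
  have int: "integrable lebesgue (\<lambda>x. ?u x *\<^sub>R \<phi> x)" if "\<phi> \<in> S_space s" for \<phi> :: "real^'n \<Rightarrow> complex"
  proof -
    obtain C where "\<And>x. norm (\<phi> x) \<le> C / weight s x" using S_space_weight_bound[OF \<open>\<phi> \<in> S_space s\<close>] by blast
    from integrable_repetition[OF v S_space_measurable[OF that] s this] show ?thesis .
  qed
  define J where "J = (LINT x|lebesgue. \<bar>?u x * (1 / weight s x)\<bar>)"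
  have J: "0 \<le> J" by (simp add: J_def)
  have T_diff: "norm (T \<psi> - T \<phi>) \<le> J * S_seminorm s [] (\<lambda>x. \<psi> x - \<phi> x)"
    if "\<phi> \<in> S_space s" "\<psi> \<in> S_space s" for \<phi> \<psi>
  proof -
    let ?p = "S_seminorm s [] (\<lambda>x. \<psi> x - \<phi> x)"
    have "T \<psi> - T \<phi> = (LINT x|lebesgue. ?u x *\<^sub>R \<psi> x - ?u x *\<^sub>R \<phi> x)"
      unfolding T_def using int that by simp
    also have "norm \<dots> \<le> (LINT x|lebesgue. \<bar>?u x * (1 / weight s x)\<bar> * ?p)"
    proof (rule Bochner_Integration.integral_norm_bound_integral)
      show "integrable lebesgue (\<lambda>x. ?u x *\<^sub>R \<psi> x - ?u x *\<^sub>R \<phi> x)"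
        using int that by (intro Bochner_Integration.integrable_diff)
      show "integrable lebesgue (\<lambda>x. \<bar>?u x * (1 / weight s x)\<bar> * ?p)"
        by (intro integrable_mult_left integrable_abs integrable_repetition_weight v s)
      fix x
      have "norm (?u x *\<^sub>R \<psi> x - ?u x *\<^sub>R \<phi> x) = \<bar>?u x\<bar> * norm (\<psi> x - \<phi> x)"
        by (simp flip: scaleR_diff_right)
      also have "\<dots> \<le> \<bar>?u x\<bar> * (?p / weight s x)"
        by (intro mult_left_mono S_space_norm_diff_le_seminorm that) simp
      finally show "norm (?u x *\<^sub>R \<psi> x - ?u x *\<^sub>R \<phi> x) \<le> \<bar>?u x * (1 / weight s x)\<bar> * ?p"
        by (simp add: abs_mult)
    qed
    also have "\<dots> = J * ?p" unfolding J_def by (rule integral_mult_left_zero)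
    finally show ?thesis .
  qed
  define B where "B = {{\<psi> \<in> S_space s. S_seminorm s \<gamma> (\<lambda>x. \<psi> x - \<phi> x) < \<epsilon>} | \<gamma> (\<phi> :: real^'n \<Rightarrow> complex) \<epsilon>. \<phi> \<in> S_space s \<and> 0 < \<epsilon>}"
  have top: "S_topology s = topology_generated_by B" by (simp add: S_topology_def B_def)
  have cont: "continuous_map (S_topology s) euclidean T"
    unfolding continuous_map_def
  proof (intro conjI allI impI)
    fix U :: "complex set" assume "openin euclidean U"
    then have U: "open U" by simp
    show "openin (S_topology s) {\<phi> \<in> topspace (S_topology s). T \<phi> \<in> U}"
      unfolding openin_subopen[of _ "{\<phi> \<in> topspace (S_topology s). T \<phi> \<in> U}"]
    proof
      fix \<phi> assume "\<phi> \<in> {\<phi> \<in> topspace (S_topology s). T \<phi> \<in> U}"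
      then have \<phi>: "\<phi> \<in> S_space s" "T \<phi> \<in> U" by (auto simp: top B_def)
      then obtain \<epsilon> where \<epsilon>: "0 < \<epsilon>" "ball (T \<phi>) \<epsilon> \<subseteq> U" using U open_contains_ball by blast
      \<comment> \<open>The denominator is J + 1 because J may be 0.\<close>
      define \<delta> where "\<delta> = \<epsilon> / (J + 1)"
      have \<delta>: "0 < \<delta>" using \<epsilon> J by (simp add: \<delta>_def)
      define N where "N = {\<psi> \<in> S_space s. S_seminorm s [] (\<lambda>x. \<psi> x - \<phi> x) < \<delta>}"
      have NB: "N \<in> B" using \<phi>(1) \<delta> unfolding N_def B_def by blast
      have "openin (S_topology s) N" unfolding top by (rule topology_generated_by_Basis[OF NB])
      moreover have "\<phi> \<in> N" using \<phi>(1) \<delta> by (simp add: N_def S_seminorm_def)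
      moreover have "N \<subseteq> {\<phi> \<in> topspace (S_topology s). T \<phi> \<in> U}"
      proof
        fix \<psi> assume \<psi>: "\<psi> \<in> N"
        then have "norm (T \<psi> - T \<phi>) \<le> J * S_seminorm s [] (\<lambda>x. \<psi> x - \<phi> x)"
          using T_diff \<phi>(1) by (simp add: N_def)
        also have "\<dots> \<le> J * \<delta>" using \<psi> J by (intro mult_left_mono) (auto simp: N_def)
        also have "\<dots> < (J + 1) * \<delta>" using \<delta> by simp
        also have "\<dots> = \<epsilon>" using J by (simp add: \<delta>_def)
        finally have "T \<psi> \<in> U" using \<epsilon>(2) by (auto simp: dist_norm norm_minus_commute)
        moreover have "\<psi> \<in> topspace (S_topology s)" using NB \<psi> by (auto simp: top)
        ultimately show "\<psi> \<in> {\<phi> \<in> topspace (S_topology s). T \<phi> \<in> U}" by simp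
      qed
      ultimately show "\<exists>N. openin (S_topology s) N \<and> \<phi> \<in> N \<and> N \<subseteq> {\<phi> \<in> topspace (S_topology s). T \<phi> \<in> U}"
        by blast
    qed
  qed simp
  have "T \<in> S_dual s"
    unfolding S_dual_def
  proof (intro CollectI conjI ballI allI cont)
    fix \<phi> \<psi> :: "real^'n \<Rightarrow> complex" assume "\<phi> \<in> S_space s" "\<psi> \<in> S_space s"
    then show "T (\<lambda>x. \<phi> x + \<psi> x) = T \<phi> + T \<psi>" by (simp add: T_def scaleR_add_right int)
  next
    fix c and \<phi> :: "real^'n \<Rightarrow> complex"
    show "T (\<lambda>x. c * \<phi> x) = c * T \<phi>" by (simp add: T_def flip: mult_scaleR_right)
  qed
  then show ?thesis unfolding defines_S_distribution_def T_def[abs_def] using int by blast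
qed

section \<open>Comparison of the two fractional Laplacians\<close>

lemma torus_frac_laplacian_periodization:
  fixes \<phi> :: "real^'n::finite \<Rightarrow> complex"
  assumes "\<phi> \<in> schwartz" "0 < s" "s < 1"
  shows "torus_frac_laplacian s (periodization \<phi>) z = (\<Sum>\<^sub>\<infinity>k. frac_laplacian s \<phi> (z + per k))"
  unfolding torus_frac_laplacian_def frac_laplacian_poisson[OF assms]
  by (simp add: fourier_coeff_periodization[OF assms(1)])

theorem theorem1:
  fixes v :: "real^'n::finite \<Rightarrow> real" and \<sigma> :: real
  assumes "0 < \<sigma>" "\<sigma> < 1"
    and "set_integrable lebesgue cell v"
    and "(\<lambda>k. cmod (fourier_coeff (\<lambda>z. complex_of_real (v z)) k) *
               (exp (- (norm (lattice_vec k))\<^sup>2) / norm (lattice_vec k))) summable_on (UNIV - {0})"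
  shows "repetition v \<in> L_space \<sigma> \<and>
    defines_S_distribution \<sigma> (repetition v) \<and>
    (\<forall>\<phi>\<in>schwartz.
       integrable lebesgue (\<lambda>x. repetition v x *\<^sub>R frac_laplacian \<sigma> \<phi> x) \<and>
       set_integrable lebesgue cell (\<lambda>z. v z *\<^sub>R torus_frac_laplacian \<sigma> (periodization \<phi>) z) \<and>
       (LINT x|lebesgue. repetition v x *\<^sub>R frac_laplacian \<sigma> \<phi> x) =
         (LINT z:cell|lebesgue. v z *\<^sub>R torus_frac_laplacian \<sigma> (periodization \<phi>) z)) \<and>
    (\<forall>\<phi>\<in>schwartz. periodization \<phi> \<in> torus_smooth \<and>
       torus_frac_laplacian_dist \<sigma> v (periodization \<phi>) = frac_laplacian_dist \<sigma> (repetition v) \<phi>)"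
proof (intro conjI ballI)
  have v: "set_integrable lebesgue cell v" by (rule assms)
  show "repetition v \<in> L_space \<sigma>" by (rule repetition_L_space[OF v assms(1)])
  show "defines_S_distribution \<sigma> (repetition v)"
    by (rule repetition_defines_S_distribution[OF v assms(1)])
  fix \<phi> :: "real^'n \<Rightarrow> complex"
  assume \<phi>: "\<phi> \<in> schwartz"
  obtain C where C: "\<And>x. norm (frac_laplacian \<sigma> \<phi> x) \<le> C / weight \<sigma> x"
    using frac_laplacian_bound[OF \<phi> assms(1,2)] by blast
  have m: "frac_laplacian \<sigma> \<phi> \<in> borel_measurable lebesgue"
    using continuous_on_frac_laplacian[OF \<phi> assms(1,2)]
    by (intro measurable_completion) (simp add: borel_measurable_continuous_onI)
  \<comment> \<open>By this identity the torus Laplacian of the periodization is the lattice sum of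
    \<open>frac_laplacian \<sigma> \<phi>\<close>, so the claims about integrals are instances of
    the unfolding lemma for the repetition.\<close>
  note torus = torus_frac_laplacian_periodization[OF \<phi> assms(1,2)]
  show "integrable lebesgue (\<lambda>x. repetition v x *\<^sub>R frac_laplacian \<sigma> \<phi> x)"
    by (rule integrable_repetition[OF v m assms(1) C])
  show "set_integrable lebesgue cell (\<lambda>z. v z *\<^sub>R torus_frac_laplacian \<sigma> (periodization \<phi>) z)"
    unfolding torus by (rule set_integrable_repetition[OF v m assms(1) C])
  show eq: "(LINT x|lebesgue. repetition v x *\<^sub>R frac_laplacian \<sigma> \<phi> x)
      = (LINT z:cell|lebesgue. v z *\<^sub>R torus_frac_laplacian \<sigma> (periodization \<phi>) z)"
    unfolding torus by (rule integral_repetition[OF v m assms(1) C])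
  show "periodization \<phi> \<in> torus_smooth" by (rule periodization_torus_smooth[OF \<phi>])
  show "torus_frac_laplacian_dist \<sigma> v (periodization \<phi>) = frac_laplacian_dist \<sigma> (repetition v) \<phi>"
    unfolding torus_frac_laplacian_dist_def frac_laplacian_dist_def by (rule eq[symmetric])
qed

end
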